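(* A $\mathcal{PSB}$-algebra is the same as a pair $(\mathfrak{g},T)$ consisting of a Lie algebra $(\mathfrak{g},[-,-])$ and a linear map $T\in\operatorname{Hom}_{\mathbb{K}}(T(\mathfrak{g})\otimes\mathfrak{g},\mathfrak{g})$ satisfying the following four properties. (i) Let $\mathcal{K}$ be the ideal of $T(\mathfrak{g})$ generated by the elements $xy-yx-[x,y]$, $x,y\in\mathfrak{g}$. Then $T(\mathcal{K};z)=0$ for all $z\in\mathfrak{g}$. (ii) $T(1;y)=y$ for all $y\in\mathfrak{g}$. (iii) For any two monomials $X$ (of length $n$) and $Y=y_1\cdots y_m$ in $T(\mathfrak{g})$ and any $z\in\mathfrak{g}$, $$T(X;T(Y;z))=\sum_{J_0\sqcup\cdots\sqcup J_m=\{1,\dots,n\}}T\big(X_{J_0},T(X_{J_1};y_1),\dots,T(X_{J_m};y_m);z\big),$$ where the sum runs over all ordered partitions $(J_0,\dots,J_m)$ of $\{1,\dots,n\}$ into possibly empty subsets, with $X_\emptyset=1$. (iv) For all monomials $X\in T(\mathfrak{g})$ of length $n$ and all $x,y\in\mathfrak{g}$, $$T(X;[x,y])=\sum_{I\sqcup J=\{1,\dots,n\}}\big[T(X_I;x),T(X_J;y)\big],$$ where the sum runs over all ordered pairs of complementary, possibly empty, subsets. Here $[-,-]$ is the operation corresponding to the class in $\mathcal{PSB}(2)$ of $C(\bullet;1,2)$, and the restriction of $T$ to $\mathfrak{g}^{\otimes n}\otimes\mathfrak{g}$ is the operation corresponding to the class in $\mathcal{PSB}(n+1)$ of the corolla $C_{n+1}$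 ($n\ge0$).
   Context: Conventions. $\mathbb{K}$ is a field of characteristic zero. Operads are symmetric operads in $\mathbb{K}$-vector spaces, concentrated in arities $n\ge 1$, given by partial compositions $\circ_i:\mathcal{O}(m)\otimes\mathcal{O}(n)\to\mathcal{O}(m+n-1)$, $1\le i\le m$. An $\mathcal{O}$-algebra is a vector space $V$ with an operad morphism $\mathcal{O}\to\operatorname{End}_V$, $\operatorname{End}_V(n)=\operatorname{Hom}(V^{\otimes n},V)$. $T(\mathfrak{g})=\bigoplus_{n\ge0}\mathfrak{g}^{\otimes n}$ is the tensor algebra; for a monomial $X=x_1\cdots x_n$ and $I=\{i_1<\dots<i_k\}\subset\{1,\dots,n\}$, $X_I=x_{i_1}\cdots x_{i_k}$. The notation $T(X;z)$ means $T(X\otimes z)$, and commas before the semicolon denote tensor (concatenation) product in $T(\mathfrak g)$. Trees. A planar rooted tree is an isomorphism class of contractible graphs embedded in the plane with a distinguished root vertex carrying a root half-edge. Trees are drawn with the root at the bottom; edges are oriented toward the root; incoming edges of a vertex are ordered left to right. For a non-root vertex $v$, its $\prec$-successor $v^+$ is the target of its outgoing edge. A partially labeled tree with $n$ labels is a planar rooted tree $T$ with a subset $U$ of its vertices and a bijection $U\to\{1,\dots,n\}$; it is fully labeled if $U$ consists of all the vertices. $\mathcal{PT}_p(n)$ is the vector space with basis the partially labeled trees with $n$ labels, with $\mathbb{S}_n$ permuting labels. For $T\in\mathcal{PT}_p(m)$, $R\in\mathcal{PT}_p(n)$ trees and $1\le i\le m$, let $In(i)$ be the ordered set of incoming edges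 of the vertex of $T$ labeled $i$. For a map $\phi$ from $In(i)$ to the set of labeled vertices of $R$, $T\circ_i^\phi R$ is obtained by replacing the vertex $i$ by $R$ (identifying the outgoing edge of $i$ with the root-edge of $R$) and grafting, for each labeled vertex $w$ of $R$, the edges of $\phi^{-1}(w)$ onto $w$, in their order, to the left of all incoming edges $w$ has in $R$ (i.e. in the minimal angle of $w$); labels $<i$ of $T$ are kept, labels of $R$ are shifted by $i-1$, labels $>i$ of $T$ are shifted by $n-1$. Set $T\circ_i R=\sum_\phi T\circ_i^\phi R$. The operad $\mathcal{LW}$. $\mathcal{L}(n)$ is spanned by the fully labeled trees with $n$ vertices. For $n\ge2$, $\mathcal{W}(n)\subset\mathcal{PT}_p(n)$ is spanned by the partially labeled trees such that: (a) the root is unlabeled; (b) if a non-root vertex is unlabeled, so is its $\prec$-successor; (c) each unlabeled vertex has exactly two incoming edges. $\mathcal{LW}(1)=\mathcal{L}(1)$, $\mathcal{LW}(n)=\mathcal{L}(n)\oplus\mathcal{W}(n)$ for $n\ge2$. For a tree $R\in\mathcal{W}(n)$ with set of unlabeled vertices $V_{unl}(R)$ and $\sigma=(\sigma_v)_v\in\mathbb{S}_2^{V_{unl}(R)}$, $R_\sigma$ is obtained from $R$ by exchanging, at every unlabeled vertex $v$ with $\sigma_v\ne id$, the two maximal subtrees sitting above $v$ (labels move along with the vertices), and $\epsilon(\sigma)=\prod_v \mathrm{sign}(\sigma_v)$. $Con(R)$ is $R$ with all edges joining two unlabeled vertices contracted. For an unlabeled non-root vertex $r$, $Con_r$ contracts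 the edge from $r$ to $r^+$, the merged vertex keeping the label of $r^+$, if any. Partial compositions of $\mathcal{LW}$: for $T\in\mathcal{LW}(m)$ and $S\in\mathcal{L}(n)$, $T\circ_iS$ is as in $\mathcal{PT}_p$. For a tree $T\in\mathcal{LW}(m)$ and a tree $R\in\mathcal{W}(n)$, with $v$ the vertex of $T$ labeled $i$: if $v$ has a $\prec$-successor and it is labeled, the composition is $\sum_{\sigma\in\mathbb{S}_2^{V_{unl}(R)}}\epsilon(\sigma)\,Con_r(T\circ_iCon(R_\sigma))$, where $r$ is the root of $Con(R_\sigma)$ seen inside $T\circ_iCon(R_\sigma)$; otherwise it is $T\circ_iR$ as in $\mathcal{PT}_p$. With these compositions $\mathcal{LW}$ is an operad. The operad $\mathcal{PSB}$. Write $C(\bullet;A,B)$ for the tree with unlabeled root and left and right subtrees $A$, $B$. $\mathcal{I}$ is the operadic ideal of $\mathcal{LW}$ generated by $C(\bullet;1,2)+C(\bullet;2,1)$ and $C(\bullet;1,C(\bullet;2,3))-C(\bullet;C(\bullet;1,2),3)-C(\bullet;2,C(\bullet;1,3))$. Then $\mathcal{PSB}:=\mathcal{LW}/\mathcal{I}$. $C_{n+1}\in\mathcal{L}(n+1)$ is the corolla with root labeled $n+1$ and leaves labeled $1,\dots,n$ from left to right. *)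

theory Defs
  imports
    "HOL.Vector_Spaces"
    "HOL-Algebra.QuotRing"
    "HOL-Combinatorics.Permutations"
    "HOL-Library.Poly_Mapping"
begin

section \<open>Formal linear combinations\<close>

text \<open>The vector space with basis \<^typ>\<open>'b\<close> is \<^typ>\<open>'b \<Rightarrow>\<^sub>0 'k\<close>.\<close>

definition fscale :: "'k::field \<Rightarrow> ('b \<Rightarrow>\<^sub>0 'k) \<Rightarrow> ('b \<Rightarrow>\<^sub>0 'k)" where
  "fscale c p = Poly_Mapping.map (\<lambda>a. c * a) p"

abbreviation basis :: "'b \<Rightarrow> ('b \<Rightarrow>\<^sub>0 'k::field)" where
  "basis b \<equiv> Poly_Mapping.single b 1"

definition lin_ext :: "('b \<Rightarrow> ('c \<Rightarrow>\<^sub>0 'k::field)) \<Rightarrow> ('b \<Rightarrow>\<^sub>0 'k) \<Rightarrow> ('c \<Rightarrow>\<^sub>0 'k)" where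
  "lin_ext f p = (\<Sum>b\<in>Poly_Mapping.keys p. fscale (Poly_Mapping.lookup p b) (f b))"


section \<open>Symmetric operads in vector spaces\<close>

text \<open>
  The data of a symmetric operad: the spaces \<open>\<O>(n)\<close> (\<open>Ops\<close>, with \<open>\<O>(0) = 0\<close> for operads
  concentrated in positive arities) with their vector space operations, the identity in
  \<open>\<O>(1)\<close>, the partial compositions \<open>ocomp P m n i x y = x \<circ>\<^sub>i y\<close> for \<open>x \<in> \<O>(m)\<close>, \<open>y \<in> \<O>(n)\<close>,
  \<open>1 \<le> i \<le> m\<close>, and the actions of the permutations of \<open>{1..n}\<close>.  These are left actions
  (\<open>\<sigma>\<close> renames the input \<open>i\<close> to \<open>\<sigma> i\<close>); the corresponding right action is that of the inverse.
  The operad axioms are not needed to speak of ideals, quotients and morphisms.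
\<close>

record ('k, 'o) operad =
  Ops :: "nat \<Rightarrow> 'o set"
  oadd :: "nat \<Rightarrow> 'o \<Rightarrow> 'o \<Rightarrow> 'o"
  oscale :: "nat \<Rightarrow> 'k \<Rightarrow> 'o \<Rightarrow> 'o"
  ounit :: "'o"
  ocomp :: "nat \<Rightarrow> nat \<Rightarrow> nat \<Rightarrow> 'o \<Rightarrow> 'o \<Rightarrow> 'o"
  oact :: "nat \<Rightarrow> (nat \<Rightarrow> nat) \<Rightarrow> 'o \<Rightarrow> 'o"

text \<open>Morphisms are made extensional, so that equal morphisms are equal as functions.\<close>

definition operad_morphism ::
  "('k, 'o) operad \<Rightarrow> ('k, 'p) operad \<Rightarrow> (nat \<Rightarrow> 'o \<Rightarrow> 'p) \<Rightarrow> bool" where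
  "operad_morphism P Q \<rho> \<longleftrightarrow>
    (\<forall>n. \<rho> n \<in> Ops P n \<rightarrow>\<^sub>E Ops Q n) \<and>
    (\<forall>n. \<forall>x\<in>Ops P n. \<forall>y\<in>Ops P n. \<rho> n (oadd P n x y) = oadd Q n (\<rho> n x) (\<rho> n y)) \<and>
    (\<forall>n c. \<forall>x\<in>Ops P n. \<rho> n (oscale P n c x) = oscale Q n c (\<rho> n x)) \<and>
    \<rho> 1 (ounit P) = ounit Q \<and>
    (\<forall>m n. \<forall>i\<in>{1..m}. \<forall>x\<in>Ops P m. \<forall>y\<in>Ops P n.
       \<rho> (m + n - 1) (ocomp P m n i x y) = ocomp Q m n i (\<rho> m x) (\<rho> n y)) \<and>
    (\<forall>n \<sigma>. \<sigma> permutes {1..n} \<longrightarrow> (\<forall>x\<in>Ops P n. \<rho> n (oact P n \<sigma> x) = oact Q n \<sigma> (\<rho> n x)))"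

definition operad_ideal :: "('k, 'o) operad \<Rightarrow> (nat \<Rightarrow> 'o set) \<Rightarrow> bool" where
  "operad_ideal P I \<longleftrightarrow>
    (\<forall>n. I n \<subseteq> Ops P n \<and> I n \<noteq> {}) \<and>
    (\<forall>n. \<forall>x\<in>I n. \<forall>y\<in>I n. oadd P n x y \<in> I n) \<and>
    (\<forall>n c. \<forall>x\<in>I n. oscale P n c x \<in> I n) \<and>
    (\<forall>n \<sigma>. \<sigma> permutes {1..n} \<longrightarrow> (\<forall>x\<in>I n. oact P n \<sigma> x \<in> I n)) \<and>
    (\<forall>m n. \<forall>i\<in>{1..m}. \<forall>x\<in>I m. \<forall>y\<in>Ops P n. ocomp P m n i x y \<in> I (m + n - 1)) \<and>
    (\<forall>m n. \<forall>i\<in>{1..m}. \<forall>x\<in>Ops P m. \<forall>y\<in>I n. ocomp P m n i x y \<in> I (m + n - 1))"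

definition generated_operad_ideal ::
  "('k, 'o) operad \<Rightarrow> (nat \<Rightarrow> 'o set) \<Rightarrow> nat \<Rightarrow> 'o set" where
  "generated_operad_ideal P G n =
    {x \<in> Ops P n. \<forall>I. operad_ideal P I \<and> (\<forall>k. G k \<subseteq> I k) \<longrightarrow> x \<in> I n}"

definition ocoset :: "('k, 'o) operad \<Rightarrow> (nat \<Rightarrow> 'o set) \<Rightarrow> nat \<Rightarrow> 'o \<Rightarrow> 'o set" where
  "ocoset P I n x = oadd P n x ` I n"

text \<open>As for quotient rings in the library, the operations on cosets are defined by unions.\<close>

definition quotient_operad ::
  "('k, 'o) operad \<Rightarrow> (nat \<Rightarrow> 'o set) \<Rightarrow> ('k, 'o set) operad" where
  "quotient_operad P I =
    \<lparr> Ops = (\<lambda>n. ocoset P I n ` Ops P n),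
      oadd = (\<lambda>n A B. \<Union>a\<in>A. \<Union>b\<in>B. ocoset P I n (oadd P n a b)),
      oscale = (\<lambda>n c A. \<Union>a\<in>A. ocoset P I n (oscale P n c a)),
      ounit = ocoset P I 1 (ounit P),
      ocomp = (\<lambda>m n i A B. \<Union>a\<in>A. \<Union>b\<in>B. ocoset P I (m + n - 1) (ocomp P m n i a b)),
      oact = (\<lambda>n \<sigma> A. \<Union>a\<in>A. ocoset P I n (oact P n \<sigma> a)) \<rparr>"

text \<open>
  The endomorphism operad.  An element of \<open>Hom(V\<^bsup>\<otimes>n\<^esup>, V)\<close> is a multilinear function of the lists
  of length \<open>n\<close>; it is set to \<open>0\<close> on lists of any other length.
\<close>

definition End_operad :: "('k::field \<Rightarrow> 'v::ab_group_add \<Rightarrow> 'v) \<Rightarrow> ('k, 'v list \<Rightarrow> 'v) operad" where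
  "End_operad scale =
    \<lparr> Ops = (\<lambda>n. if n = 0 then {\<lambda>_. 0} else
        {f. (\<forall>xs. length xs \<noteq> n \<longrightarrow> f xs = 0) \<and>
            (\<forall>xs i. length xs = n \<and> i < n \<longrightarrow>
               Vector_Spaces.linear scale scale (\<lambda>v. f (xs[i := v])))}),
      oadd = (\<lambda>n f g xs. f xs + g xs),
      oscale = (\<lambda>n c f xs. scale c (f xs)),
      ounit = (\<lambda>xs. if length xs = 1 then hd xs else 0),
      ocomp = (\<lambda>m n i f g xs.
        if length xs = m + n - 1
        then f (take (i - 1) xs @ [g (take n (drop (i - 1) xs))] @ drop (i - 1 + n) xs)
        else 0),
      oact = (\<lambda>n \<sigma> f xs.
        if length xs = n then f (map (\<lambda>i. xs ! (\<sigma> i - 1)) [1..<Suc n]) else 0) \<rparr>"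

definition operad_algebra ::
  "('k::field, 'o) operad \<Rightarrow> ('k \<Rightarrow> 'v::ab_group_add \<Rightarrow> 'v) \<Rightarrow> (nat \<Rightarrow> 'o \<Rightarrow> 'v list \<Rightarrow> 'v) \<Rightarrow> bool"
  where "operad_algebra P scale \<rho> \<longleftrightarrow> operad_morphism P (End_operad scale) \<rho>"


section \<open>Partially labeled planar rooted trees\<close>

text \<open>
  \<open>Node l ts\<close> has a root with label \<open>l\<close> (unlabeled if \<open>None\<close>) whose incoming edges, from left to
  right, come from the roots of \<open>ts\<close>.  A vertex is addressed by the path leading to it from the
  root, so the \<open>\<prec>\<close>-successor of a vertex \<open>p \<noteq> []\<close> is \<open>butlast p\<close>.
\<close>

datatype 'l ptree = Node (root_label: "'l option") (branches: "'l ptree list")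

primrec vertices :: "'l ptree \<Rightarrow> nat list set" where
  "vertices (Node l ts) =
    insert [] (\<Union>j\<in>{..<length ts}. (\<lambda>p. j # p) ` (map vertices ts ! j))"

fun subtree_at :: "'l ptree \<Rightarrow> nat list \<Rightarrow> 'l ptree" where
  "subtree_at t [] = t"
| "subtree_at t (j # p) = subtree_at (branches t ! j) p"

definition label_at :: "'l ptree \<Rightarrow> nat list \<Rightarrow> 'l option" where
  "label_at t p = root_label (subtree_at t p)"

definition in_degree :: "'l ptree \<Rightarrow> nat list \<Rightarrow> nat" where
  "in_degree t p = length (branches (subtree_at t p))"

definition unlabeled_vertices :: "'l ptree \<Rightarrow> nat list set" where
  "unlabeled_vertices t = {p \<in> vertices t. label_at t p = None}"

definition vertex_labeled :: "'l ptree \<Rightarrow> 'l \<Rightarrow> nat list" where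
  "vertex_labeled t i = (THE p. p \<in> vertices t \<and> label_at t p = Some i)"

definition partially_labeled_trees :: "nat \<Rightarrow> nat ptree set" where
  "partially_labeled_trees n =
    {t. bij_betw (\<lambda>p. the (label_at t p)) (vertices t - unlabeled_vertices t) {1..n}}"

text \<open>
  \<open>graft g t\<close> grafts, for each labeled vertex \<open>w\<close> of \<open>t\<close>, the trees \<open>g w\<close> onto \<open>w\<close> to the left of
  all the edges coming into \<open>w\<close>.  \<open>replace_vertex i h t\<close> replaces the vertex \<open>i\<close> of \<open>t\<close>, together
  with the list \<open>ts\<close> of the subtrees above it, by \<open>h ts\<close>.
\<close>

primrec graft :: "('l \<Rightarrow> 'l ptree list) \<Rightarrow> 'l ptree \<Rightarrow> 'l ptree" where
  "graft g (Node l ts) =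
    Node l ((case l of None \<Rightarrow> [] | Some w \<Rightarrow> g w) @ map (graft g) ts)"

primrec replace_vertex :: "'l \<Rightarrow> ('l ptree list \<Rightarrow> 'l ptree) \<Rightarrow> 'l ptree \<Rightarrow> 'l ptree" where
  "replace_vertex i h (Node l ts) =
    (if l = Some i then h ts else Node l (map (replace_vertex i h) ts))"

text \<open>
  \<open>T \<circ>\<^sub>i\<^sup>\<phi> R\<close> for \<open>R\<close> with \<open>n\<close> labels: \<open>\<phi> j\<close> is the label, in \<open>R\<close>, of the vertex onto which
  the \<open>j\<close>-th incoming edge of \<open>i\<close> (counted from \<open>0\<close>) is grafted.
\<close>

definition tree_comp_along ::
  "(nat \<Rightarrow> nat) \<Rightarrow> nat \<Rightarrow> nat \<Rightarrow> nat ptree \<Rightarrow> nat ptree \<Rightarrow> nat ptree" where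
  "tree_comp_along \<phi> n i T R =
    replace_vertex i
      (\<lambda>ts. graft (\<lambda>w. map (\<lambda>j. ts ! j) (filter (\<lambda>j. \<phi> j + (i - 1) = w) [0..<length ts]))
                  (map_ptree (\<lambda>k. k + (i - 1)) R))
      (map_ptree (\<lambda>k. if k > i then k + n - 1 else k) T)"

definition grafting_maps :: "nat \<Rightarrow> nat \<Rightarrow> nat ptree \<Rightarrow> (nat \<Rightarrow> nat) set" where
  "grafting_maps n i T = {..<in_degree T (vertex_labeled T i)} \<rightarrow>\<^sub>E {1..n}"

definition pt_comp :: "nat \<Rightarrow> nat \<Rightarrow> nat ptree \<Rightarrow> nat ptree \<Rightarrow> (nat ptree \<Rightarrow>\<^sub>0 'k::field)" where
  "pt_comp n i T R = (\<Sum>\<phi>\<in>grafting_maps n i T. basis (tree_comp_along \<phi> n i T R))"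


section \<open>The operad LW\<close>

definition L_trees :: "nat \<Rightarrow> nat ptree set" where
  "L_trees n = {t \<in> partially_labeled_trees n. unlabeled_vertices t = {}}"

definition W_trees :: "nat \<Rightarrow> nat ptree set" where
  "W_trees n = {t \<in> partially_labeled_trees n. n \<ge> 2 \<and>
     label_at t [] = None \<and>
     (\<forall>p\<in>unlabeled_vertices t. p \<noteq> [] \<longrightarrow> label_at t (butlast p) = None) \<and>
     (\<forall>p\<in>unlabeled_vertices t. in_degree t p = 2)}"

text \<open>
  A family \<open>\<sigma>\<close> of elements of the symmetric group on two letters, indexed by the unlabeled
  vertices, is given by the set \<open>S\<close> of the vertices with \<open>\<sigma>\<^sub>v \<noteq> id\<close>; its sign is \<open>(-1)\<close> to the
  power \<open>card S\<close>.
\<close>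

primrec swap_branches :: "'l ptree \<Rightarrow> nat list set \<Rightarrow> 'l ptree" where
  "swap_branches (Node l ts) =
    (\<lambda>S. Node l ((if [] \<in> S then rev else id)
      (map (\<lambda>j. (map swap_branches ts ! j) {p. j # p \<in> S}) [0..<length ts])))"

primrec Con :: "'l ptree \<Rightarrow> 'l ptree" where
  "Con (Node l ts) = Node l (concat
     (map (\<lambda>c. if l = None \<and> root_label c = None then branches c else [c]) (map Con ts)))"

text \<open>\<open>Con_at r t\<close> contracts the edge from the non-root vertex \<open>r\<close> of \<open>t\<close> to its successor.\<close>

fun Con_at :: "nat list \<Rightarrow> 'l ptree \<Rightarrow> 'l ptree" where
  "Con_at [] t = t"
| "Con_at [j] (Node l ts) = Node l (take j ts @ branches (ts ! j) @ drop (Suc j) ts)"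
| "Con_at (j # k # p) (Node l ts) = Node l (ts[j := Con_at (k # p) (ts ! j)])"

text \<open>
  The root of \<open>R\<close>, seen inside \<open>T \<circ>\<^sub>i\<^sup>\<phi> R\<close>, has the same address as the vertex \<open>i\<close> of \<open>T\<close>.
\<close>

definition lw_tree_comp ::
  "nat \<Rightarrow> nat \<Rightarrow> nat ptree \<Rightarrow> nat ptree \<Rightarrow> (nat ptree \<Rightarrow>\<^sub>0 'k::field)" where
  "lw_tree_comp n i T R =
    (let v = vertex_labeled T i in
     if R \<in> W_trees n \<and> v \<noteq> [] \<and> label_at T (butlast v) \<noteq> None
     then \<Sum>S\<in>Pow (unlabeled_vertices R). fscale ((-1) ^ card S)
            (lin_ext (\<lambda>t. basis (Con_at v t)) (pt_comp n i T (Con (swap_branches R S))))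
     else pt_comp n i T R)"

definition LW :: "('k::field, nat ptree \<Rightarrow>\<^sub>0 'k) operad" where
  "LW =
    \<lparr> Ops = (\<lambda>n. {x. Poly_Mapping.keys x \<subseteq> L_trees n \<union> W_trees n}),
      oadd = (\<lambda>n. (+)),
      oscale = (\<lambda>n. fscale),
      ounit = basis (Node (Some 1) []),
      ocomp = (\<lambda>m n i x y. lin_ext (\<lambda>T. lin_ext (\<lambda>R. lw_tree_comp n i T R) y) x),
      oact = (\<lambda>n \<sigma>. lin_ext (\<lambda>t. basis (map_ptree \<sigma> t))) \<rparr>"


section \<open>The operad PSB\<close>

abbreviation leaf :: "'l \<Rightarrow> 'l ptree" where
  "leaf i \<equiv> Node (Some i) []"

abbreviation cherry :: "'l ptree \<Rightarrow> 'l ptree \<Rightarrow> 'l ptree" where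
  "cherry A B \<equiv> Node None [A, B]"

definition psb_relations :: "nat \<Rightarrow> (nat ptree \<Rightarrow>\<^sub>0 'k::field) set" where
  "psb_relations n =
    (if n = 2 then
       {basis (cherry (leaf 1) (leaf 2)) + basis (cherry (leaf 2) (leaf 1))}
     else if n = 3 then
       {basis (cherry (leaf 1) (cherry (leaf 2) (leaf 3)))
        - basis (cherry (cherry (leaf 1) (leaf 2)) (leaf 3))
        - basis (cherry (leaf 2) (cherry (leaf 1) (leaf 3)))}
     else {})"

definition psb_ideal :: "nat \<Rightarrow> (nat ptree \<Rightarrow>\<^sub>0 'k::field) set" where
  "psb_ideal = generated_operad_ideal LW psb_relations"

definition PSB :: "('k::field, (nat ptree \<Rightarrow>\<^sub>0 'k) set) operad" where
  "PSB = quotient_operad LW psb_ideal"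

definition psb_class :: "nat \<Rightarrow> nat ptree \<Rightarrow> (nat ptree \<Rightarrow>\<^sub>0 'k::field) set" where
  "psb_class n t = ocoset LW psb_ideal n (basis t)"

text \<open>\<open>corolla n\<close> is the tree \<open>C\<^bsub>n+1\<^esub>\<close>, with \<open>n + 1\<close> vertices.\<close>

definition corolla :: "nat \<Rightarrow> nat ptree" where
  "corolla n = Node (Some (n + 1)) (map leaf [1..<Suc n])"


section \<open>The tensor algebra\<close>

text \<open>Words are a monoid under concatenation; the library of polynomial mappings then provides the monoid algebra.\<close>

instantiation list :: (type) monoid_add
begin

definition zero_list :: "'a list" where "zero_list = []"

definition plus_list :: "'a list \<Rightarrow> 'a list \<Rightarrow> 'a list" where "plus_list xs ys = xs @ ys"

instance by standard (simp_all add: zero_list_def plus_list_def)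

end

definition free_algebra :: "('v list \<Rightarrow>\<^sub>0 'k::field) ring" where
  "free_algebra = \<lparr> carrier = UNIV, monoid.mult = (*), one = 1, zero = 0, add = (+) \<rparr>"

text \<open>
  \<open>T(V)\<close> is the free unital associative algebra on the set \<open>V\<close> modulo the ideal making the
  inclusion of \<open>V\<close> linear.
\<close>

definition linearity_ideal ::
  "('k::field \<Rightarrow> 'v::ab_group_add \<Rightarrow> 'v) \<Rightarrow> ('v list \<Rightarrow>\<^sub>0 'k) set" where
  "linearity_ideal scale = Idl\<^bsub>free_algebra\<^esub>
    ({basis [x + y] - basis [x] - basis [y] | x y. True} \<union>
     {basis [scale c x] - fscale c (basis [x]) | c x. True})"

definition tensor_algebra ::
  "('k::field \<Rightarrow> 'v::ab_group_add \<Rightarrow> 'v) \<Rightarrow> ('v list \<Rightarrow>\<^sub>0 'k) set ring" where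
  "tensor_algebra scale = free_algebra Quot linearity_ideal scale"

definition tensor_class ::
  "('k::field \<Rightarrow> 'v::ab_group_add \<Rightarrow> 'v) \<Rightarrow> ('v list \<Rightarrow>\<^sub>0 'k) \<Rightarrow> ('v list \<Rightarrow>\<^sub>0 'k) set" where
  "tensor_class scale p = linearity_ideal scale +>\<^bsub>free_algebra\<^esub> p"

text \<open>The monomial \<open>x\<^sub>1\<cdots>x\<^sub>n\<close> of \<open>T(V)\<close>, and the multiplication by the scalar \<open>c\<close>.\<close>

definition monomial ::
  "('k::field \<Rightarrow> 'v::ab_group_add \<Rightarrow> 'v) \<Rightarrow> 'v list \<Rightarrow> ('v list \<Rightarrow>\<^sub>0 'k) set" where
  "monomial scale X = tensor_class scale (basis X)"

definition tensor_scale ::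
  "('k::field \<Rightarrow> 'v::ab_group_add \<Rightarrow> 'v) \<Rightarrow> 'k \<Rightarrow> ('v list \<Rightarrow>\<^sub>0 'k) set \<Rightarrow> ('v list \<Rightarrow>\<^sub>0 'k) set"
  where
  "tensor_scale scale c A =
     tensor_class scale (Poly_Mapping.single [] c) \<otimes>\<^bsub>tensor_algebra scale\<^esub> A"

text \<open>\<open>Hom(T(V) \<otimes> V, V)\<close>, as the set of the bilinear maps \<open>T(V) \<times> V \<rightarrow> V\<close>.\<close>

definition tensor_hom ::
  "('k::field \<Rightarrow> 'v::ab_group_add \<Rightarrow> 'v) \<Rightarrow> (('v list \<Rightarrow>\<^sub>0 'k) set \<Rightarrow> 'v \<Rightarrow> 'v) set" where
  "tensor_hom scale = {T \<in> extensional (carrier (tensor_algebra scale)).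
     (\<forall>A\<in>carrier (tensor_algebra scale). Vector_Spaces.linear scale scale (T A)) \<and>
     (\<forall>A\<in>carrier (tensor_algebra scale). \<forall>B\<in>carrier (tensor_algebra scale). \<forall>z.
        T (A \<oplus>\<^bsub>tensor_algebra scale\<^esub> B) z = T A z + T B z) \<and>
     (\<forall>c. \<forall>A\<in>carrier (tensor_algebra scale). \<forall>z. T (tensor_scale scale c A) z = scale c (T A z))}"


section \<open>The structures \<open>(\<gg>, T)\<close>\<close>

definition lie_algebra ::
  "('k::field \<Rightarrow> 'v::ab_group_add \<Rightarrow> 'v) \<Rightarrow> ('v \<Rightarrow> 'v \<Rightarrow> 'v) \<Rightarrow> bool" where
  "lie_algebra scale br \<longleftrightarrow> vector_space scale \<and>
     (\<forall>x. Vector_Spaces.linear scale scale (br x)) \<and>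
     (\<forall>y. Vector_Spaces.linear scale scale (\<lambda>x. br x y)) \<and>
     (\<forall>x. br x x = 0) \<and>
     (\<forall>x y z. br x (br y z) + br y (br z x) + br z (br x y) = 0)"

definition commutator_ideal ::
  "('k::field \<Rightarrow> 'v::ab_group_add \<Rightarrow> 'v) \<Rightarrow> ('v \<Rightarrow> 'v \<Rightarrow> 'v) \<Rightarrow> ('v list \<Rightarrow>\<^sub>0 'k) set set" where
  "commutator_ideal scale br = Idl\<^bsub>tensor_algebra scale\<^esub>
     {monomial scale [x, y] \<ominus>\<^bsub>tensor_algebra scale\<^esub> monomial scale [y, x]
        \<ominus>\<^bsub>tensor_algebra scale\<^esub> monomial scale [br x y] | x y. True}"

text \<open>
  \<open>ordered_partitions k n\<close> consists of the sequences of \<open>k\<close> disjoint, possibly empty, sets with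
  union \<open>{0..<n}\<close>.  Positions in lists being counted from \<open>0\<close>, \<open>X\<^sub>I\<close> is \<open>nths X I\<close>.
\<close>

definition ordered_partitions :: "nat \<Rightarrow> nat \<Rightarrow> nat set list set" where
  "ordered_partitions k n = {J. length J = k \<and> (\<Union>i<k. J ! i) = {..<n} \<and>
     (\<forall>i<k. \<forall>j<k. i \<noteq> j \<longrightarrow> J ! i \<inter> J ! j = {})}"

definition psb_pair ::
  "('k::field \<Rightarrow> 'v::ab_group_add \<Rightarrow> 'v) \<Rightarrow> ('v \<Rightarrow> 'v \<Rightarrow> 'v) \<Rightarrow>
     (('v list \<Rightarrow>\<^sub>0 'k) set \<Rightarrow> 'v \<Rightarrow> 'v) \<Rightarrow> bool" where
  "psb_pair scale br T \<longleftrightarrow>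
     lie_algebra scale br \<and> T \<in> tensor_hom scale \<and>
     (\<forall>A\<in>commutator_ideal scale br. \<forall>z. T A z = 0) \<and>
     (\<forall>y. T (monomial scale []) y = y) \<and>
     (\<forall>X Y z. T (monomial scale X) (T (monomial scale Y) z) =
        (\<Sum>J\<in>ordered_partitions (Suc (length Y)) (length X).
           T (monomial scale (nths X (J ! 0) @
                map (\<lambda>k. T (monomial scale (nths X (J ! Suc k))) (Y ! k)) [0..<length Y])) z)) \<and>
     (\<forall>X x y. T (monomial scale X) (br x y) =
        (\<Sum>J\<in>ordered_partitions 2 (length X).
           br (T (monomial scale (nths X (J ! 0))) x) (T (monomial scale (nths X (J ! 1))) y)))"

end

(*
A pair (br, M), where M X z stands for T(X; z), assigns a value to every partially labeled tree: an
unlabeled vertex is evaluated by br, a labeled vertex by M, the labels standing for inputs.  The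
main point is that this evaluation respects the compositions of LW if and only if (br, M) has the
stated properties.  By (iii) and (iv) for words X of length one, M [x] is a derivation with respect
to M and br, where a derivation hits the words above the labeled vertices by adding the letter x on
the left; iterating, M X applied to the value of a tree R is the sum over all graftings of X onto
R, which is the composition without contraction.  In the contracting case, (i) turns a bracket
among the letters of X into a commutator, and expanding nested brackets produces the signed sum over
the exchanged branches.  Conversely, every tree of LW is, up to relabeling, an iterated composite of
corollas and of the tree with two leaves and unlabeled root, so that an algebra evaluates trees in
this way; the defining compositions of these generators then give back the properties.
*)

theory Submission
  imports Defs
begin

section \<open>Linear extension\<close>

text \<open>The obstacle is that compositions act at a vertex deep inside a tree, while the axioms
  speak of a single operation. Everything outside the vertex is therefore packed into a linear map
  \<open>\<Lambda>\<close>, its context, which is the same for replacing the vertex and for varying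
  the input that it carries; in this form composing trees becomes substituting values. Contraction
  moves the surgery to the labeled successor, where it merely splices a word, so contexts still
  apply. A grafting map refers to labels only, hence makes sense for all exchanged trees at once:
  for each such map the signed sum collapses separately, and what is left is the uncontracted
  composition. Single letters suffice because \<open>M_deriv\<close>, solved for the longer word, is
  a recursion; (iii) and (iv) for all words come back as the cases of a corolla and of a cherry. The
  ideal defining PSB is controlled by the fact that the kernel of an algebra is an ideal. The
  characteristic serves to pass from antisymmetry to \<open>br x x = 0\<close>.\<close>

lemma lookup_fscale [simp]: "Poly_Mapping.lookup (fscale c p) b = c * Poly_Mapping.lookup p b"
  by (simp add: fscale_def Poly_Mapping.map.rep_eq when_def)

lemma vector_space_fscale: "vector_space fscale"
  by unfold_locales (auto intro!: poly_mapping_eqI simp: lookup_add algebra_simps)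

interpretation F: vector_space "fscale :: 'k::field \<Rightarrow> ('b \<Rightarrow>\<^sub>0 'k)
    \<Rightarrow> ('b \<Rightarrow>\<^sub>0 'k)"
  by (rule vector_space_fscale)

context vector_space
begin

abbreviation lin :: "('b \<Rightarrow> 'b) \<Rightarrow> bool" where
  "lin \<equiv> Vector_Spaces.linear scale scale"

lemma linI:
  assumes "\<And>x y. f (x + y) = f x + f y" "\<And>c x. f (scale c x) = scale c (f x)"
  shows "lin f"
  using assms vector_space_axioms by (simp add: linear_iff)

lemma
  assumes "lin f"
  shows lin_add: "f (x + y) = f x + f y"
    and lin_scale: "f (scale c x) = scale c (f x)"
    and lin_zero: "f 0 = 0"
    and lin_minus: "f (- x) = - f x"
    and lin_sum: "f (sum g A) = (\<Sum>a\<in>A. f (g a))"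
    and lin_sum_list: "f (sum_list ys) = sum_list (map f ys)"
proof -
  interpret linear scale scale f by fact
  show "f (x + y) = f x + f y" "f (scale c x) = scale c (f x)" "f 0 = 0"
    "f (- x) = - f x" "f (sum g A) = (\<Sum>a\<in>A. f (g a))"
    by (fact add scale zero neg sum)+
  show "f (sum_list ys) = sum_list (map f ys)"
    by (induction ys) (simp_all add: zero add)
qed

lemma lin_id: "lin (\<lambda>v. v)"
  by (rule linI) simp_all

lemma lin_comp: "lin f \<Longrightarrow> lin g \<Longrightarrow> lin (\<lambda>v. f (g v))"
  by (rule linI) (simp_all add: lin_add lin_scale)

text \<open>Linear extension of \<open>f\<close> from the basis to a space with scalar
  multiplication \<open>scale\<close>. \<open>lin_ext\<close> is the instance whose target again
  consists of formal combinations (\<open>lin_ext_lcomb\<close>), so one set of lemmas serves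
  both.\<close>

definition lcomb :: "('c \<Rightarrow> 'b) \<Rightarrow> ('c \<Rightarrow>\<^sub>0 'a) \<Rightarrow> 'b" where
  "lcomb f p = (\<Sum>b\<in>Poly_Mapping.keys p. scale (Poly_Mapping.lookup p b) (f b))"

lemma lcomb_superset:
  "finite A \<Longrightarrow> Poly_Mapping.keys p \<subseteq> A \<Longrightarrow>
    lcomb f p = (\<Sum>b\<in>A. scale (Poly_Mapping.lookup p b) (f b))"
  unfolding lcomb_def by (rule sum.mono_neutral_left) (auto simp: in_keys_iff)

lemma lcomb_add: "lcomb f (p + q) = lcomb f p + lcomb f q"
proof -
  let ?A = "Poly_Mapping.keys p \<union> Poly_Mapping.keys q"
  have "Poly_Mapping.keys (p + q) \<subseteq> ?A" by (rule Poly_Mapping.keys_add)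
  then show ?thesis
    by (simp add: lcomb_superset[of ?A] lookup_add scale_left_distrib sum.distrib)
qed

lemma lcomb_fscale: "lcomb f (fscale c p) = scale c (lcomb f p)"
proof -
  have "Poly_Mapping.keys (fscale c p) \<subseteq> Poly_Mapping.keys p" by (auto simp: in_keys_iff)
  then show ?thesis
    by (simp add: lcomb_superset[of "Poly_Mapping.keys p"] scale_sum_right)
qed

lemma lcomb_zero [simp]: "lcomb f 0 = 0"
  by (simp add: lcomb_def)

lemma lcomb_single [simp]: "lcomb f (Poly_Mapping.single b c) = scale c (f b)"
  by (cases "c = 0") (simp_all add: lcomb_def)

lemma lcomb_minus: "lcomb f (p - q) = lcomb f p - lcomb f q"
  by (metis lcomb_add add_diff_cancel_right' diff_add_cancel)

lemma lcomb_sum: "lcomb f (sum g A) = (\<Sum>a\<in>A. lcomb f (g a))"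
  by (induction A rule: infinite_finite_induct) (simp_all add: lcomb_add)

lemma lcomb_cong: "(\<And>b. b \<in> Poly_Mapping.keys p \<Longrightarrow> f b = g b) \<Longrightarrow>
    lcomb f p = lcomb g p"
  by (simp add: lcomb_def)

lemma lcomb_lin_ext: "lcomb f (lin_ext g p) = lcomb (\<lambda>b. lcomb f (g b)) p"
  by (simp add: lin_ext_def lcomb_sum lcomb_fscale lcomb_def[of "\<lambda>b. lcomb f (g b)"])

lemma lin_lcomb: "lin h \<Longrightarrow> h (lcomb f p) = lcomb (\<lambda>b. h (f b)) p"
  by (simp add: lcomb_def lin_sum lin_scale)

lemma lcomb_add_fun: "lcomb (\<lambda>b. f b + g b) p = lcomb f p + lcomb g p"
  by (simp add: lcomb_def scale_right_distrib sum.distrib)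

lemma lcomb_scale_fun: "lcomb (\<lambda>b. scale c (f b)) p = scale c (lcomb f p)"
  by (simp add: lcomb_def scale_sum_right ac_simps)

lemma lcomb_basis: "lcomb f (basis b) = f b"
  by simp

lemma lcomb_zero_fun [simp]: "lcomb (\<lambda>_. 0) p = 0"
  by (simp add: lcomb_def)

end

lemma lin_ext_lcomb: "lin_ext f p = F.lcomb f p"
  by (simp add: lin_ext_def F.lcomb_def)

lemmas lin_ext_simps = F.lcomb_add[folded lin_ext_lcomb] F.lcomb_fscale[folded lin_ext_lcomb]
  F.lcomb_zero[folded lin_ext_lcomb] F.lcomb_basis[folded lin_ext_lcomb]
  F.lcomb_sum[folded lin_ext_lcomb] F.lcomb_minus[folded lin_ext_lcomb]

lemma lin_ext_basis_self: "lin_ext basis p = p"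
proof (rule poly_mapping_eqI)
  fix b
  show "Poly_Mapping.lookup (lin_ext basis p) b = Poly_Mapping.lookup p b"
    by (cases "b \<in> Poly_Mapping.keys p")
      (simp_all add: lin_ext_def lookup_sum lookup_single when_def in_keys_iff if_distrib sum.delta
        cong: if_cong)
qed

lemma keys_lin_ext: "Poly_Mapping.keys (lin_ext f p) \<subseteq> (\<Union>b\<in>Poly_Mapping.keys p.
    Poly_Mapping.keys (f b))"
proof
  fix c assume "c \<in> Poly_Mapping.keys (lin_ext f p)"
  then have "(\<Sum>b\<in>Poly_Mapping.keys p. Poly_Mapping.lookup p b * Poly_Mapping.lookup (f b) c)
      \<noteq> 0"
    by (simp add: in_keys_iff lin_ext_def lookup_sum)
  then obtain b where "b \<in> Poly_Mapping.keys p" "Poly_Mapping.lookup (f b) c \<noteq> 0"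
    by (metis (no_types, lifting) mult_zero_right sum.neutral)
  then show "c \<in> (\<Union>b\<in>Poly_Mapping.keys p. Poly_Mapping.keys (f b))"
    by (auto simp: in_keys_iff)
qed

lemma keys_sum: "Poly_Mapping.keys (sum f A) \<subseteq> (\<Union>a\<in>A. Poly_Mapping.keys (f a))"
proof
  fix c assume "c \<in> Poly_Mapping.keys (sum f A)"
  then have "(\<Sum>a\<in>A. Poly_Mapping.lookup (f a) c) \<noteq> 0"
    by (simp add: in_keys_iff lookup_sum)
  then show "c \<in> (\<Union>a\<in>A. Poly_Mapping.keys (f a))"
    by (metis (no_types, lifting) UN_I in_keys_iff sum.neutral)
qed

lemma keys_fscale: "Poly_Mapping.keys (fscale c p) \<subseteq> Poly_Mapping.keys p"
  by (auto simp: in_keys_iff)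

section \<open>Labels and shapes of trees\<close>

text \<open>Labels in preorder. As a list it records multiplicities: bijectivity of a labeling
  becomes \<open>distinct\<close> plus a set equation, and label bookkeeping becomes a computation
  with multisets.\<close>

primrec labs :: "'l ptree \<Rightarrow> 'l list" where
  "labs (Node l ts) = (case l of None \<Rightarrow> [] | Some i \<Rightarrow> [i]) @ concat (map labs ts)"

primrec full :: "'l ptree \<Rightarrow> bool" where
  "full (Node l ts) \<longleftrightarrow> l \<noteq> None \<and> (\<forall>b\<in>set (map full ts). b)"

text \<open>Conditions (b) and (c) in recursive form: above a labeled vertex everything is labeled.
  The root is left free, so that the trees of L and of W are treated at once and told apart by
  \<open>root_label\<close>.\<close>

primrec lwt :: "'l ptree \<Rightarrow> bool" where
  "lwt (Node l ts) \<longleftrightarrow> (case l of None \<Rightarrow> length ts =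
      2 \<and> (\<forall>b\<in>set (map lwt ts). b)
     | Some i \<Rightarrow> (\<forall>t\<in>set ts. full t))"

lemma full_Node [simp]: "full (Node l ts) \<longleftrightarrow> l \<noteq> None \<and>
    (\<forall>t\<in>set ts. full t)"
  by simp

lemma lwt_Node [simp]: "lwt (Node l ts) \<longleftrightarrow> (case l of None \<Rightarrow> length ts =
    2 \<and> (\<forall>t\<in>set ts. lwt t)
     | Some i \<Rightarrow> (\<forall>t\<in>set ts. full t))"
  by (simp split: option.split)

declare full.simps [simp del] lwt.simps [simp del]

lemma full_imp_lwt: "full t \<Longrightarrow> lwt t"
  by (cases t) auto

lemma lwt_cases:
  assumes "lwt t"
  obtains (labeled) i ts where "t = Node (Some i) ts" "\<forall>t\<in>set ts. full t"
  | (cherry) A B where "t = cherry A B" "lwt A" "lwt B"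
  using assms
  by (cases t; cases "root_label t") (auto simp: numeral_2_eq_2 length_Suc_conv)

lemma lwt_induct [consumes 1, case_names labeled cherry]:
  assumes "lwt t"
    and "\<And>i ts. \<forall>t\<in>set ts. full t \<Longrightarrow> P (Node (Some i) ts)"
    and "\<And>A B. lwt A \<Longrightarrow> lwt B \<Longrightarrow> P A \<Longrightarrow>
        P B \<Longrightarrow> P (cherry A B)"
  shows "P t"
  using assms(1)
proof (induction t)
  case (Node l ts)
  from Node.prems show ?case
  proof (cases rule: lwt_cases)
    case (labeled i ts')
    then show ?thesis using assms(2) by simp
  next
    case (cherry A B)
    then show ?thesis using assms(3) Node.IH by simp
  qed
qed

lemma labs_nonempty: "lwt t \<Longrightarrow> labs t \<noteq> []"
  by (induction rule: lwt_induct) auto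

lemma length_labs_cherry:
  assumes "lwt t" "root_label t = None"
  shows "length (labs t) \<ge> 2"
  using assms(1)
proof (cases rule: lwt_cases)
  case (labeled i ts)
  then show ?thesis using assms(2) by simp
next
  case (cherry A B)
  then have "length (labs A) \<ge> 1" "length (labs B) \<ge> 1"
    using labs_nonempty by (simp_all add: Suc_le_eq)
  then show ?thesis using cherry by simp
qed

lemma labs_map_ptree: "labs (map_ptree f t) = map f (labs t)"
  by (induction t) (auto simp: map_concat comp_def split: option.split intro!: arg_cong[where f=concat])

lemma full_map_ptree [simp]: "full (map_ptree f t) = full t"
  by (induction t) auto

lemma lwt_map_ptree [simp]: "lwt (map_ptree f t) = lwt t"
  by (induction t) (auto split: option.split)

lemma map_ptree_cong_labs: "(\<And>i. i \<in> set (labs t) \<Longrightarrow> f i = g i) \<Longrightarrow>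
    map_ptree f t = map_ptree g t"
proof (induction t)
  case (Node l ts)
  then show ?case by (cases l) auto
qed

lemma map_ptree_comp: "map_ptree f (map_ptree g t) = map_ptree (\<lambda>x. f (g x)) t"
  by (simp add: ptree.map_comp comp_def)

definition LW_trees :: "nat \<Rightarrow> nat ptree set" where
  "LW_trees n = {t. lwt t \<and> distinct (labs t) \<and> set (labs t) = {1..n}}"

section \<open>Vertex addresses against the recursive shape of trees\<close>

lemma vertices_Node:
  "vertices (Node l ts) = insert [] (\<Union>j\<in>{..<length ts}. (#) j ` vertices (ts ! j))"
  by simp

declare vertices.simps [simp del]

lemma label_at_Nil [simp]: "label_at (Node l ts) [] = l"
  by (simp add: label_at_def)

lemma label_at_Cons [simp]: "label_at (Node l ts) (j # p) = label_at (ts ! j) p"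
  by (simp add: label_at_def)

lemma in_degree_Nil [simp]: "in_degree (Node l ts) [] = length ts"
  by (simp add: in_degree_def)

lemma in_degree_Cons [simp]: "in_degree (Node l ts) (j # p) = in_degree (ts ! j) p"
  by (simp add: in_degree_def)

lemma unlabeled_Node:
  "unlabeled_vertices (Node l ts) =
    (if l = None then {[]} else {}) \<union> (\<Union>j\<in>{..<length ts}. (#) j ` unlabeled_vertices (ts
        ! j))"
  by (auto simp: unlabeled_vertices_def vertices_Node)

lemma full_iff: "full t \<longleftrightarrow> unlabeled_vertices t = {}"
proof (induction t)
  case (Node l ts)
  then show ?case
    by (auto simp: unlabeled_Node set_conv_nth split: if_splits)
qed

lemma finite_vertices: "finite (vertices t)"
  by (induction t) (auto simp: vertices_Node)

lemma finite_unlabeled [simp]: "finite (unlabeled_vertices t)"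
  by (simp add: unlabeled_vertices_def finite_vertices)

lemma Nil_in_vertices [simp]: "[] \<in> vertices t"
  by (cases t) (simp add: vertices_Node)

text \<open>Conditions (b) and (c) as \<open>W_trees\<close> states them, by addresses and without a
  condition on the root; the bridge to \<open>lwt\<close>.\<close>

definition lw_shape :: "'l ptree \<Rightarrow> bool" where
  "lw_shape t \<longleftrightarrow> (\<forall>p\<in>unlabeled_vertices t. p \<noteq> [] \<longrightarrow>
      label_at t (butlast p) = None) \<and>
     (\<forall>p\<in>unlabeled_vertices t. in_degree t p = 2)"

text \<open>An unlabeled vertex closest to the root cannot exist: its successor would again be
  unlabeled, and strictly closer.\<close>

lemma unlabeled_root: "lw_shape t \<Longrightarrow> root_label t \<noteq> None \<Longrightarrow>
    unlabeled_vertices t = {}"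
proof (rule ccontr)
  assume t: "lw_shape t" "root_label t \<noteq> None" "unlabeled_vertices t \<noteq> {}"
  then obtain p where p: "p \<in> unlabeled_vertices t"
    and min: "\<And>q. q \<in> unlabeled_vertices t \<Longrightarrow> length p \<le> length q"
    using ex_has_least_nat[of "\<lambda>p. p \<in> unlabeled_vertices t" _ length] by blast
  have ne: "p \<noteq> []" using p t by (cases t) (auto simp: unlabeled_vertices_def)
  have *: "p \<in> vertices t \<Longrightarrow> p \<noteq> [] \<Longrightarrow>
      butlast p \<in> vertices t" for p t
  proof (induction p arbitrary: t)
    case (Cons j p)
    then show ?case by (cases t) (auto simp: vertices_Node)
  qed simp
  have "label_at t (butlast p) = None" using t p ne by (auto simp: lw_shape_def)
  then have "butlast p \<in> unlabeled_vertices t"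
    using *[of p t] p ne by (simp add: unlabeled_vertices_def)
  from min[OF this] show False using ne by (cases p) (auto split: if_splits)
qed

lemma lw_shape_Node_None:
  "lw_shape (Node None ts) \<longleftrightarrow> length ts = 2 \<and> (\<forall>t\<in>set ts. lw_shape t)"
  (is "?L \<longleftrightarrow> ?R")
proof
  assume L: ?L
  then have 2: "length ts = 2" by (auto simp: lw_shape_def unlabeled_Node)
  have "lw_shape t" if t: "t \<in> set ts" for t
  proof -
    obtain j where j: "j < length ts" "t = ts ! j" using t by (metis in_set_conv_nth)
    show ?thesis unfolding lw_shape_def
    proof (intro conjI ballI impI)
      fix p assume p: "p \<in> unlabeled_vertices t"
      then have jp: "j # p \<in> unlabeled_vertices (Node None ts)" using j by (auto simp: unlabeled_Node)
      show "in_degree t p = 2" using L jp j by (auto simp: lw_shape_def)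
      assume "p \<noteq> []"
      then show "label_at t (butlast p) = None" using L jp j by (auto simp: lw_shape_def)
    qed
  qed
  with 2 show ?R by blast
next
  assume R: ?R
  show ?L unfolding lw_shape_def
  proof (intro conjI ballI impI)
    fix p assume p: "p \<in> unlabeled_vertices (Node None ts)"
    show "in_degree (Node None ts) p = 2"
      using p R by (auto simp: unlabeled_Node lw_shape_def)
    assume "p \<noteq> []"
    with p obtain j q where q: "p = j # q" "j < length ts" "q \<in> unlabeled_vertices (ts ! j)"
      by (auto simp: unlabeled_Node)
    show "label_at (Node None ts) (butlast p) = None"
    proof (cases "q = []")
      case False
      moreover have "lw_shape (ts ! j)" using R q by simp
      ultimately show ?thesis using q by (simp add: lw_shape_def)
    qed (simp add: q)
  qed
qed

lemma lwt_iff: "lwt t \<longleftrightarrow> lw_shape t"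
proof (induction t)
  case (Node l ts)
  show ?case
  proof (cases l)
    case None
    then show ?thesis using Node by (simp add: lw_shape_Node_None)
  next
    case (Some i)
    have "lw_shape (Node l ts) \<longleftrightarrow> unlabeled_vertices (Node l ts) = {}"
      using unlabeled_root[of "Node l ts"] Some by (auto simp: lw_shape_def)
    then show ?thesis using Some full_iff[of "Node l ts"] by simp
  qed
qed

text \<open>Translates the labeling by addresses, as in \<open>partially_labeled_trees\<close>, into
  the list \<open>labs\<close>, with multiplicities.\<close>

lemma mset_labs:
  "mset (labs t) = image_mset (\<lambda>p. the (label_at t p)) (mset_set (vertices t - unlabeled_vertices t))"
proof (induction t)
  case (Node l ts)
  let ?V = "\<lambda>t. vertices t - unlabeled_vertices t"
  have eq: "?V (Node l ts) = (if l = None then {} else {[]}) \<union> (\<Union>j\<in>{..<length ts}. (#) j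
      ` ?V (ts ! j))"
    by (auto simp: vertices_Node unlabeled_Node)
  have fin: "finite (?V t)" for t :: "'a ptree" by (simp add: finite_vertices)
  \<comment> \<open>Addresses in different branches differ in their first entry, so these unions are
    disjoint and \<open>mset_set\<close> is additive; the branches are added one at a time.\<close>
  have "mset_set (\<Union>j\<in>{..<m}. (#) j ` ?V (ts ! j)) =
      (\<Sum>j<m. image_mset ((#) j) (mset_set (?V (ts ! j))))"
    for m
  proof (induction m)
    case (Suc m)
    have "mset_set ((\<Union>j\<in>{..<m}. (#) j ` ?V (ts ! j)) \<union> (#) m ` ?V (ts ! m)) =
      mset_set (\<Union>j\<in>{..<m}. (#) j ` ?V (ts ! j)) + mset_set ((#) m ` ?V (ts ! m))"
      by (rule mset_set_Union) (use fin in auto)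
    then show ?case using Suc
      by (simp add: lessThan_Suc Un_commute image_mset_mset_set[symmetric] add.commute)
  qed simp
  note 1 = this[of "length ts"]
  have image_sum: "image_mset f (\<Sum>j<m. M j) =
      (\<Sum>j<m. image_mset f (M j))" for m f and M :: "nat \<Rightarrow> nat list multiset"
    by (induction m) simp_all
  have "mset_set (?V (Node l ts)) = mset_set (if l = None then {} else {[]}) +
      mset_set (\<Union>j\<in>{..<length ts}. (#) j ` ?V (ts ! j))"
    unfolding eq by (rule mset_set_Union) (use fin in auto)
  then have 2: "image_mset (\<lambda>p. the (label_at (Node l ts) p)) (mset_set (?V (Node l ts))) =
     image_mset (\<lambda>p. the (label_at (Node l ts) p)) (mset_set (if l = None then {} else {[]})) +
     (\<Sum>j<length ts. image_mset (\<lambda>p. the (label_at (ts ! j) p)) (mset_set (?V (ts ! j))))"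
    by (simp add: 1 image_sum multiset.map_comp comp_def)
  also have "\<dots> = mset (case l of None \<Rightarrow> [] | Some i \<Rightarrow> [i]) +
      (\<Sum>j<length ts. mset (labs (ts ! j)))"
    using Node.IH by (auto split: option.split)
  also have "(\<Sum>j<length ts. mset (labs (ts ! j))) = mset (concat (map labs ts))"
    by (simp add: mset_concat sum_list_sum_nth atLeast0LessThan comp_def)
  finally show ?case by simp
qed

text \<open>By \<open>mset_labs\<close> the list has as many entries as there are labeled vertices,
  so it is free of repetitions exactly when the labeling is injective.\<close>

lemma partially_labeled_trees_iff:
  "t \<in> partially_labeled_trees n \<longleftrightarrow> distinct (labs t) \<and> set (labs t) = {1..n}"
proof -
  let ?V = "vertices t - unlabeled_vertices t"
  let ?f = "\<lambda>p. the (label_at t p)"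
  have fin: "finite ?V" by (simp add: finite_vertices)
  have "distinct (labs t) \<longleftrightarrow> inj_on ?f ?V"
  proof
    assume "distinct (labs t)"
    then have "card (set (labs t)) = length (labs t)" by (rule distinct_card)
    moreover have "set (labs t) = ?f ` ?V"
      using arg_cong[OF mset_labs, of set_mset t] fin by simp
    moreover have "length (labs t) = card ?V"
      using arg_cong[OF mset_labs, of size t] by simp
    ultimately show "inj_on ?f ?V" using fin by (simp add: inj_on_iff_eq_card)
  next
    assume "inj_on ?f ?V"
    then have "mset (labs t) = mset_set (?f ` ?V)" by (simp add: mset_labs image_mset_mset_set)
    moreover from this have "set (labs t) = ?f ` ?V" using fin
        by (metis finite_imageI finite_set_mset_mset_set set_mset_mset)
    ultimately show "distinct (labs t)" using fin by (simp add: distinct_count_atmost_1 count_mset_set')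
  qed
  moreover have "set (labs t) = ?f ` ?V"
    using arg_cong[OF mset_labs, of set_mset t] fin by simp
  ultimately show ?thesis by (simp add: partially_labeled_trees_def bij_betw_def)
qed

lemma L_trees_iff: "t \<in> L_trees n \<longleftrightarrow> t \<in> LW_trees n \<and>
    root_label t \<noteq> None"
proof -
  have "full t \<longleftrightarrow> lwt t \<and> root_label t \<noteq> None" by (cases t) auto
  then show ?thesis
    by (auto simp: L_trees_def LW_trees_def partially_labeled_trees_iff full_iff)
qed

text \<open>The bound \<open>n \<ge> 2\<close> comes from the two branches over the unlabeled root,
  each of which carries a label.\<close>

lemma W_trees_iff: "t \<in> W_trees n \<longleftrightarrow> t \<in> LW_trees n \<and> root_label t = None"
proof -
  have "n \<ge> 2" if "t \<in> LW_trees n" "root_label t = None"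
  proof -
    have "length (labs t) = n"
      using that distinct_card[of "labs t"] by (simp add: LW_trees_def)
    then show ?thesis using length_labs_cherry[of t] that by (simp add: LW_trees_def)
  qed
  moreover have "label_at t [] = root_label t" by (cases t) simp
  ultimately show ?thesis
    by (auto simp: W_trees_def LW_trees_def partially_labeled_trees_iff lwt_iff lw_shape_def)
qed

lemma L_W_trees: "L_trees n \<union> W_trees n = LW_trees n"
  by (auto simp: L_trees_iff W_trees_iff)

section \<open>Evaluation of trees\<close>

text \<open>Multilinearity and normalization are separated from the axioms because an algebra must
  first be shown to evaluate trees by its operations; only then can the axioms be read off.\<close>

locale psb_operations = vector_space scale
  for scale :: "'k::field \<Rightarrow> 'v::ab_group_add \<Rightarrow> 'v" +
  fixes br :: "'v \<Rightarrow> 'v \<Rightarrow> 'v" and M :: "'v list \<Rightarrow> 'v \<Rightarrow> 'v"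
  assumes br_lin_right: "lin (br x)" and br_lin_left: "lin (\<lambda>x. br x y)"
    and M_lin: "lin (M X)" and M_lin_entry: "lin (\<lambda>v. M (A @ v # B) z)"
    and M_Nil [simp]: "M [] z = z"
begin

primrec ev :: "('l \<Rightarrow> 'v) \<Rightarrow> 'l ptree \<Rightarrow> 'v" where
  "ev env (Node l ts) = (case l of None \<Rightarrow> br (map (ev env) ts ! 0) (map (ev env) ts ! 1)
     | Some i \<Rightarrow> M (map (ev env) ts) (env i))"

text \<open>The value of a tree onto whose vertices \<open>w\<close> trees with values \<open>G w\<close> have been grafted.\<close>

primrec evg :: "('l \<Rightarrow> 'v) \<Rightarrow> ('l \<Rightarrow> 'v list) \<Rightarrow> 'l ptree
    \<Rightarrow> 'v" where
  "evg env G (Node l ts) = (case l of None \<Rightarrow> br (map (evg env G) ts ! 0) (map (evg env G) ts ! 1)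
     | Some i \<Rightarrow> M (G i @ map (evg env G) ts) (env i))"

lemma ev_graft: "ev env (graft g t) = evg env (\<lambda>i. map (ev env) (g i)) t"
proof (induction t)
  case (Node l ts)
  then have "map (\<lambda>t. ev env (graft g t)) ts = map (evg env (\<lambda>i. map (ev env) (g i))) ts"
    by simp
  then show ?case by (simp add: comp_def split: option.split del: map_eq_conv)
qed

lemma evg_Nil: "evg env (\<lambda>_. []) t = ev env t"
proof (induction t)
  case (Node l ts)
  then have "map (evg env (\<lambda>_. [])) ts = map (ev env) ts" by simp
  then show ?case by (simp split: option.split del: map_eq_conv)
qed

lemma ev_map_ptree: "ev env (map_ptree f t) = ev (\<lambda>i. env (f i)) t"
proof (induction t)
  case (Node l ts)
  then have "map (\<lambda>t. ev env (map_ptree f t)) ts = map (ev (\<lambda>i. env (f i))) ts" by simp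
  then show ?case by (simp add: comp_def split: option.split del: map_eq_conv)
qed

lemma evg_map_ptree: "evg env G (map_ptree f t) = evg (\<lambda>i. env (f i)) (\<lambda>i. G (f i)) t"
proof (induction t)
  case (Node l ts)
  then have "map (\<lambda>t. evg env G (map_ptree f t)) ts =
      map (evg (\<lambda>i. env (f i)) (\<lambda>i. G (f i))) ts"
    by simp
  then show ?case by (simp add: comp_def split: option.split del: map_eq_conv)
qed

lemma evg_cong:
  "(\<And>i. i \<in> set (labs t) \<Longrightarrow> env i = env' i \<and> G i = G' i) \<Longrightarrow>
      evg env G t = evg env' G' t"
proof (induction t)
  case (Node l ts)
  then have "map (evg env G) ts = map (evg env' G') ts" by auto
  then show ?case using Node.prems by (simp split: option.split del: map_eq_conv)
qed

lemma ev_cong: "(\<And>i. i \<in> set (labs t) \<Longrightarrow> env i = env' i) \<Longrightarrow>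
    ev env t = ev env' t"
  using evg_cong[of t env env' "\<lambda>_. []" "\<lambda>_. []"] by (simp add: evg_Nil)

lemma ev_leaf [simp]: "ev env (leaf i) = env i"
  by simp

lemma ev_cherry [simp]: "ev env (cherry A B) = br (ev env A) (ev env B)"
  by simp

lemma evg_cherry [simp]: "evg env G (cherry A B) = br (evg env G A) (evg env G B)"
  by simp

subsection \<open>Dependence on one vertex\<close>

text \<open>With the root label and the other branches held fixed, the value is linear in branch
  \<open>j\<close>. The environment may vary as long as it agrees elsewhere, which is what updating
  an input inside the branch requires.\<close>

lemma ev_hole:
  assumes "lwt (Node l ts)" "j < length ts"
  shows "\<exists>\<Lambda>. lin \<Lambda> \<and>
      (\<forall>t' env'. (\<forall>k<length ts. k \<noteq> j \<longrightarrow> ev env' (ts ! k) =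
          ev env (ts ! k)) \<longrightarrow>
     (\<forall>a. l = Some a \<longrightarrow> env' a =
         env a) \<longrightarrow> ev env' (Node l (ts[j := t'])) = \<Lambda> (ev env' t'))"
proof (cases l)
  case None
  then have "length ts = 2" using assms by simp
  then obtain A B where ts: "ts = [A, B]" by (auto simp: numeral_2_eq_2 length_Suc_conv)
  show ?thesis
  proof (cases "j = 0")
    case True
    show ?thesis using br_lin_left[of "ev env B"]
        by (intro exI[of _ "\<lambda>x. br x (ev env B)"]) (auto simp: ts True None)
  next
    case False
    then have "j = 1" using assms ts by auto
    then show ?thesis using br_lin_right[of "ev env A"]
        by (intro exI[of _ "br (ev env A)"]) (auto simp: ts None)
  qed
next
  case (Some a)
  let ?A = "map (ev env) (take j ts)" and ?B = "map (ev env) (drop (Suc j) ts)"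
  have "ev env' (Node l (ts[j := t'])) = M (?A @ ev env' t' # ?B) (env a)"
    if *: "\<forall>k<length ts. k \<noteq> j \<longrightarrow> ev env' (ts ! k) =
        ev env (ts ! k)" "env' a = env a" for t' env'
  proof -
    have "map (ev env') (take j ts) = ?A" "map (ev env') (drop (Suc j) ts) = ?B"
      using * assms by (auto simp: in_set_conv_nth)
    then show ?thesis using assms *(2)
      by (simp add: Some upd_conv_take_nth_drop del: map_eq_conv)
  qed
  then show ?thesis
    by (intro exI[of _ "\<lambda>v. M (?A @ v # ?B) (env a)"]) (simp add: Some M_lin_entry)
qed

end

section \<open>Locating a label, and surgery at its vertex\<close>

lemma label_in_labs: "p \<in> vertices t \<Longrightarrow> label_at t p = Some i \<Longrightarrow>
    i \<in> set (labs t)"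
proof (induction p arbitrary: t)
  case Nil
  then show ?case by (cases t) auto
next
  case (Cons j p)
  obtain l ts where t: "t = Node l ts" by (cases t)
  with Cons.prems have "j < length ts" "p \<in> vertices (ts ! j)" "label_at (ts ! j) p = Some i"
    by (auto simp: vertices_Node)
  then show ?case using Cons.IH[of "ts ! j"] by (auto simp: t)
qed

lemma distinct_labs_Node:
  assumes "distinct (labs (Node l ts))"
  shows "j < length ts \<Longrightarrow> distinct (labs (ts ! j))"
    and "j < length ts \<Longrightarrow> k < length ts \<Longrightarrow> j \<noteq> k \<Longrightarrow>
        set (labs (ts ! j)) \<inter> set (labs (ts ! k)) = {}"
    and "l = Some a \<Longrightarrow> j < length ts \<Longrightarrow> a \<notin> set (labs (ts ! j))"
proof -
  have d: "distinct (concat (map labs ts))" using assms by simp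
  show "distinct (labs (ts ! j))" if "j < length ts" using d that by (simp add: distinct_concat_iff)
  show "set (labs (ts ! j)) \<inter> set (labs (ts ! k)) = {}" if "j < length ts" "k < length ts" "j \<noteq> k"
  proof -
    have "j < k \<or> k < j" using that by auto
    have *: "set (labs (ts ! j)) \<inter> set (labs (ts ! k)) = {}" if "j < k" "k < length ts" for j k
    proof -
      have "ts = take k ts @ ts ! k # drop (Suc k) ts" using that by (simp add: id_take_nth_drop)
      then have "distinct (concat (map labs (take k ts @ ts ! k # drop (Suc k) ts)))" using d by simp
      moreover have "ts ! j \<in> set (take k ts)" using that
          by (auto simp: in_set_conv_nth intro!: exI[of _ j])
      ultimately show ?thesis by auto
    qed
    from *[of j k] *[of k j] that show ?thesis by (cases "j < k") auto
  qed
  show "a \<notin> set (labs (ts ! j))" if "l = Some a" "j < length ts" using assms that by auto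
qed

lemma vertex_labeled_eq:
  assumes "distinct (labs t)" "p \<in> vertices t" "label_at t p = Some i"
  shows "vertex_labeled t i = p"
  unfolding vertex_labeled_def
proof (rule the_equality)
  show "p \<in> vertices t \<and> label_at t p = Some i" using assms by simp
  show "q = p" if "q \<in> vertices t \<and> label_at t q = Some i" for q
    using assms that
  proof (induction p arbitrary: q t)
    case Nil
    obtain l ts where t: "t = Node l ts" by (cases t)
    show ?case
    proof (cases q)
      case (Cons j r)
      then have "j < length ts" "i \<in> set (labs (ts ! j))"
        using Nil.prems t label_in_labs[of r "ts ! j" i] by (auto simp: vertices_Node)
      then show ?thesis using distinct_labs_Node(3)[of l ts i j] Nil.prems t by simp
    qed simp
  next
    case (Cons j p)
    obtain l ts where t: "t = Node l ts" by (cases t)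
    have j: "j < length ts" "p \<in> vertices (ts ! j)" "label_at (ts ! j) p = Some i"
      using Cons.prems by (auto simp: t vertices_Node)
    note ij = label_in_labs[OF j(2,3)]
    show ?case
    proof (cases q)
      case Nil
      then show ?thesis using distinct_labs_Node(3)[of l ts i j] Cons.prems t j ij by simp
    next
      case (Cons k r)
      then have k: "k < length ts" "r \<in> vertices (ts ! k)" "label_at (ts ! k) r = Some i"
        using Cons.prems by (auto simp: t vertices_Node)
      note ik = label_in_labs[OF k(2,3)]
      have "k = j" using distinct_labs_Node(2)[of l ts j k] Cons.prems t j k ij ik by auto
      moreover have "r = p"
        using Cons.IH[of "ts ! j" r] distinct_labs_Node(1)[of l ts j] Cons.prems t j k \<open>k =
            j\<close> by simp
      ultimately show ?thesis using Cons by simp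
    qed
  qed
qed

lemma label_exists:
  assumes "i \<in> set (labs t)"
  obtains p where "p \<in> vertices t" "label_at t p = Some i"
proof -
  have "\<exists>p. p \<in> vertices t \<and> label_at t p = Some i"
    using assms
  proof (induction t)
    case (Node l ts)
    show ?case
    proof (cases "l = Some i")
      case True
      then show ?thesis by (intro exI[of _ "[]"]) simp
    next
      case False
      then obtain t where t: "t \<in> set ts" "i \<in> set (labs t)"
        using Node.prems by (auto split: option.splits)
      then obtain j where j: "j < length ts" "t = ts ! j" by (metis in_set_conv_nth)
      from Node.IH[OF t] obtain p where "p \<in> vertices t" "label_at t p = Some i" by blast
      then show ?thesis using j by (intro exI[of _ "j # p"]) (auto simp: vertices_Node)
    qed
  qed
  then show ?thesis using that by blast
qed

lemma replace_vertex_id: "i \<notin> set (labs t) \<Longrightarrow> replace_vertex i h t = t"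
  by (induction t) (auto simp: map_idI)

text \<open>Labels being distinct, the other branches do not contain \<open>i\<close>, and the
  replacement happens inside branch \<open>j\<close> alone.\<close>

lemma replace_vertex_Node:
  assumes "distinct (labs (Node l ts))" "j < length ts" "i \<in> set (labs (ts ! j))"
  shows "replace_vertex i h (Node l ts) = Node l (ts[j := replace_vertex i h (ts ! j)])"
proof -
  have "l \<noteq> Some i" using assms distinct_labs_Node(3) by metis
  moreover have "map (replace_vertex i h) ts = ts[j := replace_vertex i h (ts ! j)]"
  proof (rule nth_equalityI)
    fix k assume k: "k < length (map (replace_vertex i h) ts)"
    show "map (replace_vertex i h) ts ! k = ts[j := replace_vertex i h (ts ! j)] ! k"
    proof (cases "k = j")
      case False
      then have "i \<notin> set (labs (ts ! k))"
          using assms k distinct_labs_Node(2)[OF assms(1), of j k] by auto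
      then show ?thesis using False k by (simp add: replace_vertex_id)
    qed (use k in simp)
  qed simp
  ultimately show ?thesis by simp
qed

text \<open>
  Contracting the edge below the vertex \<open>i\<close> amounts to replacing the successor of \<open>i\<close>; this reduces
  \<^const>\<open>Con_at\<close> to \<^const>\<open>replace_vertex\<close>.
\<close>

definition splice_at :: "nat \<Rightarrow> ('t \<Rightarrow> 't list) \<Rightarrow> 't list \<Rightarrow>
    't list" where
  "splice_at j f us = (if j < length us then take j us @ f (us ! j) @ drop (Suc j) us else us)"

text \<open>After contraction the vertex \<open>i\<close> is gone, but the result is still a
  replacement, now at its labeled successor \<open>a\<close>: the branches of the inserted tree are
  spliced in at position \<open>j\<close>. All claims descend along \<open>q\<close> to the case
  where \<open>a\<close> is the root, hence the single induction.\<close>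

lemma
  assumes "distinct (labs T)" "q @ [j] \<in> vertices T" "label_at T (q @ [j]) = Some i" "label_at T q = Some a"
  shows replace_vertex_child: "replace_vertex i h T =
      replace_vertex a (\<lambda>us. Node (Some a) (splice_at j (\<lambda>t. [h (branches t)]) us)) T"
    and Con_at_replace_vertex: "Con_at (q @ [j]) (replace_vertex i h T) =
      replace_vertex a (\<lambda>us. Node (Some a) (splice_at j (\<lambda>t. branches (h (branches t))) us)) T"
    and parent_child: "q \<in> vertices T" "j < length (branches (subtree_at T q))"
      "branches (subtree_at T q) ! j = Node (Some i) (branches (subtree_at T (q @ [j])))"
proof -
  have "replace_vertex i h T = replace_vertex a (\<lambda>us. Node (Some a) (splice_at j (\<lambda>t. [h
      (branches t)]) us)) T \<and>
    Con_at (q @ [j]) (replace_vertex i h T) =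
      replace_vertex a (\<lambda>us. Node (Some a) (splice_at j (\<lambda>t. branches (h (branches t)))
          us)) T \<and>
    q \<in> vertices T \<and> j < length (branches (subtree_at T q)) \<and>
    branches (subtree_at T q) ! j = Node (Some i) (branches (subtree_at T (q @ [j])))"
    using assms
  proof (induction q arbitrary: T)
    case Nil
    obtain ts where T: "T = Node (Some a) ts" using Nil.prems by (cases T) auto
    have j: "j < length ts" using Nil.prems by (auto simp: T vertices_Node)
    obtain us where us: "ts ! j = Node (Some i) us" using Nil.prems by (cases "ts ! j") (auto simp: T)
    have d: "distinct (labs (Node (Some a) ts))" using Nil.prems by (simp only: T)
    have "replace_vertex i h T = Node (Some a) (ts[j := h us])"
      unfolding T by (subst replace_vertex_Node[OF d j]) (simp_all add: us)
    then show ?case using j by (simp add: T us splice_at_def upd_conv_take_nth_drop nth_append)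
  next
    case (Cons k q)
    obtain l ts where T: "T = Node l ts" by (cases T)
    have k: "k < length ts" and q: "q @ [j] \<in> vertices (ts ! k)" "label_at (ts ! k) (q @ [j]) = Some i"
      "label_at (ts ! k) q = Some a"
      using Cons.prems by (auto simp: T vertices_Node)
    have d: "distinct (labs (Node l ts))" using Cons.prems T by simp
    note IH = Cons.IH[OF distinct_labs_Node(1)[OF d k] q]
    have "i \<in> set (labs (ts ! k))" "a \<in> set (labs (ts ! k))"
      using q IH by (auto intro: label_in_labs)
    note rv = replace_vertex_Node[OF d k this(1)] replace_vertex_Node[OF d k this(2)]
    \<comment> \<open>The descending equation of \<open>Con_at\<close> asks for an address with at
      least two entries; \<open>q @ [j]\<close> supplies the second one.\<close>
    have Con: "Con_at (k # q @ [j]) (Node l (ts[k := t])) = Node l (ts[k := Con_at (q @ [j]) t])" for t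
      using k by (cases "q @ [j]") simp_all
    have "k # q \<in> vertices (Node l ts)" using IH k by (auto simp: vertices_Node)
    then show ?case unfolding T append_Cons rv Con subtree_at.simps ptree.sel
        IH[THEN conjunct2, THEN conjunct1]
      unfolding IH[THEN conjunct1] using IH[THEN conjunct2, THEN conjunct2] by (intro conjI refl) blast+
  qed
  then show "replace_vertex i h T =
      replace_vertex a (\<lambda>us. Node (Some a) (splice_at j (\<lambda>t. [h (branches t)]) us)) T"
    "Con_at (q @ [j]) (replace_vertex i h T) =
      replace_vertex a (\<lambda>us. Node (Some a) (splice_at j (\<lambda>t. branches (h (branches t))) us)) T"
    "q \<in> vertices T" "j < length (branches (subtree_at T q))"
    "branches (subtree_at T q) ! j = Node (Some i) (branches (subtree_at T (q @ [j])))"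
    by blast+
qed

section \<open>Linear contexts of a vertex\<close>

context psb_operations
begin

lemma ev_fun_upd: "i \<notin> set (labs t) \<Longrightarrow> ev (env(i := v)) t = ev env t"
  by (rule ev_cong) auto

text \<open>The label \<open>i\<close> occurs in branch \<open>j\<close> only, so the same linear
  map describes exchanging this branch and changing the input \<open>i\<close>.\<close>

lemma ev_hole_replace:
  assumes "lwt (Node l ts)" "distinct (labs (Node l ts))" "j < length ts" "i \<in> set (labs (ts ! j))"
  obtains \<Lambda> where "lin \<Lambda>" "\<And>t'. ev env (Node l (ts[j := t'])) = \<Lambda> (ev env t')"
    "\<And>v. ev (env(i := v)) (Node l ts) = \<Lambda> (ev (env(i := v)) (ts ! j))"
proof -
  from ev_hole[OF assms(1,3), of env] obtain \<Lambda> where \<Lambda>: "lin \<Lambda>" and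
    *: "\<And>t' env'. (\<forall>k<length ts. k \<noteq> j \<longrightarrow> ev env' (ts ! k) =
        ev env (ts ! k)) \<Longrightarrow>
     (\<forall>a. l = Some a \<longrightarrow> env' a = env a) \<Longrightarrow>
         ev env' (Node l (ts[j := t'])) = \<Lambda> (ev env' t')"
    by blast
  show ?thesis
  proof (rule that[OF \<Lambda>])
    show "ev env (Node l (ts[j := t'])) = \<Lambda> (ev env t')" for t' by (rule *) simp_all
    have "ev (env(i := v)) (Node l (ts[j := ts ! j])) = \<Lambda> (ev (env(i := v)) (ts ! j))" for v
    proof (rule *)
      show "\<forall>k<length ts. k \<noteq> j \<longrightarrow> ev (env(i := v)) (ts ! k) = ev env (ts ! k)"
        using distinct_labs_Node(2)[OF assms(2), of j] assms(3,4) by (intro allI impI ev_fun_upd) blast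
      show "\<forall>a. l = Some a \<longrightarrow> (env(i := v)) a = env a"
        using distinct_labs_Node(3)[OF assms(2), of _ j] assms(3,4) by auto
    qed
    then show "ev (env(i := v)) (Node l ts) = \<Lambda> (ev (env(i := v)) (ts ! j))" for v
      by (simp only: list_update_id)
  qed
qed

lemma lwt_nth: "lwt (Node l ts) \<Longrightarrow> j < length ts \<Longrightarrow> lwt (ts ! j)"
  by (auto simp: full_imp_lwt split: option.splits)

text \<open>The context \<open>\<Lambda>\<close> of the vertex, composed from the maps of
  \<open>ev_hole\<close> along the address. Since it governs both a replacement at \<open>i\<close>
  and the value of the input \<open>i\<close>, comparing the two turns composition of trees into
  substitution in the environment.\<close>

lemma ev_replace_vertex:
  assumes "lwt T" "distinct (labs T)" "p \<in> vertices T" "label_at T p = Some i"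
  obtains \<Lambda> where "lin \<Lambda>"
    "\<And>h. ev env (replace_vertex i h T) = \<Lambda> (ev env (h (branches (subtree_at T p))))"
    "\<And>v. ev (env(i := v)) T = \<Lambda> (M (map (ev env) (branches (subtree_at T p))) v)"
proof -
  have "\<exists>\<Lambda>. lin \<Lambda> \<and> (\<forall>h. ev env (replace_vertex i h T) =
      \<Lambda> (ev env (h (branches (subtree_at T p))))) \<and>
    (\<forall>v. ev (env(i := v)) T = \<Lambda> (M (map (ev env) (branches (subtree_at T p))) v))"
    using assms
  proof (induction p arbitrary: T)
    case Nil
    obtain l ts where T: "T = Node l ts" by (cases T)
    have l: "l = Some i" using Nil.prems T by simp
    have "map (ev (env(i := v))) ts = map (ev env) ts" for v
      using Nil.prems T l by (auto intro!: ev_fun_upd)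
    then have "ev (env(i := v)) T = M (map (ev env) ts) v" for v
      by (simp only: T l ev.simps option.case fun_upd_same)
    then show ?case by (intro exI[of _ "\<lambda>v. v"]) (simp add: T l lin_id del: fun_upd_apply)
  next
    case (Cons j p)
    obtain l ts where T: "T = Node l ts" by (cases T)
    have j: "j < length ts" "p \<in> vertices (ts ! j)" "label_at (ts ! j) p = Some i"
      using Cons.prems by (auto simp: T vertices_Node)
    have i: "i \<in> set (labs (ts ! j))" using j by (metis label_in_labs)
    have d: "distinct (labs (Node l ts))" and lw: "lwt (Node l ts)" using Cons.prems T by auto
    obtain \<Lambda>1 where 1: "lin \<Lambda>1" "\<And>t'. ev env (Node l (ts[j := t'])) =
        \<Lambda>1 (ev env t')"
      "\<And>v. ev (env(i := v)) (Node l ts) = \<Lambda>1 (ev (env(i := v)) (ts ! j))"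
      using ev_hole_replace[OF lw d j(1) i] by blast
    obtain \<Lambda>2 where 2: "lin \<Lambda>2"
      "\<And>h. ev env (replace_vertex i h (ts ! j)) =
          \<Lambda>2 (ev env (h (branches (subtree_at (ts ! j) p))))"
      "\<And>v. ev (env(i := v)) (ts ! j) = \<Lambda>2 (M (map (ev env) (branches (subtree_at (ts ! j) p))) v)"
      using Cons.IH[OF lwt_nth[OF lw j(1)] distinct_labs_Node(1)[OF d j(1)] j(2,3)] by blast
    show ?case
      by (rule exI[of _ "\<lambda>v. \<Lambda>1 (\<Lambda>2 v)"])
        (simp only: T replace_vertex_Node[OF d j(1) i] 1 2 lin_comp subtree_at.simps ptree.sel simp_thms)
  qed
  then show ?thesis using that by blast
qed

text \<open>The same \<open>\<Lambda>\<close>, \<open>A\<close>, \<open>B\<close>, \<open>z\<close>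
  serve with and without contraction: contracting only exchanges one letter of the word above the
  successor for the letters above the contracted root.\<close>

lemma ev_Con_at_replace_vertex:
  assumes "lwt T" "distinct (labs T)" "q @ [j] \<in> vertices T" "label_at T (q @ [j]) = Some i"
    "label_at T q = Some a"
  obtains \<Lambda> A B z where "lin \<Lambda>"
    "\<And>h. ev env (Con_at (q @ [j]) (replace_vertex i h T)) =
      \<Lambda> (M (A @ map (ev env) (branches (h (branches (subtree_at T (q @ [j]))))) @ B) z)"
    "\<And>h. ev env (replace_vertex i h T) = \<Lambda> (M (A @ [ev env (h (branches (subtree_at T (q @
        [j]))))] @ B) z)"
proof -
  note c = parent_child[OF assms(2-5)]
  let ?us = "branches (subtree_at T q)"
  obtain \<Lambda> where "lin \<Lambda>" and \<Lambda>: "\<And>h. ev env (replace_vertex a h T) =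
      \<Lambda> (ev env (h ?us))"
    using ev_replace_vertex[OF assms(1,2) c(1) assms(5), of env] by blast
  show ?thesis
  proof (rule that[OF \<open>lin \<Lambda>\<close>])
    let ?A = "map (ev env) (take j ?us)" and ?B = "map (ev env) (drop (Suc j) ?us)"
    fix h
    show "ev env (Con_at (q @ [j]) (replace_vertex i h T)) =
        \<Lambda> (M (?A @ map (ev env) (branches (h (branches (subtree_at T (q @ [j]))))) @ ?B) (env a))"
      unfolding Con_at_replace_vertex[OF assms(2-5)] \<Lambda> using c(2,3) by (simp add: splice_at_def)
    show "ev env (replace_vertex i h T) =
        \<Lambda> (M (?A @ [ev env (h (branches (subtree_at T (q @ [j]))))] @ ?B) (env a))"
      unfolding replace_vertex_child[OF assms(2-5)] \<Lambda> using c(2,3) by (simp add: splice_at_def)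
  qed
qed

end

section \<open>Grafting as iterated derivation\<close>

text \<open>A grafting is a list \<open>\<phi>\<close> of vertices parallel to the word
  \<open>X\<close>; this is the subword that ends up on \<open>w\<close>, in the order of
  \<open>X\<close>.\<close>

definition pick :: "'l list \<Rightarrow> 'v list \<Rightarrow> 'l \<Rightarrow> 'v list" where
  "pick \<phi> X w = map snd (filter (\<lambda>p. fst p = w) (zip \<phi> X))"

lemma pick_Nil [simp]: "pick [] [] = (\<lambda>_. [])"
  by (simp add: pick_def fun_eq_iff)

lemma pick_Cons: "pick (a # \<phi>) (x # X) = (pick \<phi> X)(a := x # pick \<phi> X a)"
  by (simp add: pick_def fun_eq_iff)

lemma pick_singleton: "pick [a] [x] w = (if w = a then [x] else [])"
  by (simp add: pick_def)

text \<open>Each letter of \<open>X\<close> occurs in exactly one of the subwords, so changing a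
  letter after the distribution is the same as changing it before.\<close>

lemma sum_pick_update:
  fixes h :: "('l \<Rightarrow> 'v list) \<Rightarrow> 'w::comm_monoid_add"
  assumes "length \<phi> = length X" "finite W" "set \<phi> \<subseteq> W"
  shows "(\<Sum>w\<in>W. \<Sum>k<length (pick \<phi> X w). h ((pick \<phi> X)(w := (pick \<phi> X w)[k := f
      (pick \<phi> X w ! k)]))) =
    (\<Sum>k<length X. h (pick \<phi> (X[k := f (X ! k)])))"
  using assms
proof (induction \<phi> X arbitrary: h rule: list_induct2)
  case (Cons a \<phi> x X)
  define G where "G = pick \<phi> X"
  define G' where "G' = G(a := x # G a)"
  have aW: "a \<in> W" and fin: "finite W" using Cons.prems by auto
  let ?S = "\<lambda>w. \<Sum>k<length (G' w). h (G'(w := (G' w)[k := f (G' w ! k)]))"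
  \<comment> \<open>\<open>h'\<close> absorbs the first letter, so that the induction hypothesis,
    for arbitrary \<open>h\<close>, treats the remaining ones.\<close>
  define h' where "h' = (\<lambda>F. h (F(a := x # F a)))"
  have other: "?S w = (\<Sum>k<length (G w). h' (G(w := (G w)[k := f (G w ! k)])))" if "w \<noteq> a" for w
    using that by (intro sum.cong) (auto simp: G'_def h'_def fun_upd_twist)
  have same: "?S a = h (G(a := f x # G a)) + (\<Sum>k<length (G a). h' (G(a := (G a)[k := f (G a ! k)])))"
    unfolding G'_def h'_def by (simp add: sum.lessThan_Suc_shift del: sum.lessThan_Suc)
  have "(\<Sum>w\<in>W. ?S w) = ?S a + (\<Sum>w\<in>W - {a}. ?S w)"
    by (rule sum.remove[OF fin aW])
  also have "(\<Sum>w\<in>W - {a}. ?S w) = (\<Sum>w\<in>W - {a}. \<Sum>k<length (G w). h' (G(w := (G w)[k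
      := f (G w ! k)])))"
    by (rule sum.cong[OF refl], rule other) simp
  also have "?S a + \<dots> = h (G(a := f x # G a)) +
      (\<Sum>w\<in>W. \<Sum>k<length (G w). h' (G(w := (G w)[k := f (G w ! k)])))"
    unfolding same sum.remove[OF fin aW] by (simp only: add.assoc)
  also have "(\<Sum>w\<in>W. \<Sum>k<length (G w). h' (G(w := (G w)[k := f (G w ! k)]))) =
      (\<Sum>k<length X. h' (pick \<phi> (X[k := f (X ! k)])))"
    unfolding G_def by (rule Cons.IH) (use Cons.prems in auto)
  also have "h (G(a := f x # G a)) + \<dots> =
      (\<Sum>k<length (x # X). h (pick (a # \<phi>) ((x # X)[k := f ((x # X) ! k)])))"
    by (simp add: sum.lessThan_Suc_shift pick_Cons G_def h'_def del: sum.lessThan_Suc)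
  finally show ?case unfolding G'_def G_def pick_Cons .
qed simp

lemma sum_list_concat: "(\<Sum>w\<leftarrow>concat xss. f w) =
    (\<Sum>k<length xss. \<Sum>w\<leftarrow>xss ! k. f w)"
  by (induction xss) (simp_all add: sum.lessThan_Suc_shift del: sum.lessThan_Suc)

definition words :: "'l set \<Rightarrow> nat \<Rightarrow> 'l list set" where
  "words W n = {\<phi>. set \<phi> \<subseteq> W \<and> length \<phi> = n}"

lemma words_0 [simp]: "words W 0 = {[]}"
  by (auto simp: words_def)

lemma sum_words_Suc: "(\<Sum>\<phi>\<in>words W (Suc n). f \<phi>) =
    (\<Sum>w\<in>W. \<Sum>\<phi>\<in>words W n. f (w # \<phi>))"
proof -
  have "words W (Suc n) = (\<lambda>(w, \<phi>). w # \<phi>) ` (W \<times> words W n)"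
    by (auto simp: words_def length_Suc_conv)
  moreover have "inj_on (\<lambda>(w, \<phi>). w # \<phi>) (W \<times> words W n)" by (auto simp: inj_on_def)
  ultimately show ?thesis
    by (simp add: sum.reindex sum.cartesian_product) (rule sum.cong, auto)
qed

text \<open>
  The three axioms on \<open>M\<close> are the case of the ideal generators in (i), and the cases of words \<open>X\<close>
  of length one in (iii) and (iv).
\<close>

locale psb_structure = psb_operations +
  assumes M_commutator: "M (A @ [x, y] @ B) z - M (A @ [y, x] @ B) z = M (A @ [br x y] @ B) z"
    and M_deriv: "M [x] (M Y z) = M (x # Y) z + (\<Sum>k<length Y. M (Y[k := M [x] (Y ! k)]) z)"
    and br_deriv: "M [x] (br a b) = br (M [x] a) b + br a (M [x] b)"
    and br_antisym: "br x y = - br y x"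
    and br_jacobi: "br x (br y z) = br (br x y) z + br y (br x z)"
begin

text \<open>The right-hand side of \<open>M_deriv\<close>, with an arbitrary function of the word in
  place of \<open>\<lambda>Y. M Y z\<close>.\<close>

definition modsum :: "'b \<Rightarrow> ('b list \<Rightarrow> 'b) \<Rightarrow> 'b list \<Rightarrow> 'b" where
  "modsum x f Y = f (x # Y) + (\<Sum>k<length Y. f (Y[k := M [x] (Y ! k)]))"

lemma modsum_append:
  "modsum x f (A @ B) = modsum x (\<lambda>A'. f (A' @ B)) A +
      (\<Sum>k<length B. f (A @ B[k := M [x] (B ! k)]))"
proof -
  have *: "(\<Sum>k<m + n. g k) = (\<Sum>k<m. g k) + (\<Sum>k<n. g (m +
      k))" for m n and g :: "nat \<Rightarrow> 'b"
    by (induction n) (simp_all add: add.assoc)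
  show ?thesis
    unfolding modsum_def length_append * by (simp add: list_update_append nth_append add.assoc)
qed

lemma lin_modsum: "lin \<Lambda> \<Longrightarrow> \<Lambda> (modsum x f Y) =
    modsum x (\<lambda>Y. \<Lambda> (f Y)) Y"
  by (simp add: modsum_def lin_add lin_sum)

lemma lin_list_update:
  assumes "k < length C"
  shows "lin (\<lambda>v. M (Y @ C[k := v]) z)"
proof -
  have "(\<lambda>v. M (Y @ C[k := v]) z) = (\<lambda>v. M ((Y @ take k C) @ v # drop (Suc k) C) z)"
    using assms by (simp add: upd_conv_take_nth_drop)
  then show ?thesis by (simp only: M_lin_entry)
qed

lemma modsum_cong: "(\<And>Y'. f Y' = g Y') \<Longrightarrow> modsum x f Y = modsum x g Y"
  by presburger

text \<open>Leibniz rule over the vertices of \<open>R\<close>: \<open>br_deriv\<close> passes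
  \<open>M [x]\<close> through an unlabeled vertex and \<open>M_deriv\<close> through a labeled one.
  The prepended letter joins the word at the root; a letter that is a branch is expanded by the
  induction hypothesis, linearly in that entry.\<close>

lemma evg_deriv:
  assumes "lwt R" "distinct (labs R)"
  shows "M [x] (evg env G R) = (\<Sum>w\<leftarrow>labs R. modsum x (\<lambda>g. evg env (G(w := g)) R) (G w))"
  using assms
proof (induction R)
  case (Node l ts)
  show ?case
    using Node.prems(1)
  proof (cases rule: lwt_cases)
    case (cherry A B)
    then have l: "l = None" and ts: "ts = [A, B]" by auto
    have IH: "M [x] (evg env G A) = (\<Sum>w\<leftarrow>labs A. modsum x (\<lambda>g. evg env (G(w := g))
        A) (G w))"
       "M [x] (evg env G B) = (\<Sum>w\<leftarrow>labs B. modsum x (\<lambda>g. evg env (G(w := g)) B) (G w))"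
      by (rule Node.IH; use Node.prems cherry ts in auto)+
    have disj: "set (labs A) \<inter> set (labs B) = {}" using Node.prems ts by auto
    have 1: "evg env (G(w := g)) (cherry A B) = br (evg env (G(w := g)) A) (evg env G B)"
      if "w \<in> set (labs A)" for w g
    proof -
      have "evg env (G(w := g)) B = evg env G B" by (rule evg_cong) (use disj that in auto)
      then show ?thesis by (simp only: evg_cherry)
    qed
    have 2: "evg env (G(w := g)) (cherry A B) = br (evg env G A) (evg env (G(w := g)) B)"
      if "w \<in> set (labs B)" for w g
    proof -
      have "evg env (G(w := g)) A = evg env G A" by (rule evg_cong) (use disj that in auto)
      then show ?thesis by (simp only: evg_cherry)
    qed
    have 3: "(\<Sum>w\<leftarrow>labs A. modsum x (\<lambda>g. evg env (G(w := g)) (cherry A B)) (G w)) =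
        br (M [x] (evg env G A)) (evg env G B)"
      unfolding IH lin_sum_list[OF br_lin_left] map_map comp_def lin_modsum[OF br_lin_left]
      by (intro arg_cong[of _ _ sum_list] map_cong refl modsum_cong 1)
    have 4: "(\<Sum>w\<leftarrow>labs B. modsum x (\<lambda>g. evg env (G(w := g)) (cherry A B)) (G w)) =
        br (evg env G A) (M [x] (evg env G B))"
      unfolding IH lin_sum_list[OF br_lin_right] map_map comp_def lin_modsum[OF br_lin_right]
      by (intro arg_cong[of _ _ sum_list] map_cong refl modsum_cong 2)
    have "labs (Node l ts) = labs A @ labs B" using l ts by simp
    then show ?thesis unfolding l ts br_deriv evg_cherry
      by (simp only: map_append sum_list_append 3[unfolded evg_cherry] 4[unfolded evg_cherry])
  next
    case (labeled i ts')
    then have l: "l = Some i" and full: "\<forall>t\<in>set ts. full t" by auto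
    let ?C = "map (evg env G) ts" and ?R = "Node l ts"
    have d: "distinct (labs ?R)" by fact
    have i: "i \<notin> set (labs (ts ! k))" if "k < length ts" for k
      using distinct_labs_Node(3)[OF d l that] .
    have root: "evg env (G(i := g)) ?R = M (g @ ?C) (env i)" for g
    proof -
      have "map (evg env (G(i := g))) ts = ?C"
      proof (rule nth_equalityI)
        fix k assume "k < length (map (evg env (G(i := g))) ts)"
        then have k: "k < length ts" by simp
        have "evg env (G(i := g)) (ts ! k) = evg env G (ts ! k)"
          by (rule evg_cong) (use i[OF k] in auto)
        then show "map (evg env (G(i := g))) ts ! k = ?C ! k" using k by (simp only: nth_map)
      qed simp
      then show ?thesis by (simp only: l evg.simps option.case fun_upd_same)
    qed
    have child: "evg env (G(w := g)) ?R = M (G i @ ?C[k := evg env (G(w := g)) (ts ! k)]) (env i)"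
      if k: "k < length ts" and w: "w \<in> set (labs (ts ! k))" for k w g
    proof -
      have "map (evg env (G(w := g))) ts = ?C[k := evg env (G(w := g)) (ts ! k)]"
      proof (rule nth_equalityI)
        fix j assume "j < length (map (evg env (G(w := g))) ts)"
        then have j: "j < length ts" by simp
        show "map (evg env (G(w := g))) ts ! j = ?C[k := evg env (G(w := g)) (ts ! k)] ! j"
        proof (cases "j = k")
          case False
          have "evg env (G(w := g)) (ts ! j) = evg env G (ts ! j)"
            by (rule evg_cong) (use distinct_labs_Node(2)[OF d j k False] w in auto)
          then show ?thesis using j False by (simp only: nth_map nth_list_update_neq)
        qed (use j in \<open>simp del: fun_upd_apply\<close>)
      qed simp
      moreover have iw: "i \<noteq> w" using i[OF k] w by auto
      ultimately show ?thesis by (simp only: l evg.simps option.case fun_upd_other[OF iw])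
    qed
    have sub: "(\<Sum>w\<leftarrow>labs (ts ! k). modsum x (\<lambda>g. evg env (G(w := g)) ?R) (G w)) =
        M (G i @ ?C[k := M [x] (?C ! k)]) (env i)" if k: "k < length ts" for k
    proof -
      have lin: "lin (\<lambda>v. M (G i @ ?C[k := v]) (env i))" using k by (intro lin_list_update) simp
      have IH: "M [x] (?C ! k) = (\<Sum>w\<leftarrow>labs (ts ! k). modsum x (\<lambda>g. evg env (G(w :=
          g)) (ts ! k)) (G w))"
        using Node.IH[of "ts ! k"] k full distinct_labs_Node(1)[OF d k]
            by (simp add: full_imp_lwt del: fun_upd_apply)
      show ?thesis
        unfolding IH lin_sum_list[OF lin] map_map comp_def lin_modsum[OF lin]
        by (intro arg_cong[of _ _ sum_list] map_cong refl modsum_cong child[OF k])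
    qed
    \<comment> \<open>The word above the root is \<open>G i @ ?C\<close>: the part in
      \<open>G i\<close>, with the prepended letter, is the contribution of the root, and each
      letter of \<open>?C\<close> that is hit is the contribution of one branch.\<close>
    have "M [x] (evg env G ?R) = modsum x (\<lambda>Y. M Y (env i)) (G i @ ?C)"
      by (simp add: l M_deriv modsum_def)
    also have "\<dots> = modsum x (\<lambda>g. evg env (G(i := g)) ?R) (G i) +
        (\<Sum>k<length ?C. M (G i @ ?C[k := M [x] (?C ! k)]) (env i))"
      unfolding modsum_append by (simp only: root)
    also have "(\<Sum>k<length ?C. M (G i @ ?C[k := M [x] (?C ! k)]) (env i)) =
      (\<Sum>k<length ts. \<Sum>w\<leftarrow>labs (ts ! k). modsum x (\<lambda>g. evg env (G(w := g)) ?R)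
          (G w))"
      by (rule sum.cong) (simp_all only: sub length_map lessThan_iff)
    also have "\<dots> = (\<Sum>w\<leftarrow>concat (map labs ts). modsum x (\<lambda>g. evg env (G(w :=
        g)) ?R) (G w))"
      unfolding sum_list_concat by simp
    finally show ?thesis by (simp only: l labs.simps option.case append_Cons append_Nil list.map sum_list.Cons)
  qed
qed

text \<open>\<open>M_deriv\<close> solved for the longer word: a recursion, of the kind known from
  the Guin-Oudom construction, by which single letters determine the action of all words.\<close>

lemma M_Cons: "M (x # X) v = M [x] (M X v) - (\<Sum>k<length X. M (X[k := M [x] (X ! k)]) v)"
  by (simp add: M_deriv)

text \<open>
  Each letter \<open>x\<close> acts as a derivation (\<open>evg_deriv\<close>); the terms in which it hits a letter grafted
  before cancel against those of \<open>M_Cons\<close>, so that only the graftings onto the vertices of \<open>R\<close> remain.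
\<close>

theorem M_ev_sum:
  assumes "lwt R" "distinct (labs R)"
  shows "M X (ev env R) = (\<Sum>\<phi>\<in>words (set (labs R)) (length X). evg env (pick \<phi> X) R)"
proof (induction "length X" arbitrary: X)
  case 0
  then show ?case by (simp add: evg_Nil)
next
  case (Suc n)
  let ?W = "set (labs R)" and ?h = "\<lambda>G. evg env G R"
  from Suc.hyps(2) obtain x X' where X: "X = x # X'" "length X' = n" by (cases X) auto
  have W: "finite ?W" by simp
  have step: "M [x] (?h (pick \<phi> X')) = (\<Sum>w\<in>?W. ?h (pick (w # \<phi>) (x # X'))) +
     (\<Sum>k<length X'. ?h (pick \<phi> (X'[k := M [x] (X' ! k)])))" if "\<phi> \<in> words ?W n" for \<phi>
  proof -
    have \<phi>: "set \<phi> \<subseteq> ?W" "length \<phi> = length X'" using that X by (auto simp: words_def)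
    show ?thesis
      unfolding evg_deriv[OF assms] sum_list_distinct_conv_sum_set[OF assms(2)] modsum_def sum.distrib
        sum_pick_update[OF \<phi>(2) W \<phi>(1), of ?h] pick_Cons ..
  qed
  have "M X (ev env R) = M [x] (M X' (ev env R)) - (\<Sum>k<length X'. M (X'[k := M [x] (X' ! k)]) (ev env R))"
    unfolding X(1) by (rule M_Cons)
  also have "M X' (ev env R) = (\<Sum>\<phi>\<in>words ?W n. ?h (pick \<phi> X'))"
    using Suc.hyps(1)[of X'] X by simp
  also have "(\<Sum>k<length X'. M (X'[k := M [x] (X' ! k)]) (ev env R)) =
     (\<Sum>k<length X'. \<Sum>\<phi>\<in>words ?W n. ?h (pick \<phi> (X'[k := M [x] (X' ! k)])))"
    using X by (intro sum.cong refl) (subst Suc.hyps(1), simp_all)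
  also have "M [x] (\<Sum>\<phi>\<in>words ?W n. ?h (pick \<phi> X')) =
     (\<Sum>\<phi>\<in>words ?W n. \<Sum>w\<in>?W. ?h (pick (w # \<phi>) (x # X'))) +
     (\<Sum>\<phi>\<in>words ?W n. \<Sum>k<length X'. ?h (pick \<phi> (X'[k := M [x] (X' ! k)])))"
    unfolding lin_sum[OF M_lin] sum.distrib[symmetric] by (rule sum.cong[OF refl], rule step)
  also have "(\<Sum>\<phi>\<in>words ?W n. \<Sum>k<length X'. ?h (pick \<phi> (X'[k := M [x] (X' ! k)]))) =
     (\<Sum>k<length X'. \<Sum>\<phi>\<in>words ?W n. ?h (pick \<phi> (X'[k := M [x] (X' ! k)])))"
    by (rule sum.swap)
  also have "(\<Sum>\<phi>\<in>words ?W n. \<Sum>w\<in>?W. ?h (pick (w # \<phi>) (x # X'))) =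
     (\<Sum>w\<in>?W. \<Sum>\<phi>\<in>words ?W n. ?h (pick (w # \<phi>) (x # X')))"
    by (rule sum.swap)
  finally show ?case by (simp add: X sum_words_Suc)
qed

end

section \<open>Evaluation of compositions\<close>

lemma root_label_Con [simp]: "root_label (Con t) = root_label t"
  by (cases t) simp

lemma root_label_swap [simp]: "root_label (swap_branches t S) = root_label t"
  by (cases t) simp

lemma root_label_graft [simp]: "root_label (graft g t) = root_label t"
  by (cases t) simp

lemma Con_full: "full t \<Longrightarrow> Con t = t"
proof (induction t)
  case (Node l ts)
  have "concat (map (\<lambda>c. if l = None \<and> root_label c =
      None then branches c else [c]) (map Con ts)) = map Con ts"
    using Node.prems concat_map_singleton[of "\<lambda>c. c" "map Con ts"] by (auto simp: comp_def)
  moreover have "map Con ts = ts" using Node by (auto intro: map_idI)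
  ultimately show ?case by (simp only: Con.simps)
qed

lemma swap_empty: "swap_branches t {} = t"
proof (induction t)
  case (Node l ts)
  have "map (\<lambda>j. (map swap_branches ts ! j) {p. j # p \<in> {}}) [0..<length ts] = ts"
    by (rule nth_equalityI) (simp_all add: Node)
  then show ?case by simp
qed

text \<open>The letters that a subtree contributes to the word above a contracted root.\<close>

definition piece :: "'l ptree \<Rightarrow> 'l ptree list" where
  "piece t = (if root_label t = None then branches t else [t])"

text \<open>A family of exchanges on a cherry is a choice \<open>b\<close> at the root together with
  independent families on the two branches; this is the recursion behind
  \<open>M_word\<close>.\<close>

lemma Pow_unlabeled_cherry:
  "bij_betw (\<lambda>(b, S1, S2). (if b then {[]} else {}) \<union> (#) 0 ` S1 \<union> (#) 1 ` S2)
    (UNIV \<times> Pow (unlabeled_vertices L) \<times> Pow (unlabeled_vertices R))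
    (Pow (unlabeled_vertices (cherry L R)))" (is "bij_betw ?f ?A ?B")
proof (rule bij_betwI')
  have un: "unlabeled_vertices (cherry L R) =
      {[]} \<union> (#) 0 ` unlabeled_vertices L \<union> (#) 1 ` unlabeled_vertices R"
    by (auto simp: unlabeled_Node numeral_2_eq_2 lessThan_Suc)
  show "?f x = ?f y \<longleftrightarrow> x = y" if "x \<in> ?A" "y \<in> ?A" for x y
  proof
    assume eq: "?f x = ?f y"
    obtain b S1 S2 c T1 T2 where xy: "x = (b, S1, S2)" "y = (c, T1, T2)" by (cases x, cases y) auto
    have "b = c" using arg_cong[OF eq, of "\<lambda>S. [] \<in> S"] by (auto simp: xy split: if_splits)
    moreover have "S1 = T1" using arg_cong[OF eq, of "\<lambda>S. {p. 0 # p \<in> S}"]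
        by (auto simp: xy split: if_splits)
    moreover have "S2 = T2" using arg_cong[OF eq, of "\<lambda>S. {p. 1 # p \<in> S}"]
        by (auto simp: xy split: if_splits)
    ultimately show "x = y" by (simp add: xy)
  qed simp
  show "?f x \<in> ?B" if "x \<in> ?A" for x using that by (fastforce simp: un split: if_splits)
  show "\<exists>x\<in>?A. S = ?f x" if S: "S \<in> ?B" for S
  proof (rule bexI[of _ "([] \<in> S, {p. 0 # p \<in> S}, {p. 1 # p \<in> S})"])
    show "([] \<in> S, {p. 0 # p \<in> S}, {p. 1 # p \<in> S}) \<in> ?A" using S by (auto simp: un)
    show "S = ?f ([] \<in> S, {p. 0 # p \<in> S}, {p. 1 # p \<in> S})" using S by (auto simp: un)
  qed
qed

text \<open>Addresses in the set refer to the tree before exchanging: branches are treated first and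
  then reversed. Contraction concatenates the two words, in the order chosen by
  \<open>b\<close>.\<close>

lemma piece_Con_swap_cherry:
  "piece (Con (swap_branches (cherry L R) ((if b then {[]} else {}) \<union> (#) 0 ` S1 \<union> (#) 1 ` S2))) =
    (if b then piece (Con (swap_branches R S2)) @ piece (Con (swap_branches L S1))
     else piece (Con (swap_branches L S1)) @ piece (Con (swap_branches R S2)))" (is "?l = ?r")
proof -
  let ?S = "(if b then {[]} else {}) \<union> (#) 0 ` S1 \<union> (#) 1 ` S2"
  have "{p. 0 # p \<in> ?S} = S1" "{p. Suc 0 # p \<in> ?S} = S2" "[] \<in> ?S \<longleftrightarrow> b" by auto
  then have "swap_branches (cherry L R) ?S =
      Node None (if b then [swap_branches R S2, swap_branches L S1] else [swap_branches L S1, swap_branches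
          R S2])"
    by (simp add: upt_rec numeral_2_eq_2)
  then show ?thesis by (simp add: piece_def)
qed

lemma card_swap_cherry:
  assumes "finite S1" "finite S2"
  shows "card ((if b then {[]} else {}) \<union> (#) (0::nat) ` S1 \<union> (#) 1 ` S2) =
      of_bool b + card S1 + card S2"
proof -
  have "card ((if b then {[]} else {}) \<union> (#) (0::nat) ` S1 \<union> (#) 1 ` S2) =
      card ((if b then {[]} else {}) \<union> (#) (0::nat) ` S1) + card ((#) (1::nat) ` S2)"
    by (rule card_Un_disjoint) (use assms in \<open>auto split: if_splits\<close>)
  also have "card ((if b then {[]} else {}) \<union> (#) (0::nat) ` S1) =
      card (if b then {[]::nat list} else {}) + card ((#) (0::nat) ` S1)"
    by (rule card_Un_disjoint) (use assms in \<open>auto split: if_splits\<close>)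
  finally show ?thesis by (simp add: card_image inj_on_def)
qed

context psb_structure
begin

text \<open>
  The commutator rule expands a bracket among the arguments of \<open>M\<close> into the signed sum of all
  the words obtained by exchanging the entries of the nested brackets.
\<close>

lemma M_word:
  assumes "lwt R"
  shows "(\<Sum>S\<in>Pow (unlabeled_vertices R). scale ((-1) ^ card S)
      (M (A @ map (evg env G) (piece (Con (swap_branches R S))) @ B) z)) = M (A @ [evg env G R] @ B) z"
  using assms
proof (induction arbitrary: A B rule: lwt_induct)
  case (labeled i ts)
  then have "full (Node (Some i) ts)" by simp
  then have un: "unlabeled_vertices (Node (Some i) ts) = {}" and Con: "Con (Node (Some i) ts) =
      Node (Some i) ts"
    using full_iff Con_full by blast+
  have "(\<Sum>S\<in>Pow (unlabeled_vertices (Node (Some i) ts)). scale ((-1) ^ card S)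
      (M (A @ map (evg env G) (piece (Con (swap_branches (Node (Some i) ts) S))) @ B) z)) =
      M (A @ map (evg env G) (piece (Con (swap_branches (Node (Some i) ts) {}))) @ B) z"
    unfolding un by (simp del: swap_branches.simps Con.simps)
  also have "piece (Con (swap_branches (Node (Some i) ts) {})) = [Node (Some i) ts]"
    unfolding swap_empty Con by (simp add: piece_def)
  finally show ?case by (simp only: list.map)
next
  case (cherry L R)
  let ?U = "unlabeled_vertices L" and ?V = "unlabeled_vertices R"
  let ?P = "\<lambda>t S. map (evg env G) (piece (Con (swap_branches t S)))"
  let ?s = "\<lambda>S v. scale ((-1) ^ card (S :: nat list set)) v"
  let ?f = "\<lambda>S. ?s S (M (A @ ?P (cherry L R) S @ B) z)"
  let ?g = "\<lambda>(b, S1, S2). (if b then {[]} else {}) \<union> (#) 0 ` S1 \<union> (#) 1 ` S2"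
  have "(\<Sum>S\<in>Pow (unlabeled_vertices (cherry L R)). ?f S) =
    (\<Sum>x\<in>UNIV \<times> Pow ?U \<times> Pow ?V. ?f (?g x))"
    by (rule sum.reindex_bij_betw[OF Pow_unlabeled_cherry, symmetric])
  also have "\<dots> = (\<Sum>b\<in>UNIV. \<Sum>S1\<in>Pow ?U. \<Sum>S2\<in>Pow ?V. ?f (?g (b, S1, S2)))"
    by (simp only: sum.cartesian_product split_def fst_conv snd_conv prod.collapse)
  also have "\<dots> = (\<Sum>S1\<in>Pow ?U. \<Sum>S2\<in>Pow ?V. ?s S1 (?s S2 (M (A @ ?P L S1 @ ?P R S2 @
      B) z))) -
      (\<Sum>S1\<in>Pow ?U. \<Sum>S2\<in>Pow ?V. ?s S1 (?s S2 (M (A @ ?P R S2 @ ?P L S1 @ B) z)))"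
  proof -
    \<comment> \<open>An exchange at the root adds one element to the set, hence the sign, and puts
      the word of \<open>R\<close> before that of \<open>L\<close>.\<close>
    have "?f (?g (b, S1, S2)) = (if b then - ?s S1 (?s S2 (M (A @ ?P R S2 @ ?P L S1 @ B) z))
        else ?s S1 (?s S2 (M (A @ ?P L S1 @ ?P R S2 @ B) z)))"
      if "S1 \<in> Pow ?U" "S2 \<in> Pow ?V" for b S1 S2
    proof -
      have "finite S1" "finite S2" using that finite_unlabeled by (auto dest: finite_subset)
      then show ?thesis unfolding split_def fst_conv snd_conv card_swap_cherry[OF \<open>finite S1\<close>
          \<open>finite S2\<close>]
          piece_Con_swap_cherry
        by (simp add: power_add)
    qed
    then have "(\<Sum>S1\<in>Pow ?U. \<Sum>S2\<in>Pow ?V. ?f (?g (b, S1, S2))) =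
      (\<Sum>S1\<in>Pow ?U. \<Sum>S2\<in>Pow ?V. (if b then - ?s S1 (?s S2 (M (A @ ?P R S2 @ ?P L S1 @ B) z))
        else ?s S1 (?s S2 (M (A @ ?P L S1 @ ?P R S2 @ B) z))))" for b
      by (intro sum.cong refl)
    then show ?thesis by (simp add: UNIV_bool sum_negf del: split_paired_Ex)
  qed
  \<comment> \<open>The inner sum collapses by the hypothesis for \<open>R\<close> with the letters
    of \<open>L\<close> moved into the prefix, which is why \<open>A\<close> and \<open>B\<close>
    are arbitrary in the induction.\<close>
  also have "(\<Sum>S1\<in>Pow ?U. \<Sum>S2\<in>Pow ?V. ?s S1 (?s S2 (M (A @ ?P L S1 @ ?P R S2 @ B) z))) =
      (\<Sum>S1\<in>Pow ?U. ?s S1 (M ((A @ ?P L S1) @ [evg env G R] @ B) z))"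
    unfolding scale_sum_right[symmetric] cherry.IH(2)[symmetric] by simp
  also have "\<dots> = M (A @ [evg env G L] @ [evg env G R] @ B) z"
    unfolding append.assoc by (rule cherry.IH(1))
  also have "(\<Sum>S1\<in>Pow ?U. \<Sum>S2\<in>Pow ?V. ?s S1 (?s S2 (M (A @ ?P R S2 @ ?P L S1 @ B) z))) =
      (\<Sum>S1\<in>Pow ?U. ?s S1 (M (A @ [evg env G R] @ ?P L S1 @ B) z))"
    unfolding scale_sum_right[symmetric] cherry.IH(2)[symmetric] ..
  also have "\<dots> = M (A @ [evg env G R] @ [evg env G L] @ B) z"
    using cherry.IH(1)[of "A @ [evg env G R]" B] by simp
  also have "M (A @ [evg env G L] @ [evg env G R] @ B) z - M (A @ [evg env G R] @ [evg env G L] @ B) z =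
      M (A @ [evg env G (cherry L R)] @ B) z"
    using M_commutator[of A "evg env G L" "evg env G R" B z] by simp
  finally show ?case .
qed

end

section \<open>Grafting maps as words, and the evaluation of a composition\<close>

lemma pick_map_nth:
  assumes "length \<phi> = length X"
  shows "pick \<phi> X w = map (\<lambda>j. X ! j) (filter (\<lambda>j. \<phi> ! j = w) [0..<length X])"
proof -
  have "zip \<phi> X = map (\<lambda>j. (\<phi> ! j, X ! j)) [0..<length X]"
    using assms by (intro nth_equalityI) simp_all
  then show ?thesis by (simp add: pick_def filter_map comp_def)
qed

text \<open>The compositions sum over extensional functions, while the induction in
  \<open>M_ev_sum\<close> runs over lists; this carries one sum into the other.\<close>

lemma words_eq_PiE:
  "bij_betw (\<lambda>\<phi>. map \<phi> [0..<d]) ({..<d} \<rightarrow>\<^sub>E W) (words W d)"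
proof (rule bij_betwI')
  show "map \<phi> [0..<d] = map \<psi> [0..<d] \<longleftrightarrow> \<phi> =
      \<psi>" if "\<phi> \<in> {..<d} \<rightarrow>\<^sub>E W" "\<psi> \<in> {..<d} \<rightarrow>\<^sub>E
          W" for \<phi> \<psi>
    using PiE_ext[OF that] by auto
  show "map \<phi> [0..<d] \<in> words W d" if "\<phi> \<in> {..<d} \<rightarrow>\<^sub>E W" for \<phi>
    using PiE_mem[OF that] by (auto simp: words_def)
  show "\<exists>\<phi>\<in>{..<d} \<rightarrow>\<^sub>E W. w =
      map \<phi> [0..<d]" if w: "w \<in> words W d" for w
  proof (rule bexI[of _ "restrict (nth w) {..<d}"])
    show "w = map (restrict (nth w) {..<d}) [0..<d]"
      using w by (intro nth_equalityI) (auto simp: words_def)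
    show "restrict (nth w) {..<d} \<in> {..<d} \<rightarrow>\<^sub>E W"
      using w by (auto simp: words_def PiE_iff intro: subsetD[OF _ nth_mem])
  qed
qed

lemma vertices_map_ptree [simp]: "vertices (map_ptree f t) = vertices t"
  by (induction t) (simp add: vertices_Node)

lemma subtree_at_map_ptree: "p \<in> vertices t \<Longrightarrow>
    subtree_at (map_ptree f t) p = map_ptree f (subtree_at t p)"
proof (induction p arbitrary: t)
  case (Cons j p)
  then show ?case by (cases t) (auto simp: vertices_Node)
qed simp

lemma label_at_map_ptree: "p \<in> vertices t \<Longrightarrow>
    label_at (map_ptree f t) p = map_option f (label_at t p)"
  by (simp add: label_at_def subtree_at_map_ptree ptree.map_sel)

lemma butlast_vertices: "p \<in> vertices t \<Longrightarrow> butlast p \<in> vertices t"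
proof (induction p arbitrary: t)
  case (Cons j p)
  then show ?case by (cases t) (auto simp: vertices_Node)
qed simp

context psb_operations
begin

text \<open>The shift of the labels of \<open>R\<close> by \<open>c\<close> is absorbed by the
  environment, and it cancels in the test \<open>\<phi> j + c = w\<close>.\<close>

lemma ev_graft_comp:
  "ev env (graft (\<lambda>w. map ((!) ts) (filter (\<lambda>j. \<phi> j + c =
      w) [0..<length ts])) (map_ptree (\<lambda>k. k + c) R)) =
    evg (\<lambda>k. env (k + c)) (pick (map \<phi> [0..<length ts]) (map (ev env) ts)) R" for c :: nat
proof -
  have "map (ev env) (map ((!) ts) (filter (\<lambda>j. \<phi> j + c = w + c) [0..<length ts])) =
      pick (map \<phi> [0..<length ts]) (map (ev env) ts) w" for w
  proof -
    have "filter (\<lambda>j. \<phi> j = w) [0..<length ts] =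
        filter (\<lambda>j. map \<phi> [0..<length ts] ! j = w) [0..<length ts]"
      by (rule filter_cong) auto
    then show ?thesis by (auto simp: pick_map_nth)
  qed
  then show ?thesis by (simp only: ev_graft evg_map_ptree)
qed

end

lemma LW_trees_pos: "t \<in> LW_trees n \<Longrightarrow> n \<ge> 1"
  using labs_nonempty[of t] by (cases n) (auto simp: LW_trees_def)

context psb_structure
begin

text \<open>Composition becomes substitution of the value of \<open>R\<close> for the input
  \<open>i\<close>. Without contraction this is \<open>M_ev_sum\<close> seen through the context of
  the vertex. With contraction, \<open>M_word\<close> first reduces the signed sum to the sum
  without contraction.\<close>

theorem ev_lw_tree_comp:
  assumes T: "T \<in> LW_trees m" and R: "R \<in> LW_trees n" and i: "i \<in> {1..m}"
  shows "lcomb (ev env) (lw_tree_comp n i T R) =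
    ev (\<lambda>k. if k < i then env k else if k =
        i then ev (\<lambda>k. env (k + (i - 1))) R else env (k + n - 1)) T"
proof -
  let ?f = "\<lambda>k. if k > i then k + n - 1 else k"
  define T' where "T' = map_ptree ?f T"
  define c where "c = i - 1"
  have n: "n \<ge> 1" using R by (rule LW_trees_pos)
  have lT: "lwt T" "distinct (labs T)" "set (labs T) = {1..m}" using T by (auto simp: LW_trees_def)
  have lR: "lwt R" "distinct (labs R)" "set (labs R) = {1..n}" using R by (auto simp: LW_trees_def)
  have "inj_on ?f X" for X using n by (auto simp: inj_on_def)
  then have lT': "lwt T'" "distinct (labs T')"
    using lT by (auto simp: T'_def labs_map_ptree distinct_map)
  obtain p where p: "p \<in> vertices T" "label_at T p = Some i" using label_exists[of i T] lT i by auto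
  have vl: "vertex_labeled T i = p" by (rule vertex_labeled_eq[OF lT(2) p])
  have p': "p \<in> vertices T'" "label_at T' p = Some i"
    using p by (simp_all add: T'_def label_at_map_ptree)
  define ts where "ts = branches (subtree_at T' p)"
  define X where "X = map (ev env) ts"
  define v where "v = ev (\<lambda>k. env (k + c)) R"
  define h where "h = (\<lambda>\<phi> R ts. graft (\<lambda>w. map ((!) ts) (filter (\<lambda>j. \<phi> j
      + c = w) [0..<length ts])) (map_ptree (\<lambda>k. k + c) R))"
  define \<Phi> where "\<Phi> = {..<length ts} \<rightarrow>\<^sub>E {1..n}"
  define e where "e = (\<lambda>\<phi>. evg (\<lambda>k. env (k + c)) (pick (map \<phi> [0..<length ts]) X))"
  have h: "ev env (h \<phi> R ts) = e \<phi> R" for \<phi> R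
    unfolding h_def e_def X_def by (rule ev_graft_comp)
  have along: "tree_comp_along \<phi> n i T R = replace_vertex i (h \<phi> R) T'" for \<phi> R
    unfolding tree_comp_along_def h_def T'_def c_def ..
  have maps: "grafting_maps n i T = \<Phi>"
    using p by (simp add: grafting_maps_def vl \<Phi>_def ts_def T'_def subtree_at_map_ptree in_degree_def
        ptree.map_sel)
  have rhs: "ev (\<lambda>k. if k < i then env k else if k =
      i then ev (\<lambda>k. env (k + (i - 1))) R else env (k + n - 1)) T =
      ev (env(i := v)) T'"
    unfolding T'_def ev_map_ptree v_def c_def by (rule ev_cong) (use n in auto)
  \<comment> \<open>Grafting maps are the words of length \<open>length ts\<close> over the labels
    of \<open>R\<close>, so \<open>M_ev_sum\<close> applies to the word \<open>X\<close> of values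
    above the vertex.\<close>
  have sum_e: "(\<Sum>\<phi>\<in>\<Phi>. e \<phi> R) = M X v"
    unfolding v_def M_ev_sum[OF lR(1,2)] lR(3) e_def \<Phi>_def
    using sum.reindex_bij_betw[OF words_eq_PiE, of "\<lambda>\<phi>. evg (\<lambda>k. env (k +
        c)) (pick \<phi> X) R" "length ts" "{1..n}"]
    by (simp add: X_def)
  obtain \<Lambda> where \<Lambda>: "lin \<Lambda>" "\<And>h. ev env (replace_vertex i h T') =
      \<Lambda> (ev env (h ts))"
    "\<And>v. ev (env(i := v)) T' = \<Lambda> (M X v)"
    using ev_replace_vertex[OF lT' p', of env] unfolding ts_def X_def by blast
  have plain: "(\<Sum>\<phi>\<in>\<Phi>. ev env (replace_vertex i (h \<phi> R) T')) = ev (env(i := v)) T'"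
    by (simp only: \<Lambda>(2,3) h sum_e[symmetric] lin_sum[OF \<Lambda>(1)])
  let ?con = "R \<in> W_trees n \<and> p \<noteq> [] \<and> label_at T (butlast p) \<noteq> None"
  show ?thesis
  proof (cases ?con)
    case False
    then have "(lw_tree_comp n i T R :: _ \<Rightarrow>\<^sub>0 'a) =
        (\<Sum>\<phi>\<in>\<Phi>. basis (replace_vertex i (h \<phi> R) T'))"
      unfolding lw_tree_comp_def vl Let_def pt_comp_def maps along by (simp only: if_False)
    then show ?thesis unfolding rhs plain[symmetric] by (simp only: lcomb_sum lcomb_basis)
  next
    case True
    then have root: "root_label R = None" by (simp add: W_trees_iff)
    obtain q j where q: "p = q @ [j]" using True by (metis append_butlast_last_id)
    then obtain a where a: "label_at T' q = Some a"
      using True butlast_vertices[OF p(1)] by (auto simp: T'_def label_at_map_ptree)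
    obtain \<Lambda> A B z where \<Lambda>: "lin \<Lambda>"
      "\<And>h. ev env (Con_at p (replace_vertex i h T')) =
          \<Lambda> (M (A @ map (ev env) (branches (h ts)) @ B) z)"
      "\<And>h. ev env (replace_vertex i h T') = \<Lambda> (M (A @ [ev env (h ts)] @ B) z)"
      using ev_Con_at_replace_vertex[OF lT' p'[unfolded q] a, of env] unfolding ts_def q by blast
    let ?c = "\<lambda>S. Con (swap_branches R S)"
    have comp: "(lw_tree_comp n i T R :: _ \<Rightarrow>\<^sub>0 'a) =
        (\<Sum>S\<in>Pow (unlabeled_vertices R). fscale ((-1) ^ card S)
            (lin_ext (\<lambda>t. basis (Con_at p t)) (\<Sum>\<phi>\<in>\<Phi>. basis (replace_vertex i (h
                \<phi> (?c S)) T'))))"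
      unfolding lw_tree_comp_def vl Let_def pt_comp_def maps along using True by (simp only: if_True simp_thms)
    \<comment> \<open>Grafting adds edges at labeled vertices only, so above the unlabeled root of
      \<open>?c S\<close> stand just the branches of \<open>?c S\<close>, each with its own
      graftings.\<close>
    have branches: "map (ev env) (branches (h \<phi> (?c S) ts)) = map (e \<phi>) (piece (?c S))" for \<phi> S
    proof -
      obtain us where us: "?c S = Node None us" using root
          by (metis ptree.collapse root_label_Con root_label_swap)
      have "branches (h \<phi> (?c S) ts) = map (\<lambda>t. h \<phi> t ts) us" by (simp add: h_def us)
      then show ?thesis by (simp only: map_map comp_def h us piece_def ptree.sel simp_thms if_True)
    qed
    have "lcomb (ev env) (lw_tree_comp n i T R) = (\<Sum>S\<in>Pow (unlabeled_vertices R). scale ((-1) ^ card S)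
        (\<Sum>\<phi>\<in>\<Phi>. \<Lambda> (M (A @ map (e \<phi>) (piece (?c S)) @ B) z)))"
      by (simp only: comp lcomb_sum lcomb_fscale lin_ext_simps lcomb_basis \<Lambda>(2) branches)
    \<comment> \<open>The grafting map does not depend on \<open>S\<close>, so the sums may be
      interchanged; for fixed \<open>\<phi>\<close> the inner sum is the one of
      \<open>M_word\<close>.\<close>
    also have "\<dots> = (\<Sum>\<phi>\<in>\<Phi>. \<Lambda> (\<Sum>S\<in>Pow (unlabeled_vertices R). scale
        ((-1) ^ card S)
        (M (A @ map (e \<phi>) (piece (?c S)) @ B) z)))"
      unfolding scale_sum_right lin_sum[OF \<Lambda>(1)] lin_scale[OF \<Lambda>(1)] by (rule sum.swap)
    also have "\<dots> = (\<Sum>\<phi>\<in>\<Phi>. ev env (replace_vertex i (h \<phi> R) T'))"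
      unfolding \<Lambda>(3) h e_def M_word[OF lR(1)] ..
    finally show ?thesis unfolding rhs plain .
  qed
qed

end

section \<open>Closure of the trees of LW under composition\<close>

text \<open>Multisets of labels are additive under grafting and replacement, so that the labels of a
  composite can be computed instead of argued about by disjointness.\<close>

lemma LW_trees_mset: "t \<in> LW_trees n \<longleftrightarrow> lwt t \<and> mset (labs t) = mset_set {1..n}"
proof -
  have "mset (labs t) = mset_set {1..n} \<longleftrightarrow> distinct (labs t) \<and> set (labs t) = {1..n}"
  proof
    assume eq: "mset (labs t) = mset_set {1..n}"
    have set: "set (labs t) = {1..n}" using arg_cong[OF eq, of set_mset] by simp
    with eq show "distinct (labs t) \<and> set (labs t) = {1..n}"
      by (simp add: distinct_count_atmost_1 count_mset_set')
  next
    assume "distinct (labs t) \<and> set (labs t) = {1..n}"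
    then show "mset (labs t) = mset_set {1..n}" by (metis mset_set_set)
  qed
  then show ?thesis by (simp add: LW_trees_def)
qed

lemma sum_list_concat_map: "(\<Sum>w\<leftarrow>concat (map g ts). f w) =
    (\<Sum>t\<leftarrow>ts. \<Sum>w\<leftarrow>g t. f w)"
  by (induction ts) simp_all

lemma mset_labs_graft:
  "mset (labs (graft g t)) = mset (labs t) + (\<Sum>w\<leftarrow>labs t. mset (concat (map labs (g w))))"
proof (induction t)
  case (Node l ts)
  have "(\<Sum>t\<leftarrow>ts. mset (labs (graft g t))) =
      (\<Sum>t\<leftarrow>ts. mset (labs t) + (\<Sum>w\<leftarrow>labs t. mset (concat (map labs (g w)))))"
    using Node by (intro arg_cong[of _ _ sum_list] map_cong refl)
  also have "\<dots> = (\<Sum>t\<leftarrow>ts. mset (labs t)) +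
      (\<Sum>w\<leftarrow>concat (map labs ts). mset (concat (map labs (g w))))"
    by (simp only: sum_list_addf sum_list_concat_map)
  finally show ?case
    by (cases l) (simp_all add: mset_concat comp_def)
qed

text \<open>Each \<open>ts ! j\<close> is grafted exactly once, onto the vertex \<open>f j\<close>;
  summing over the vertices regroups the sum over \<open>j\<close>.\<close>

lemma mset_labs_graft_words:
  assumes "distinct (labs R)" "\<And>j. j < length ts \<Longrightarrow> f j \<in> set (labs R)"
  shows "mset (labs (graft (\<lambda>w. map ((!) ts) (filter (\<lambda>j. f j = w) [0..<length ts])) R)) =
    mset (labs R) + mset (concat (map labs ts))"
proof -
  have "mset (concat (map labs (map ((!) ts) (filter (\<lambda>j. f j = w) [0..<length ts])))) =
      (\<Sum>j\<in>{j \<in> {..<length ts}. f j = w}. mset (labs (ts ! j)))" for w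
  proof -
    have "(\<Sum>j\<leftarrow>filter (\<lambda>j. f j = w) [0..<length ts]. mset (labs (ts ! j))) =
       (\<Sum>j\<in>set (filter (\<lambda>j. f j = w) [0..<length ts]). mset (labs (ts ! j)))"
      by (rule sum_list_distinct_conv_sum_set) simp
    moreover have "set (filter (\<lambda>j. f j = w) [0..<length ts]) = {j \<in> {..<length ts}. f j =
        w}" by auto
    ultimately show ?thesis by (simp add: mset_concat comp_def)
  qed
  then have "(\<Sum>w\<leftarrow>labs R. mset (concat (map labs (map ((!) ts) (filter (\<lambda>j. f j =
      w) [0..<length ts]))))) =
     (\<Sum>w\<in>set (labs R). \<Sum>j\<in>{j \<in> {..<length ts}. f j = w}. mset (labs (ts ! j)))"
    by (simp only: sum_list_distinct_conv_sum_set[OF assms(1)])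
  also have "\<dots> = (\<Sum>j<length ts. mset (labs (ts ! j)))"
    by (rule sum.group) (use assms(2) in auto)
  also have "\<dots> = mset (concat (map labs ts))"
    by (simp add: mset_concat sum_list_sum_nth atLeast0LessThan comp_def)
  finally show ?thesis unfolding mset_labs_graft by (rule arg_cong)
qed

text \<open>The removed labels are added on the left, since subtraction of multisets is truncated;
  \<open>exchange_add\<close> chains equations of this form.\<close>

lemma mset_labs_list_update:
  assumes "j < length ts"
  shows "mset (labs (Node l (ts[j := t']))) + mset (labs (ts ! j)) = mset (labs (Node l ts)) + mset (labs t')"
proof -
  have "mset (labs (Node l ts)) = mset (labs (Node l (take j ts @ ts ! j # drop (Suc j) ts)))"
    using assms by (simp only: id_take_nth_drop[symmetric])
  then show ?thesis using assms by (simp add: upd_conv_take_nth_drop)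
qed

lemma exchange_add:
  fixes r :: "'a::cancel_comm_monoid_add"
  assumes "a + k = x + b" "r + x = t + a"
  shows "r + k = t + b"
proof -
  have "r + k + x = t + (a + k)" using assms(2) by (simp add: ac_simps)
  also have "\<dots> = t + b + x" by (simp add: assms(1) ac_simps)
  finally show ?thesis by simp
qed

lemma mset_labs_replace_vertex:
  assumes "distinct (labs T)" "p \<in> vertices T" "label_at T p = Some i"
  shows "mset (labs (replace_vertex i h T)) + mset (i # concat (map labs (branches (subtree_at T p)))) =
    mset (labs T) + mset (labs (h (branches (subtree_at T p))))"
  using assms
proof (induction p arbitrary: T)
  case Nil
  then show ?case by (cases T) simp
next
  case (Cons j p)
  obtain l ts where T: "T = Node l ts" by (cases T)
  have j: "j < length ts" "p \<in> vertices (ts ! j)" "label_at (ts ! j) p = Some i"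
    using Cons.prems by (auto simp: T vertices_Node)
  have d: "distinct (labs (Node l ts))" using Cons.prems T by simp
  have i: "i \<in> set (labs (ts ! j))" using j by (metis label_in_labs)
  have IH: "mset (labs (replace_vertex i h (ts ! j))) +
      mset (i # concat (map labs (branches (subtree_at (ts ! j) p)))) =
    mset (labs (ts ! j)) + mset (labs (h (branches (subtree_at (ts ! j) p))))"
    using Cons.IH[OF distinct_labs_Node(1)[OF d j(1)] j(2,3)] .
  have "mset (labs (replace_vertex i h T)) + mset (labs (ts ! j)) =
      mset (labs T) + mset (labs (replace_vertex i h (ts ! j)))"
    unfolding T replace_vertex_Node[OF d j(1) i] by (rule mset_labs_list_update[OF j(1)])
  from exchange_add[OF IH this] show ?case by (simp only: T subtree_at.simps ptree.sel)
qed

text \<open>Only the branches of the inserted tree count, because its root merges with the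
  successor, which keeps its label \<open>a\<close>.\<close>

lemma mset_labs_Con_at_replace_vertex:
  assumes "distinct (labs T)" "q @ [j] \<in> vertices T" "label_at T (q @ [j]) = Some i" "label_at T q = Some a"
  shows "mset (labs (Con_at (q @ [j]) (replace_vertex i h T))) +
      mset (i # concat (map labs (branches (subtree_at T (q @ [j]))))) =
    mset (labs T) + mset (concat (map labs (branches (h (branches (subtree_at T (q @ [j])))))))"
proof -
  note c = parent_child[OF assms]
  let ?us = "branches (subtree_at T q)"
  have us: "?us = take j ?us @ Node (Some i) (branches (subtree_at T (q @ [j]))) # drop (Suc j) ?us"
    using id_take_nth_drop[OF c(2)] unfolding c(3) .
  have "concat (map labs ?us) = concat (map labs (take j ?us)) @
      (i # concat (map labs (branches (subtree_at T (q @ [j]))))) @ concat (map labs (drop (Suc j) ?us))"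
    by (subst us) simp
  then show ?thesis
    using mset_labs_replace_vertex[OF assms(1) c(1) assms(4),
        of "\<lambda>us. Node (Some a) (splice_at j (\<lambda>t. branches (h (branches t))) us)"]
    by (simp add: Con_at_replace_vertex[OF assms] splice_at_def c(2,3))
qed

lemma full_replace_vertex:
  assumes "\<And>us. \<forall>t\<in>set us. full t \<Longrightarrow> full (h us)"
  shows "full T \<Longrightarrow> full (replace_vertex i h T)"
  by (induction T) (auto intro: assms)

lemma lwt_replace_vertex:
  assumes "\<And>us. \<forall>t\<in>set us. full t \<Longrightarrow> full (h us)" "lwt T"
  shows "lwt (replace_vertex i h T)"
  using assms(2)
proof (induction rule: lwt_induct)
  case (labeled a ts)
  have "full (replace_vertex i h (Node (Some a) ts))"
    by (rule full_replace_vertex[OF assms(1)]) (use labeled in simp_all)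
  then show ?case by (rule full_imp_lwt)
qed simp

lemma full_label_at: "full t \<Longrightarrow> p \<in> vertices t \<Longrightarrow> label_at t p \<noteq> None"
  using full_iff[of t] by (auto simp: unlabeled_vertices_def)

text \<open>If the successor of \<open>i\<close> is unlabeled, so is every vertex from there down to
  the root; a tree with unlabeled root can then be inserted without leaving the shape.\<close>

lemma lwt_replace_vertex_unlabeled:
  assumes "\<And>us. \<forall>t\<in>set us. full t \<Longrightarrow> lwt (h us)" "lwt T" "distinct (labs T)"
    "p \<in> vertices T" "label_at T p = Some i" "p = [] \<or> label_at T (butlast p) = None"
  shows "lwt (replace_vertex i h T)"
  using assms(2-)
proof (induction p arbitrary: T)
  case Nil
  then show ?case by (cases T) (auto intro: assms(1))
next
  case (Cons j p)
  obtain l ts where T: "T = Node l ts" by (cases T)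
  have j: "j < length ts" "p \<in> vertices (ts ! j)" "label_at (ts ! j) p = Some i"
    using Cons.prems by (auto simp: T vertices_Node)
  have d: "distinct (labs (Node l ts))" and lw: "lwt (Node l ts)" using Cons.prems T by auto
  have i: "i \<in> set (labs (ts ! j))" using j by (metis label_in_labs)
  have l: "l = None"
  proof (cases "p = []")
    case False
    then have "label_at (ts ! j) (butlast p) = None" using Cons.prems T by simp
    then have "\<not> full (ts ! j)" using full_label_at[OF _ butlast_vertices[OF j(2)]] by blast
    then show ?thesis using lw j by (cases l) auto
  qed (use Cons.prems T in simp)
  have "lwt (replace_vertex i h (ts ! j))"
    using Cons.IH[OF _ _ j(2,3)] lw d j(1) Cons.prems T l distinct_labs_Node(1)[OF d j(1)]
    by (cases "p = []") simp_all
  then show ?case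
    unfolding T replace_vertex_Node[OF d j(1) i] using lw l
        by (auto dest!: set_update_subset_insert[THEN subsetD])
qed

lemma full_graft: "full R \<Longrightarrow> (\<And>w. \<forall>t\<in>set (g w). full t) \<Longrightarrow>
    full (graft g R)"
  by (induction R) auto

lemma lwt_graft: "lwt R \<Longrightarrow> (\<And>w. \<forall>t\<in>set (g w). full t) \<Longrightarrow>
    lwt (graft g R)"
  by (induction rule: lwt_induct) (auto intro!: full_graft)

text \<open>Contraction removes all unlabeled vertices above the root, and exchanges permute the
  labels; hence the spliced branches are full, as required above a labeled successor.\<close>

lemma piece_Con_swap:
  assumes "lwt R" "S \<subseteq> unlabeled_vertices R"
  shows "(\<forall>t\<in>set (piece (Con (swap_branches R S))). full t) \<and>
    mset (concat (map labs (piece (Con (swap_branches R S))))) = mset (labs R)"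
  using assms
proof (induction arbitrary: S rule: lwt_induct)
  case (labeled i ts)
  then have f: "full (Node (Some i) ts)" by simp
  then have "S = {}" using full_iff[of "Node (Some i) ts"] labeled.prems by simp
  then have "piece (Con (swap_branches (Node (Some i) ts) S)) = [Node (Some i) ts]"
    unfolding \<open>S = {}\<close> swap_empty Con_full[OF f] by (simp add: piece_def)
  then show ?case using f by (simp only:) simp
next
  case (cherry L R)
  have "S \<in> Pow (unlabeled_vertices (cherry L R))" using cherry.prems by simp
  then obtain x where x: "x \<in> UNIV \<times> Pow (unlabeled_vertices L) \<times> Pow (unlabeled_vertices R)"
    "S = (\<lambda>(b, S1, S2). (if b then {[]} else {}) \<union> (#) 0 ` S1 \<union> (#) 1 ` S2) x"
    using bij_betw_imp_surj_on[OF Pow_unlabeled_cherry[of L R]] by (metis (no_types, lifting) imageE)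
  obtain b S1 S2 where "x = (b, S1, S2)" by (rule prod_cases3)
  with x have S: "S = (if b then {[]} else {}) \<union> (#) 0 ` S1 \<union> (#) 1 ` S2"
    "S1 \<subseteq> unlabeled_vertices L" "S2 \<subseteq> unlabeled_vertices R"
    by (simp_all only: prod.case mem_Times_iff fst_conv snd_conv Pow_iff)
  show ?case unfolding S(1) piece_Con_swap_cherry
    using cherry.IH(1)[OF S(2)] cherry.IH(2)[OF S(3)] by (auto simp: add.commute)
qed

text \<open>The ideal and the algebra maps are controlled on \<open>Ops LW\<close> only, so
  composites must be seen to lie there. The two cases differ in the shape argument and share the
  count of labels.\<close>

theorem lw_tree_comp_closed:
  assumes T: "T \<in> LW_trees m" and R: "R \<in> LW_trees n" and i: "i \<in> {1..m}"
  shows "Poly_Mapping.keys (lw_tree_comp n i T R :: _ \<Rightarrow>\<^sub>0 'k::field) \<subseteq> LW_trees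
      (m + n - 1)"
proof -
  let ?f = "\<lambda>k. if k > i then k + n - 1 else k"
  define T' where "T' = map_ptree ?f T"
  define c where "c = i - 1"
  have n: "n \<ge> 1" using R by (rule LW_trees_pos)
  have lT: "lwt T" "distinct (labs T)" "set (labs T) = {1..m}" using T by (auto simp: LW_trees_def)
  have lR: "lwt R" "distinct (labs R)" "set (labs R) = {1..n}" using R by (auto simp: LW_trees_def)
  have inj: "inj_on ?f X" for X using n by (auto simp: inj_on_def)
  then have lT': "lwt T'" "distinct (labs T')"
    using lT by (auto simp: T'_def labs_map_ptree distinct_map)
  obtain p where p: "p \<in> vertices T" "label_at T p = Some i" using label_exists[of i T] lT i by auto
  have vl: "vertex_labeled T i = p" by (rule vertex_labeled_eq[OF lT(2) p])
  have p': "p \<in> vertices T'" "label_at T' p = Some i"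
    using p by (simp_all add: T'_def label_at_map_ptree)
  define ts where "ts = branches (subtree_at T' p)"
  define \<Phi> where "\<Phi> = {..<length ts} \<rightarrow>\<^sub>E {1..n}"
  define h where "h = (\<lambda>\<phi> R ts. graft (\<lambda>w. map ((!) ts) (filter (\<lambda>j. \<phi> j
      + c = w) [0..<length ts])) (map_ptree (\<lambda>k. k + c) R))"
  have along: "tree_comp_along \<phi> n i T R = replace_vertex i (h \<phi> R) T'" for \<phi> R
    unfolding tree_comp_along_def h_def T'_def c_def ..
  have maps: "grafting_maps n i T = \<Phi>"
    using p by (simp add: grafting_maps_def vl \<Phi>_def ts_def T'_def subtree_at_map_ptree in_degree_def
        ptree.map_sel)
  have gfull: "\<forall>t\<in>set (map ((!) us) (filter (\<lambda>j. \<phi> j + c =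
      w) [0..<length us])). full t"
    if "\<forall>t\<in>set us. full t" for \<phi> us w using that by auto
  have mset_h: "mset (labs (h \<phi> Q ts)) =
      mset (map (\<lambda>k. k + c) (labs Q)) + mset (concat (map labs ts))"
    if "\<phi> \<in> \<Phi>" "mset (labs Q) = mset (labs R)" for \<phi> Q
  proof -
    have Q: "distinct (labs Q)" "set (labs Q) = {1..n}"
      using that(2) lR by (metis mset_eq_imp_distinct_iff, metis mset_eq_setD)
    show ?thesis unfolding h_def labs_map_ptree[symmetric]
    proof (rule mset_labs_graft_words)
      show "distinct (labs (map_ptree (\<lambda>k. k +
          c) Q))" using Q by (simp add: labs_map_ptree distinct_map)
      show "\<phi> j + c \<in> set (labs (map_ptree (\<lambda>k. k + c) Q))" if "j < length ts" for j
        using PiE_mem[of \<phi> "{..<length ts}" "\<lambda>_. {1..n}" j] \<open>\<phi> \<in> \<Phi>\<close>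
            that Q by (simp add: labs_map_ptree \<Phi>_def)
    qed
  qed
  \<comment> \<open>The count for both cases: renumbering \<open>T\<close> leaves the gap from
    \<open>i\<close> to \<open>i + n - 1\<close>, occupied by \<open>i\<close> alone; once
    \<open>i\<close> is removed, the shifted labels of \<open>R\<close> fill it.\<close>
  have final: "mset (labs Z) = mset_set {1..m + n - 1}"
    if Z: "mset (labs Z) + mset (i # concat (map labs ts)) =
        mset (labs T') + (mset (map (\<lambda>k. k + c) (labs R)) + mset (concat (map labs ts)))" for Z
  proof -
    have R': "mset (map (\<lambda>k. k + c) (labs R)) = mset_set {i..i + n - 1}"
    proof -
      have "mset (labs R) = mset_set {1..n}" using R by (simp add: LW_trees_mset)
      then have "mset (map (\<lambda>k. k + c) (labs R)) = mset_set ((\<lambda>k. k + c) ` {1..n})"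
        by (simp add: image_mset_mset_set)
      moreover have "(\<lambda>k. k + c) ` {1..n} = {1 + c..n + c}" by (rule image_add_atLeastAtMost')
      moreover have "1 + c = i" "n + c = i + n - 1" using i by (auto simp: c_def)
      ultimately show ?thesis by simp
    qed
    have "mset (labs T) = mset_set {1..m}" using T by (simp add: LW_trees_mset)
    then have "mset (labs T') = mset_set (?f ` {1..m})"
      by (simp add: T'_def labs_map_ptree image_mset_mset_set[OF inj])
    also have "?f ` {1..m} = {1..<i} \<union> insert i {i + n..m + n - 1}"
    proof
      show "{1..<i} \<union> insert i {i + n..m + n - 1} \<subseteq> ?f ` {1..m}"
      proof
        fix x assume "x \<in> {1..<i} \<union> insert i {i + n..m + n - 1}"
        then have "x \<in> {1..i} \<or> x \<in> {i + n..m + n - 1}" using i by auto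
        then consider "x \<in> {1..i}" | "x \<in> {i + n..m + n - 1}" by blast
        then show "x \<in> ?f ` {1..m}"
        proof cases
          case 1
          then show ?thesis using i by (intro image_eqI[of _ _ x]) auto
        next
          case 2
          then show ?thesis using n by (intro image_eqI[of _ _ "x + 1 - n"]) auto
        qed
      qed
    qed (use i n in auto)
    finally have "mset (labs Z) + mset_set {i} =
        mset_set ({1..<i} \<union> insert i {i + n..m + n - 1}) + mset_set {i..i + n - 1}"
      using Z R' by simp
    also have "mset_set ({1..<i} \<union> insert i {i + n..m + n - 1}) =
        mset_set ({1..<i} \<union> {i + n..m + n - 1}) + mset_set {i}"
      using n by (subst mset_set_Union[symmetric]) (auto intro: arg_cong[of _ _ mset_set])
    finally have "mset (labs Z) = mset_set ({1..<i} \<union> {i + n..m + n - 1}) + mset_set {i..i + n - 1}"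
      by simp
    also have "\<dots> = mset_set (({1..<i} \<union> {i + n..m + n - 1}) \<union> {i..i + n - 1})"
      by (rule mset_set_Union[symmetric]) (use n in auto)
    also have "({1..<i} \<union> {i + n..m + n - 1}) \<union> {i..i + n - 1} = {1..m + n - 1}"
      using i n by auto
    finally show ?thesis .
  qed
  let ?con = "R \<in> W_trees n \<and> p \<noteq> [] \<and> label_at T (butlast p) \<noteq> None"
  show ?thesis
  proof (cases ?con)
    case False
    have key: "replace_vertex i (h \<phi> R) T' \<in> LW_trees (m +
        n - 1)" if \<phi>: "\<phi> \<in> \<Phi>" for \<phi>
      unfolding LW_trees_mset
    proof
      show "mset (labs (replace_vertex i (h \<phi> R) T')) = mset_set {1..m + n - 1}"
        by (rule final) (use mset_labs_replace_vertex[OF lT'(2) p', of "h \<phi> R"] mset_h[OF \<phi> refl]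
            in \<open>simp only: ts_def\<close>)
      show "lwt (replace_vertex i (h \<phi> R) T')"
      proof (cases "root_label R = None")
        case True
        then have "R \<in> W_trees n" using R by (simp add: W_trees_iff)
        then have "p = [] \<or> label_at T' (butlast p) = None"
          using False p by (auto simp: T'_def label_at_map_ptree butlast_vertices)
        then show ?thesis
          by (intro lwt_replace_vertex_unlabeled[OF _ lT' p'])
            (auto simp: h_def lR intro!: lwt_graft gfull)
      next
        case False
        then have "full R" using lR(1) by (cases R) auto
        then show ?thesis
          by (intro lwt_replace_vertex[OF _ lT'(1)]) (auto simp: h_def intro!: full_graft gfull)
      qed
    qed
    have eq: "(lw_tree_comp n i T R :: _ \<Rightarrow>\<^sub>0 'k) =
        (\<Sum>\<phi>\<in>\<Phi>. basis (replace_vertex i (h \<phi> R) T'))"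
      using False unfolding lw_tree_comp_def vl Let_def pt_comp_def maps along by (simp only: if_False)
    show ?thesis unfolding eq by (rule order_trans[OF keys_sum]) (use key in auto)
  next
    case True
    let ?c = "\<lambda>S. Con (swap_branches R S)"
    have comp: "(lw_tree_comp n i T R :: _ \<Rightarrow>\<^sub>0 'k) =
        (\<Sum>S\<in>Pow (unlabeled_vertices R). fscale ((-1) ^ card S)
            (\<Sum>\<phi>\<in>\<Phi>. basis (Con_at p (replace_vertex i (h \<phi> (?c S)) T'))))"
      using True unfolding lw_tree_comp_def vl Let_def pt_comp_def maps along
      by (simp only: if_True simp_thms lin_ext_simps)
    have key: "Con_at p (replace_vertex i (h \<phi> (?c S)) T') \<in> LW_trees (m + n - 1)"
      if \<phi>: "\<phi> \<in> \<Phi>" and S: "S \<in> Pow (unlabeled_vertices R)" for \<phi> S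
    proof -
      obtain us where us: "?c S = Node None us"
        using True by (metis W_trees_iff ptree.collapse root_label_Con root_label_swap)
      have us2: "\<forall>t\<in>set us. full t" "mset (concat (map labs us)) = mset (labs R)"
        using piece_Con_swap[OF lR(1), of S] S us by (auto simp: piece_def)
      have "mset (labs (?c S)) = mset (labs R)" using us2 us by simp
      from mset_h[OF \<phi> this] have "mset (labs (h \<phi> (?c S) ts)) =
          mset (map (\<lambda>k. k + c) (labs R)) + mset (concat (map labs ts))"
        using \<open>mset (labs (?c S)) = mset (labs R)\<close> by (simp only: mset_map)
      moreover have "labs (h \<phi> (?c S) ts) = concat (map labs (branches (h \<phi> (?c S) ts)))"
        by (simp add: h_def us)
      ultimately have h: "mset (concat (map labs (branches (h \<phi> (?c S) ts)))) =
          mset (map (\<lambda>k. k + c) (labs R)) + mset (concat (map labs ts))" by (simp only:)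
      obtain q j where q: "p = q @ [j]" using True by (metis append_butlast_last_id)
      then obtain a where a: "label_at T' q = Some a"
        using True butlast_vertices[OF p(1)] by (auto simp: T'_def label_at_map_ptree)
      note child = lT'(2) p'[unfolded q] a
      have "lwt (Con_at p (replace_vertex i (h \<phi> (?c S)) T'))"
        unfolding q Con_at_replace_vertex[OF child]
      proof (rule lwt_replace_vertex[OF _ lT'(1)])
        fix ws :: "nat ptree list" assume ws: "\<forall>t\<in>set ws. full t"
        have "\<forall>t\<in>set (branches (h \<phi> (?c S) (branches (ws ! j)))). full t" if "j < length ws"
        proof -
          have "full (ws ! j)" using ws that by simp
          then have "\<forall>t\<in>set (branches (ws ! j)). full t" by (cases "ws ! j") simp
          then show ?thesis using us2 gfull by (auto simp: h_def us intro!: full_graft)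
        qed
        then show "full (Node (Some a) (splice_at j (\<lambda>t. branches (h \<phi> (?c S) (branches t))) ws))"
          using ws by (auto simp: splice_at_def dest: in_set_takeD in_set_dropD)
      qed
      moreover have "mset (labs (Con_at p (replace_vertex i (h \<phi> (?c S)) T'))) = mset_set {1..m + n - 1}"
        by (rule final) (use mset_labs_Con_at_replace_vertex[OF child, of "h \<phi> (?c S)"] h in
            \<open>simp only: ts_def q\<close>)
      ultimately show ?thesis by (simp add: LW_trees_mset)
    qed
    show ?thesis unfolding comp
    proof (rule order_trans[OF keys_sum], rule UN_least)
      fix S assume S: "S \<in> Pow (unlabeled_vertices R)"
      show "Poly_Mapping.keys (fscale ((-1) ^ card S)
            (\<Sum>\<phi>\<in>\<Phi>. basis (Con_at p (replace_vertex i (h \<phi> (?c S)) T'))) :: _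
                \<Rightarrow>\<^sub>0 'k) \<subseteq> LW_trees (m + n - 1)"
        by (rule order_trans[OF keys_fscale], rule order_trans[OF keys_sum]) (use key[OF _ S] in auto)
    qed
  qed
qed

section \<open>Algebras over the quotient\<close>

lemma LW_simps [simp]:
  "Ops (LW :: ('k::field, _) operad) = (\<lambda>n. {x. Poly_Mapping.keys x \<subseteq> LW_trees n})"
  "oadd (LW :: ('k::field, _) operad) n = (+)"
  "oscale (LW :: ('k::field, _) operad) n = fscale"
  "ounit (LW :: ('k::field, _) operad) = basis (leaf 1)"
  "oact (LW :: ('k::field, _) operad) n \<sigma> = lin_ext (\<lambda>t. basis (map_ptree \<sigma> t))"
  by (simp_all add: LW_def L_W_trees)

lemma LW_comp: "ocomp LW m n i x y = lin_ext (\<lambda>T. lin_ext (\<lambda>R. lw_tree_comp n i T R) y) x"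
  by (simp add: LW_def)

lemma LW_comp_add_left: "ocomp LW m n i (x + x') y = ocomp LW m n i x y + ocomp LW m n i x' y"
  by (simp add: LW_comp lin_ext_simps)

lemma LW_comp_add_right: "ocomp LW m n i x (y + y') = ocomp LW m n i x y + ocomp LW m n i x y'"
  by (simp add: LW_comp lin_ext_lcomb F.lcomb_add F.lcomb_add_fun)

lemma LW_comp_basis: "ocomp LW m n i (basis T) (basis R) = lw_tree_comp n i T R"
  by (simp add: LW_comp lin_ext_simps)

lemma LW_add_closed: "x \<in> Ops LW n \<Longrightarrow> y \<in> Ops LW n \<Longrightarrow>
    x + y \<in> Ops LW n"
  using Poly_Mapping.keys_add[of x y] by auto

lemma LW_scale_closed: "x \<in> Ops LW n \<Longrightarrow> fscale c x \<in> Ops LW n"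
  using keys_fscale[of c x] by auto

lemma LW_comp_closed:
  fixes x y :: "nat ptree \<Rightarrow>\<^sub>0 'k::field"
  assumes "x \<in> Ops LW m" "y \<in> Ops LW n" "i \<in> {1..m}"
  shows "ocomp LW m n i x y \<in> Ops LW (m + n - 1)"
proof -
  have "Poly_Mapping.keys (lin_ext (\<lambda>R. lw_tree_comp n i T R) y) \<subseteq> LW_trees (m + n - 1)"
    if "T \<in> Poly_Mapping.keys x" for T
  proof (rule order_trans[OF keys_lin_ext], rule UN_least)
    fix R assume "R \<in> Poly_Mapping.keys y"
    then show "Poly_Mapping.keys (lw_tree_comp n i T R :: _ \<Rightarrow>\<^sub>0 'k) \<subseteq> LW_trees
        (m + n - 1)"
      using assms that by (intro lw_tree_comp_closed) auto
  qed
  then have "Poly_Mapping.keys (ocomp LW m n i x y) \<subseteq> LW_trees (m + n - 1)"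
    unfolding LW_comp by - (rule order_trans[OF keys_lin_ext], rule UN_least)
  then show ?thesis by simp
qed

lemma map_ptree_permutes: "t \<in> LW_trees n \<Longrightarrow> \<sigma> permutes {1..n} \<Longrightarrow>
    map_ptree \<sigma> t \<in> LW_trees n"
  by (auto simp: LW_trees_def labs_map_ptree distinct_map permutes_image permutes_inj_on)

lemma LW_act_closed:
  fixes x :: "nat ptree \<Rightarrow>\<^sub>0 'k::field"
  assumes "x \<in> Ops LW n" "\<sigma> permutes {1..n}"
  shows "oact LW n \<sigma> x \<in> Ops LW n"
proof -
  have "Poly_Mapping.keys (lin_ext (\<lambda>t. basis (map_ptree \<sigma> t)) x) \<subseteq>
      (\<Union>t\<in>Poly_Mapping.keys x. Poly_Mapping.keys (basis (map_ptree \<sigma> t) :: _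
          \<Rightarrow>\<^sub>0 'k))"
    by (rule keys_lin_ext)
  also have "\<dots> \<subseteq> LW_trees n" using assms map_ptree_permutes by auto
  finally show ?thesis by simp
qed

lemma cherry_in_LW_trees: "cherry (leaf 1) (leaf 2) \<in> LW_trees 2" "cherry (leaf 2) (leaf 1) \<in>
    LW_trees 2"
  by (auto simp: LW_trees_def)

lemma jacobi_in_LW_trees:
  "cherry (leaf 1) (cherry (leaf 2) (leaf 3)) \<in> LW_trees 3"
  "cherry (cherry (leaf 1) (leaf 2)) (leaf 3) \<in> LW_trees 3"
  "cherry (leaf 2) (cherry (leaf 1) (leaf 3)) \<in> LW_trees 3"
  by (auto simp: LW_trees_def)

lemma basis_in_LW [simp]: "t \<in> LW_trees n \<Longrightarrow>
    (basis t :: _ \<Rightarrow>\<^sub>0 'k::field) \<in> Ops LW n"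
  by simp

lemma LW_diff_closed:
  assumes "x \<in> Ops LW n" "y \<in> Ops LW n" shows "x - y \<in> Ops LW n"
proof -
  have "x - y = x + fscale (-1) y" by (intro poly_mapping_eqI) (simp add: lookup_add lookup_minus)
  then show ?thesis using LW_add_closed[OF assms(1) LW_scale_closed[OF assms(2)]] by metis
qed

lemma psb_relations_subset: "psb_relations n \<subseteq> Ops LW n"
proof -
  have "basis (cherry (leaf 1) (leaf 2)) + basis (cherry (leaf 2) (leaf 1)) \<in> Ops (LW :: ('a, _) operad) 2"
    by (intro LW_add_closed basis_in_LW cherry_in_LW_trees)
  moreover have "basis (cherry (leaf 1) (cherry (leaf 2) (leaf 3)))
        - basis (cherry (cherry (leaf 1) (leaf 2)) (leaf 3))
        - basis (cherry (leaf 2) (cherry (leaf 1) (leaf 3))) \<in> Ops (LW :: ('a, _) operad) 3"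
    by (intro LW_diff_closed basis_in_LW jacobi_in_LW_trees)
  ultimately show ?thesis unfolding psb_relations_def by (simp del: LW_simps)
qed

section \<open>The ideal of relations and its cosets\<close>

lemma zero_in_operad_ideal:
  assumes "operad_ideal (LW :: ('k::field, _) operad) I"
  shows "0 \<in> I n"
proof -
  have "I n \<noteq> {}" and sc: "x \<in> I n \<Longrightarrow> fscale c x \<in> I n" for x c
    using assms unfolding operad_ideal_def LW_simps(3) by blast+
  then obtain x where "x \<in> I n" by blast
  then have "fscale 0 x \<in> I n" by (rule sc)
  then show ?thesis by simp
qed

lemma psb_ideal_iff:
  "x \<in> psb_ideal n \<longleftrightarrow> x \<in> Ops LW n \<and> (\<forall>I. operad_ideal LW I \<and>
      (\<forall>k. psb_relations k \<subseteq> I k) \<longrightarrow> x \<in> I n)"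
  unfolding psb_ideal_def generated_operad_ideal_def by blast

text \<open>An intersection of ideals. As the generated ideal is cut out inside
  \<open>Ops LW\<close>, each clause also uses that \<open>LW\<close> is closed under the operation
  in question.\<close>

lemma operad_ideal_psb_ideal: "operad_ideal LW (psb_ideal :: nat \<Rightarrow> (nat ptree
    \<Rightarrow>\<^sub>0 'k::field) set)"
  unfolding operad_ideal_def
proof (intro conjI allI ballI impI)
  fix n
  show "(psb_ideal n :: (_ \<Rightarrow>\<^sub>0 'k) set) \<subseteq> Ops LW n" by (auto simp: psb_ideal_iff)
  have "(0 :: _ \<Rightarrow>\<^sub>0 'k) \<in> psb_ideal n" using zero_in_operad_ideal
      by (auto simp: psb_ideal_iff)
  then show "(psb_ideal n :: (_ \<Rightarrow>\<^sub>0 'k) set) \<noteq> {}" by blast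
next
  fix n and x y :: "nat ptree \<Rightarrow>\<^sub>0 'k" assume "x \<in> psb_ideal n" "y \<in> psb_ideal n"
  then show "oadd LW n x y \<in> psb_ideal n"
    unfolding psb_ideal_iff using LW_add_closed[of x n y] by (simp add: operad_ideal_def del: LW_simps(1))
next
  fix n c and x :: "nat ptree \<Rightarrow>\<^sub>0 'k" assume "x \<in> psb_ideal n"
  then show "oscale LW n c x \<in> psb_ideal n"
    unfolding psb_ideal_iff using LW_scale_closed[of x n] by (simp add: operad_ideal_def del: LW_simps(1))
next
  fix n \<sigma> and x :: "nat ptree \<Rightarrow>\<^sub>0 'k" assume "x \<in> psb_ideal n" "\<sigma>
      permutes {1..n}"
  then show "oact LW n \<sigma> x \<in> psb_ideal n"
    unfolding psb_ideal_iff using LW_act_closed[of x n] by (simp add: operad_ideal_def del: LW_simps)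
next
  fix m n i and x y :: "nat ptree \<Rightarrow>\<^sub>0 'k" assume "i \<in> {1..m}" "x \<in> psb_ideal m"
      "y \<in> Ops LW n"
  then show "ocomp LW m n i x y \<in> psb_ideal (m + n - 1)"
    unfolding psb_ideal_iff using LW_comp_closed[of x m y n i] by (simp add: operad_ideal_def del: LW_simps)
next
  fix m n i and x y :: "nat ptree \<Rightarrow>\<^sub>0 'k" assume "i \<in> {1..m}" "x \<in> Ops LW m" "y
      \<in> psb_ideal n"
  then show "ocomp LW m n i x y \<in> psb_ideal (m + n - 1)"
    unfolding psb_ideal_iff using LW_comp_closed[of x m y n i] by (simp add: operad_ideal_def del: LW_simps)
qed

lemma psb_relations_ideal: "psb_relations n \<subseteq> psb_ideal n"
  using psb_relations_subset unfolding psb_ideal_iff subset_iff by blast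

lemma
  fixes x y :: "nat ptree \<Rightarrow>\<^sub>0 'k::field"
  shows psb_ideal_zero: "(0 :: nat ptree \<Rightarrow>\<^sub>0 'k) \<in> psb_ideal n"
    and psb_ideal_subset: "x \<in> psb_ideal n \<Longrightarrow> x \<in> Ops LW n"
    and psb_ideal_add: "x \<in> psb_ideal n \<Longrightarrow> y \<in> psb_ideal n \<Longrightarrow>
        x + y \<in> psb_ideal n"
    and psb_ideal_scale: "x \<in> psb_ideal n \<Longrightarrow> fscale c x \<in> psb_ideal n"
    and psb_ideal_act: "x \<in> psb_ideal n \<Longrightarrow> \<sigma> permutes {1..n} \<Longrightarrow>
        oact LW n \<sigma> x \<in> psb_ideal n"
    and psb_ideal_comp_left: "x \<in> psb_ideal m \<Longrightarrow> y \<in> Ops LW n \<Longrightarrow>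
        i \<in> {1..m} \<Longrightarrow> ocomp LW m n i x y \<in> psb_ideal (m + n - 1)"
    and psb_ideal_comp_right: "x \<in> Ops LW m \<Longrightarrow> y \<in> psb_ideal n \<Longrightarrow>
        i \<in> {1..m} \<Longrightarrow> ocomp LW m n i x y \<in> psb_ideal (m + n - 1)"
proof -
  note I = operad_ideal_psb_ideal[where 'k='k]
  show "(0 :: nat ptree \<Rightarrow>\<^sub>0 'k) \<in> psb_ideal n" by (rule zero_in_operad_ideal[OF I])
  show "x \<in> psb_ideal n \<Longrightarrow> x \<in> Ops LW n" by (simp only: psb_ideal_iff)
  note I = I[unfolded operad_ideal_def LW_simps(2,3)]
  show "x \<in> psb_ideal n \<Longrightarrow> y \<in> psb_ideal n \<Longrightarrow> x + y \<in> psb_ideal n"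
    "x \<in> psb_ideal n \<Longrightarrow> fscale c x \<in> psb_ideal n"
    "x \<in> psb_ideal n \<Longrightarrow> \<sigma> permutes {1..n} \<Longrightarrow>
        oact LW n \<sigma> x \<in> psb_ideal n"
    "x \<in> psb_ideal m \<Longrightarrow> y \<in> Ops LW n \<Longrightarrow>
        i \<in> {1..m} \<Longrightarrow> ocomp LW m n i x y \<in> psb_ideal (m + n - 1)"
    "x \<in> Ops LW m \<Longrightarrow> y \<in> psb_ideal n \<Longrightarrow>
        i \<in> {1..m} \<Longrightarrow> ocomp LW m n i x y \<in> psb_ideal (m + n - 1)"
    using I by meson+
qed

lemma psb_ideal_minus: "x \<in> psb_ideal n \<Longrightarrow> - x \<in> psb_ideal n"
  using psb_ideal_scale[of x n "-1"] by simp

abbreviation psb_coset :: "nat \<Rightarrow> (nat ptree \<Rightarrow>\<^sub>0 'k::field) \<Rightarrow> (nat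
    ptree \<Rightarrow>\<^sub>0 'k) set" where
  "psb_coset \<equiv> ocoset LW psb_ideal"

lemma psb_coset_mem: "y \<in> psb_coset n x \<longleftrightarrow> y - x \<in> psb_ideal n"
  unfolding ocoset_def LW_simps(2) by (auto simp: image_iff) (metis add_diff_cancel_left' diff_add_cancel
      add.commute)

lemma psb_coset_eq: "psb_coset n x = psb_coset n y \<longleftrightarrow> x - y \<in> psb_ideal n"
proof
  show "x - y \<in> psb_ideal n" if "psb_coset n x = psb_coset n y"
    using that psb_coset_mem[of x n x] psb_coset_mem[of x n y] psb_ideal_zero by auto
  assume *: "x - y \<in> psb_ideal n"
  have "z - x \<in> psb_ideal n \<longleftrightarrow> z - y \<in> psb_ideal n" for z
    using psb_ideal_add[OF _ *, of "z - x"] psb_ideal_add[OF _ psb_ideal_minus[OF *], of "z - y"] by auto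
  then show "psb_coset n x = psb_coset n y" by (auto simp: psb_coset_mem)
qed

lemma psb_coset_self: "x \<in> psb_coset n x"
  by (simp add: psb_coset_mem psb_ideal_zero)

text \<open>Quotient operations are unions over representatives; when all representatives yield the
  same coset, and there is one, the union is that coset.\<close>

lemma UN_eq_const: "A \<noteq> {} \<Longrightarrow> (\<And>a. a \<in> A \<Longrightarrow>
    f a = c) \<Longrightarrow> (\<Union>a\<in>A. f a) = c"
  by auto

lemma Ops_PSB: "Ops PSB n = psb_coset n ` Ops LW n"
  by (simp add: PSB_def quotient_operad_def)

lemma
  fixes x y :: "nat ptree \<Rightarrow>\<^sub>0 'k::field"
  assumes x: "x \<in> Ops LW n"
  shows PSB_add: "y \<in> Ops LW n \<Longrightarrow> oadd PSB n (psb_coset n x) (psb_coset n y) =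
      psb_coset n (x + y)"
    and PSB_scale: "oscale PSB n c (psb_coset n x) = psb_coset n (fscale c x)"
    and PSB_act: "\<sigma> permutes {1..n} \<Longrightarrow> oact PSB n \<sigma> (psb_coset n x) =
        psb_coset n (oact LW n \<sigma> x)"
    and PSB_comp: "y \<in> Ops LW m \<Longrightarrow> i \<in> {1..n} \<Longrightarrow>
      ocomp PSB n m i (psb_coset n x) (psb_coset m y) = psb_coset (n + m - 1) (ocomp LW n m i x y)"
proof -
  have ne: "psb_coset n z \<noteq> {}" for n
      and z :: "nat ptree \<Rightarrow>\<^sub>0 'k" using psb_coset_self by auto
  show "oadd PSB n (psb_coset n x) (psb_coset n y) = psb_coset n (x + y)"
    unfolding PSB_def quotient_operad_def operad.simps
  proof (intro UN_eq_const ne)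
    fix a b assume "a \<in> psb_coset n x" "b \<in> psb_coset n y"
    then have "(a - x) + (b - y) \<in> psb_ideal n" unfolding psb_coset_mem by (rule psb_ideal_add)
    then show "psb_coset n (oadd LW n a b) = psb_coset n (x + y)"
      unfolding psb_coset_eq by (simp add: algebra_simps)
  qed
  show "oscale PSB n c (psb_coset n x) = psb_coset n (fscale c x)"
    unfolding PSB_def quotient_operad_def operad.simps
  proof (intro UN_eq_const ne)
    fix a assume "a \<in> psb_coset n x"
    then have "fscale c (a - x) \<in> psb_ideal n" unfolding psb_coset_mem by (rule psb_ideal_scale)
    then show "psb_coset n (oscale LW n c a) = psb_coset n (fscale c x)"
      unfolding psb_coset_eq by (simp add: F.scale_right_diff_distrib)
  qed
  show "oact PSB n \<sigma> (psb_coset n x) = psb_coset n (oact LW n \<sigma> x)" if "\<sigma> permutes {1..n}"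
    unfolding PSB_def quotient_operad_def operad.simps
  proof (intro UN_eq_const ne)
    fix a assume "a \<in> psb_coset n x"
    then have "oact LW n \<sigma> (a - x) \<in> psb_ideal n" unfolding psb_coset_mem using that
        by (rule psb_ideal_act)
    then show "psb_coset n (oact LW n \<sigma> a) = psb_coset n (oact LW n \<sigma> x)"
      unfolding psb_coset_eq by (simp add: lin_ext_simps)
  qed
  show "ocomp PSB n m i (psb_coset n x) (psb_coset m y) = psb_coset (n + m - 1) (ocomp LW n m i x y)"
    if y: "y \<in> Ops LW m" and i: "i \<in> {1..n}"
    unfolding PSB_def quotient_operad_def operad.simps
  proof (intro UN_eq_const ne)
    fix a b assume "a \<in> psb_coset n x" "b \<in> psb_coset m y"
    then have u: "a - x \<in> psb_ideal n" and v: "b - y \<in> psb_ideal m" unfolding psb_coset_mem by auto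
    \<comment> \<open>The arguments are changed one at a time, \<open>x\<close> to \<open>a\<close>
      with the second argument already \<open>b\<close>; hence \<open>b\<close> has to lie in
      \<open>Ops LW m\<close>.\<close>
    have b: "b \<in> Ops LW m" using LW_add_closed[OF y psb_ideal_subset[OF v]] by simp
    have 1: "ocomp LW n m i a b = ocomp LW n m i x b + ocomp LW n m i (a - x) b"
      by (simp add: LW_comp_add_left[symmetric])
    have 2: "ocomp LW n m i x b = ocomp LW n m i x y + ocomp LW n m i x (b - y)"
      by (simp add: LW_comp_add_right[symmetric])
    have "ocomp LW n m i a b - ocomp LW n m i x y = ocomp LW n m i x (b - y) + ocomp LW n m i (a - x) b"
      unfolding 1 2 by (simp add: algebra_simps)
    moreover have "\<dots> \<in> psb_ideal (n + m - 1)"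
      using psb_ideal_comp_left[OF u b i] psb_ideal_comp_right[OF x v i] by (intro psb_ideal_add)
    ultimately show "psb_coset (n + m - 1) (ocomp LW n m i a b) = psb_coset (n + m - 1) (ocomp LW n m i x y)"
      unfolding psb_coset_eq by simp
  qed
qed

lemma PSB_unit: "ounit PSB = psb_coset 1 (basis (leaf 1))"
  by (simp add: PSB_def quotient_operad_def)

text \<open>An algebra over the quotient operad, as a family of maps on \<open>\<L>\<W>\<close>.\<close>

locale lw_algebra = vector_space scale
  for scale :: "'k::field \<Rightarrow> 'v::ab_group_add \<Rightarrow> 'v" +
  fixes r :: "nat \<Rightarrow> (nat ptree \<Rightarrow>\<^sub>0 'k) \<Rightarrow> 'v list \<Rightarrow> 'v"
  assumes r_Ops: "x \<in> Ops LW n \<Longrightarrow> r n x \<in> Ops (End_operad scale) n"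
    and r_add: "x \<in> Ops LW n \<Longrightarrow> y \<in> Ops LW n \<Longrightarrow>
        r n (x + y) = (\<lambda>xs. r n x xs + r n y xs)"
    and r_scale: "x \<in> Ops LW n \<Longrightarrow> r n (fscale c x) = (\<lambda>xs. scale c (r n x xs))"
    and r_unit: "r 1 (basis (leaf 1)) = ounit (End_operad scale)"
    and r_comp: "i \<in> {1..m} \<Longrightarrow> x \<in> Ops LW m \<Longrightarrow>
        y \<in> Ops LW n \<Longrightarrow>
      r (m + n - 1) (ocomp LW m n i x y) = ocomp (End_operad scale) m n i (r m x) (r n y)"
    and r_act: "\<sigma> permutes {1..n} \<Longrightarrow> x \<in> Ops LW n \<Longrightarrow>
      r n (oact LW n \<sigma> x) = oact (End_operad scale) n \<sigma> (r n x)"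
    and r_relations: "x \<in> psb_relations n \<Longrightarrow> r n x = (\<lambda>_. 0)"

section \<open>The endomorphism operad, and algebras pulled back to LW\<close>

lemma End_add: "oadd (End_operad scale) n f g = (\<lambda>xs. f xs + g xs)"
  and End_scale: "oscale (End_operad scale) n c f = (\<lambda>xs. scale c (f xs))"
  by (simp_all add: End_operad_def)

text \<open>An element of the endomorphism operad is linear in its \<open>i\<close>-th entry and so
  vanishes when this entry is 0.\<close>

lemma End_comp_zero:
  assumes "vector_space scale" "f \<in> Ops (End_operad scale) m" "i \<in> {1..m}"
  shows "ocomp (End_operad scale) m n i f (\<lambda>_. 0) = (\<lambda>_. 0)"
proof
  interpret vector_space scale by fact
  fix xs
  show "ocomp (End_operad scale) m n i f (\<lambda>_. 0) xs = 0"
  proof (cases "length xs = m + n - 1")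
    case True
    let ?ys = "take (i - 1) xs @ [0] @ drop (i - 1 + n) xs"
    have "length (take (i - 1) xs) = i - 1" "length ?ys = m" using assms(3) True by auto
    moreover from this have "?ys[i - 1 := 0] = ?ys" by (metis append_Cons append_Nil list_update_length)
    moreover have "lin (\<lambda>v. f (?ys[i - 1 := v]))"
      using assms(2,3) \<open>length ?ys = m\<close> by (auto simp: End_operad_def)
    ultimately have "f ?ys = 0" using lin_zero by metis
    then show ?thesis using True by (simp add: End_operad_def)
  qed (simp add: End_operad_def)
qed

text \<open>
  With inputs numbered from \<open>1\<close>, the arguments passed to the two operations of a partial
  composition in the endomorphism operad.
\<close>

lemma End_comp_args:
  assumes "i \<in> {1..m}" "n \<ge> 1" "length xs = m + n - 1"
  shows "k \<in> {1..n} \<Longrightarrow> take n (drop (i - 1) xs) ! (k - 1) = xs ! (k + (i - 1) - 1)"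
    and "k \<in> {1..m} \<Longrightarrow> (take (i - 1) xs @ [v] @ drop (i - 1 + n) xs) ! (k - 1) =
      (if k < i then xs ! (k - 1) else if k = i then v else xs ! (k + n - 1 - 1))"
    and "length (take n (drop (i - 1) xs)) = n" "length (take (i - 1) xs @ [v] @ drop (i - 1 + n) xs) = m"
proof -
  have le: "i - 1 \<le> length xs" "i - 1 + n \<le> length xs" using assms by auto
  show "take n (drop (i - 1) xs) ! (k - 1) = xs ! (k + (i - 1) - 1)" if "k \<in> {1..n}"
  proof -
    have "(i - 1) + (k - 1) = k + (i - 1) - 1" "k - 1 < n" using that by auto
    then show ?thesis by (simp only: nth_take nth_drop[OF le(1)])
  qed
  show "length (take n (drop (i - 1) xs)) = n" "length (take (i - 1) xs @ [v] @ drop (i - 1 + n) xs) = m"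
    using assms by auto
  have l: "length (take (i - 1) xs) = i - 1" using le by simp
  consider "k < i" | "k = i" | "k > i" by linarith
  then show "(take (i - 1) xs @ [v] @ drop (i - 1 + n) xs) ! (k - 1) =
      (if k < i then xs ! (k - 1) else if k = i then v else xs ! (k + n - 1 - 1))" if "k \<in> {1..m}"
  proof cases
    case 1
    then have "k - 1 < i - 1" using that by auto
    then show ?thesis by (simp only: nth_append l 1 if_True nth_take)
  next
    case 2
    then show ?thesis using nth_append_length[of "take (i - 1) xs"]
        by (simp only: l append_Cons append_Nil) simp
  next
    case 3
    then have "\<not> k - 1 < i - 1" "k - 1 - (i - 1) = Suc (k - i - 1)" using assms by auto
    then have "(take (i - 1) xs @ [v] @ drop (i - 1 + n) xs) ! (k - 1) = drop (i - 1 + n) xs ! (k - i - 1)"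
      by (simp only: nth_append l if_False append_Cons append_Nil nth_Cons_Suc)
    also have "\<dots> = xs ! (i - 1 + n + (k - i - 1))" by (rule nth_drop[OF le(2)])
    also have "i - 1 + n + (k - i - 1) = k + n - 1 - 1" using 3 assms by auto
    finally show ?thesis using 3 by simp
  qed
qed

text \<open>Composition with the projection from LW to PSB; the relations go to the coset of
  zero.\<close>

lemma lw_algebra_of_operad_algebra:
  assumes "vector_space scale" "operad_algebra PSB scale \<rho>"
  shows "lw_algebra scale (\<lambda>n x. \<rho> n (psb_coset n x))"
proof -
  interpret vector_space scale by fact
  note \<rho> = assms(2)[unfolded operad_algebra_def operad_morphism_def]
  have PSB: "x \<in> Ops LW n \<Longrightarrow> psb_coset n x \<in> Ops PSB n" for n x unfolding Ops_PSB
      by (rule imageI)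
  have add: "\<rho> n (psb_coset n (x + y)) =
      (\<lambda>xs. \<rho> n (psb_coset n x) xs + \<rho> n (psb_coset n y) xs)"
    if "x \<in> Ops LW n" "y \<in> Ops LW n" for n x y
  proof -
    have "\<rho> n (oadd PSB n (psb_coset n x) (psb_coset n y)) =
        oadd (End_operad scale) n (\<rho> n (psb_coset n x)) (\<rho> n (psb_coset n y))"
      using \<rho> PSB that by meson
    then show ?thesis using that by (simp only: PSB_add End_add)
  qed
  have sc: "\<rho> n (psb_coset n (fscale c x)) =
      (\<lambda>xs. scale c (\<rho> n (psb_coset n x) xs))" if "x \<in> Ops LW n" for n x c
  proof -
    have "\<rho> n (oscale PSB n c (psb_coset n x)) = oscale (End_operad scale) n c (\<rho> n (psb_coset n x))"
      using \<rho> PSB that by meson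
    then show ?thesis using that by (simp only: PSB_scale End_scale)
  qed
  show ?thesis
  proof (rule lw_algebra.intro[OF assms(1)], unfold_locales)
    show "\<rho> n (psb_coset n x) \<in> Ops (End_operad scale) n" if "x \<in> Ops LW n" for x n
      using PiE_mem[OF spec[OF conjunct1[OF \<rho>]] PSB[OF that]] .
    show "\<rho> 1 (psb_coset 1 (basis (leaf 1))) = ounit (End_operad scale)"
      using \<rho> unfolding PSB_unit by meson
    show "\<rho> (m + n - 1) (psb_coset (m + n - 1) (ocomp LW m n i x y)) =
       ocomp (End_operad scale) m n i (\<rho> m (psb_coset m x)) (\<rho> n (psb_coset n y))"
      if "i \<in> {1..m}" "x \<in> Ops LW m" "y \<in> Ops LW n" for i m n x y
    proof -
      have "\<rho> (m + n - 1) (ocomp PSB m n i (psb_coset m x) (psb_coset n y)) =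
          ocomp (End_operad scale) m n i (\<rho> m (psb_coset m x)) (\<rho> n (psb_coset n y))"
        using \<rho> PSB that by meson
      then show ?thesis using that by (simp only: PSB_comp)
    qed
    show "\<rho> n (psb_coset n (oact LW n \<sigma> x)) =
        oact (End_operad scale) n \<sigma> (\<rho> n (psb_coset n x))"
      if "\<sigma> permutes {1..n}" "x \<in> Ops LW n" for \<sigma> n x
    proof -
      have "\<rho> n (oact PSB n \<sigma> (psb_coset n x)) =
          oact (End_operad scale) n \<sigma> (\<rho> n (psb_coset n x))"
        using \<rho> PSB that by meson
      then show ?thesis using that by (simp only: PSB_act)
    qed
    show "\<rho> n (psb_coset n x) = (\<lambda>_. 0)" if x: "x \<in> psb_relations n" for x n
    proof -
      \<comment> \<open>Zero is written as \<open>fscale 0 x\<close> so that compatibility with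
        scalars gives the value 0.\<close>
      have "psb_coset n x = psb_coset n (fscale 0 x)"
        using x psb_relations_ideal[of n] by (auto simp: psb_coset_eq)
      then show ?thesis using sc[of x n 0] x psb_relations_subset[of n] by auto
    qed
  qed (fact add sc)+
qed

section \<open>Descent to the quotient\<close>

context lw_algebra
begin

lemma r_zero: "r n 0 = (\<lambda>_. 0)"
  using r_scale[of 0 n 0] by simp

lemma r_lcomb:
  assumes "x \<in> Ops LW n"
  shows "r n x xs = lcomb (\<lambda>t. r n (basis t) xs) x"
proof -
  have "r n (\<Sum>t\<in>A. fscale (Poly_Mapping.lookup x t) (basis t)) xs =
      (\<Sum>t\<in>A. scale (Poly_Mapping.lookup x t) (r n (basis t) xs))
    \<and> (\<Sum>t\<in>A. fscale (Poly_Mapping.lookup x t) (basis t)) \<in> Ops LW n"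
    if "finite A" "A \<subseteq> LW_trees n" for A
    using that
  proof (induction A)
    case empty
    then show ?case by (simp add: r_zero)
  next
    case (insert t A)
    have 1: "fscale (Poly_Mapping.lookup x t) (basis t) \<in> Ops LW n"
      using insert by (intro LW_scale_closed basis_in_LW) simp
    then show ?case using insert LW_add_closed[OF 1]
      by (simp add: r_add[OF 1] r_scale[OF basis_in_LW] del: LW_simps)
  qed
  from this[of "Poly_Mapping.keys x"] show ?thesis
    using assms lin_ext_basis_self[of x] by (simp add: lin_ext_def lcomb_def)
qed

lemma r_lin_entry:
  assumes "x \<in> Ops LW n" "length xs = n" "k < n"
  shows "lin (\<lambda>v. r n x (xs[k := v]))"
  using r_Ops[OF assms(1)] assms(2,3) by (auto simp: End_operad_def)

lemma r_length: "x \<in> Ops LW n \<Longrightarrow> length xs \<noteq> n \<Longrightarrow> r n x xs = 0"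
  using r_Ops[of x n] by (auto simp: End_operad_def split: if_splits)

text \<open>The kernel of a morphism is an ideal. It contains the relations, hence by minimality all
  of \<open>psb_ideal\<close>, and the maps descend to the quotient.\<close>

lemma operad_ideal_kernel: "operad_ideal LW (\<lambda>n. {x \<in> Ops LW n. r n x = (\<lambda>_. 0)})"
  unfolding operad_ideal_def
proof (intro conjI allI ballI impI)
  fix m n i :: nat and x y :: "nat ptree \<Rightarrow>\<^sub>0 'k" assume i: "i \<in> {1..m}"
  { assume x: "x \<in> {x \<in> Ops LW m. r m x = (\<lambda>_. 0)}" and y: "y \<in> Ops LW n"
    then have "r (m + n - 1) (ocomp LW m n i x y) = (\<lambda>_. 0)"
      using r_comp[OF i _ y, of x] by (simp add: End_operad_def del: LW_simps)
    then show "ocomp LW m n i x y \<in> {x \<in> Ops LW (m + n - 1). r (m + n - 1) x = (\<lambda>_. 0)}"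
      using LW_comp_closed[of x m y n i] x y i by blast }
  { assume x: "x \<in> Ops LW m" and y: "y \<in> {x \<in> Ops LW n. r n x = (\<lambda>_. 0)}"
    then have "r (m + n - 1) (ocomp LW m n i x y) = (\<lambda>_. 0)"
      using r_comp[OF i x, of y n] End_comp_zero[OF vector_space_axioms r_Ops[OF x] i] by simp
    then show "ocomp LW m n i x y \<in> {x \<in> Ops LW (m + n - 1). r (m + n - 1) x = (\<lambda>_. 0)}"
      using LW_comp_closed[of x m y n i] x y i by blast }
next
  fix n
  have "(0 :: nat ptree \<Rightarrow>\<^sub>0 'k) \<in> Ops LW n" by simp
  then have "0 \<in> {x \<in> Ops LW n. r n x = (\<lambda>_. 0)}" using r_zero by blast
  then show "{x \<in> Ops LW n. r n x = (\<lambda>_. 0)} \<noteq> {}" by blast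
next
  fix n \<sigma> x assume "\<sigma> permutes {1..n}" "x \<in> {x \<in> Ops LW n. r n x = (\<lambda>_. 0)}"
  then show "oact LW n \<sigma> x \<in> {x \<in> Ops LW n. r n x = (\<lambda>_. 0)}"
    using r_act[of \<sigma> n x] LW_act_closed[of x n \<sigma>]
        by (simp add: End_operad_def fun_eq_iff del: LW_simps)
qed (use LW_add_closed LW_scale_closed r_add r_scale in \<open>auto simp del: LW_simps(1) simp:
    LW_simps(2,3)\<close>)

lemma r_psb_ideal: "x \<in> psb_ideal n \<Longrightarrow> r n x = (\<lambda>_. 0)"
proof -
  have "psb_relations k \<subseteq> {x \<in> Ops LW k. r k x = (\<lambda>_. 0)}" for k
    using r_relations psb_relations_subset by blast
  then show "x \<in> psb_ideal n \<Longrightarrow> r n x = (\<lambda>_. 0)"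
    using operad_ideal_kernel unfolding psb_ideal_iff by blast
qed

text \<open>The value on a coset is taken at a chosen representative, which
  \<open>r_psb_ideal\<close> makes irrelevant; outside the carrier the map is restricted, as
  morphisms are extensional.\<close>

lemma ex_operad_algebra:
  "\<exists>\<rho>. operad_algebra PSB scale \<rho> \<and>
      (\<forall>n. \<forall>x\<in>Ops LW n. \<rho> n (psb_coset n x) = r n x)"
proof -
  define \<rho> where "\<rho> = (\<lambda>n. restrict (\<lambda>A. r n (SOME x. x \<in> Ops LW n \<and> A =
      psb_coset n x)) (Ops PSB n))"
  have PSB: "x \<in> Ops LW n \<Longrightarrow> psb_coset n x \<in> Ops PSB n" for n
      and x :: "nat ptree \<Rightarrow>\<^sub>0 'k"
    unfolding Ops_PSB by (rule imageI)
  have \<rho>: "\<rho> n (psb_coset n x) = r n x" if x: "x \<in> Ops LW n" for n x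
  proof -
    let ?y = "SOME y. y \<in> Ops LW n \<and> psb_coset n x = psb_coset n y"
    have y: "?y \<in> Ops LW n \<and> psb_coset n x = psb_coset n ?y"
      by (rule someI[of _ x]) (use x in blast)
    then have "?y - x \<in> psb_ideal n" by (metis psb_coset_eq)
    then have z: "r n (?y - x) = (\<lambda>_. 0)" by (rule r_psb_ideal)
    have "r n (x + (?y - x)) = r n x" using z r_add[OF x psb_ideal_subset[OF \<open>?y - x \<in> psb_ideal
        n\<close>]] by simp
    then have "r n ?y = r n x" by simp
    then show ?thesis using PSB[OF x] by (simp only: \<rho>_def restrict_apply if_True)
  qed
  have "operad_morphism PSB (End_operad scale) \<rho>"
    unfolding operad_morphism_def
  proof (intro conjI allI ballI impI)
    fix n
    show "\<rho> n \<in> Ops PSB n \<rightarrow>\<^sub>E Ops (End_operad scale) n"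
    proof (rule PiE_I)
      fix A :: "(nat ptree \<Rightarrow>\<^sub>0 'k) set" assume "A \<in> Ops PSB n"
      then obtain x where "x \<in> Ops LW n" "A = psb_coset n x" unfolding Ops_PSB by blast
      then show "\<rho> n A \<in> Ops (End_operad scale) n" using \<rho> r_Ops by simp
    qed (simp add: \<rho>_def)
  next
    fix n and A B :: "(nat ptree \<Rightarrow>\<^sub>0 'k) set" assume "A \<in> Ops PSB n" "B \<in> Ops PSB n"
    then obtain x y where "x \<in> Ops LW n" "A = psb_coset n x" "y \<in> Ops LW n" "B = psb_coset n y"
      unfolding Ops_PSB by blast
    then show "\<rho> n (oadd PSB n A B) = oadd (End_operad scale) n (\<rho> n A) (\<rho> n B)"
      by (simp only: PSB_add \<rho> LW_add_closed r_add End_add)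
  next
    fix n c and A :: "(nat ptree \<Rightarrow>\<^sub>0 'k) set" assume "A \<in> Ops PSB n"
    then obtain x where "x \<in> Ops LW n" "A = psb_coset n x" unfolding Ops_PSB by blast
    then show "\<rho> n (oscale PSB n c A) = oscale (End_operad scale) n c (\<rho> n A)"
      by (simp only: PSB_scale \<rho> LW_scale_closed r_scale End_scale)
  next
    have "(basis (leaf 1) :: nat ptree \<Rightarrow>\<^sub>0 'k) \<in> Ops LW 1"
      by (rule basis_in_LW) (simp add: LW_trees_def)
    then show "\<rho> 1 (ounit PSB) = ounit (End_operad scale)"
      by (simp only: PSB_unit \<rho> r_unit)
  next
    fix m n i and A B :: "(nat ptree \<Rightarrow>\<^sub>0 'k) set" assume i: "i \<in> {1..m}"
        and "A \<in> Ops PSB m" "B \<in> Ops PSB n"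
    then obtain x y where "x \<in> Ops LW m" "A = psb_coset m x" "y \<in> Ops LW n" "B = psb_coset n y"
      unfolding Ops_PSB by blast
    then show "\<rho> (m + n - 1) (ocomp PSB m n i A B) =
        ocomp (End_operad scale) m n i (\<rho> m A) (\<rho> n B)"
      using i by (simp only: PSB_comp \<rho> LW_comp_closed r_comp)
  next
    fix n \<sigma> and A :: "(nat ptree \<Rightarrow>\<^sub>0 'k) set" assume s: "\<sigma> permutes {1..n}"
        and "A \<in> Ops PSB n"
    then obtain x where "x \<in> Ops LW n" "A = psb_coset n x" unfolding Ops_PSB by blast
    then show "\<rho> n (oact PSB n \<sigma> A) = oact (End_operad scale) n \<sigma> (\<rho> n A)"
      using s by (simp only: PSB_act \<rho> LW_act_closed r_act)
  qed
  then show ?thesis using \<rho> unfolding operad_algebra_def by blast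
qed

end

text \<open>Cosets are represented by combinations of trees, and morphisms are linear and
  extensional, so the trees decide.\<close>

lemma operad_algebra_eqI:
  assumes V: "vector_space scale" and "operad_algebra PSB scale \<rho>" "operad_algebra PSB scale \<rho>'"
    and eq: "\<And>n t. t \<in> LW_trees n \<Longrightarrow> \<rho> n (psb_coset n (basis t)) =
        \<rho>' n (psb_coset n (basis t))"
  shows "\<rho> = \<rho>'"
proof
  fix n
  interpret A: lw_algebra scale "\<lambda>n x. \<rho> n (psb_coset n x)"
    by (rule lw_algebra_of_operad_algebra[OF V assms(2)])
  interpret B: lw_algebra scale "\<lambda>n x. \<rho>' n (psb_coset n x)"
    by (rule lw_algebra_of_operad_algebra[OF V assms(3)])
  have ext: "\<rho> n \<in> Ops PSB n \<rightarrow>\<^sub>E Ops (End_operad scale) n" "\<rho>' n \<in> Ops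
      PSB n \<rightarrow>\<^sub>E Ops (End_operad scale) n"
    using assms(2,3)[unfolded operad_algebra_def operad_morphism_def, THEN conjunct1] by simp_all
  show "\<rho> n = \<rho>' n"
  proof (rule PiE_ext[OF ext])
    fix A :: "(nat ptree \<Rightarrow>\<^sub>0 'a) set" assume "A \<in> Ops PSB n"
    then obtain x where x: "x \<in> Ops LW n" "A = psb_coset n x" unfolding Ops_PSB by blast
    have "\<rho> n (psb_coset n x) xs = \<rho>' n (psb_coset n x) xs" for xs
      unfolding A.r_lcomb[OF x(1)] B.r_lcomb[OF x(1)]
      by (rule A.lcomb_cong) (use eq x in auto)
    then show "\<rho> n A = \<rho>' n A" using x by auto
  qed
qed

section \<open>The operations of an algebra\<close>

lemma corolla_in_LW_trees: "corolla n \<in> LW_trees (n + 1)"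
proof -
  have "labs (corolla n) = (n + 1) # [1..<Suc n]"
    by (simp add: corolla_def comp_def concat_map_singleton del: upt_Suc)
  moreover have "lwt (corolla n)" by (auto simp: corolla_def)
  ultimately show ?thesis by (auto simp: LW_trees_def)
qed

lemma graft_Nil: "graft (\<lambda>_. []) t = t"
  by (induction t) (simp add: map_idI split: option.split)

text \<open>The permutation in one-line notation, with entries numbered from 1 and the identity
  elsewhere, as \<open>permutes\<close> demands.\<close>

definition perm_of :: "nat list \<Rightarrow> nat \<Rightarrow> nat" where
  "perm_of ls i = (if i \<in> {1..length ls} then ls ! (i - 1) else i)"

lemma perm_of_permutes:
  assumes "distinct ls" "set ls = {1..n}"
  shows "perm_of ls permutes {1..n}" and "length ls = n"
proof -
  show n: "length ls = n" using distinct_card[OF assms(1)] assms(2) by simp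
  show "perm_of ls permutes {1..n}"
  proof (rule bij_imp_permutes)
    have "inj_on (perm_of ls) {1..n}"
      using assms(1) n by (auto simp: inj_on_def perm_of_def nth_eq_iff_index_eq)
    moreover have "perm_of ls ` {1..n} \<subseteq> {1..n}"
      using n assms(2) nth_mem[of _ ls] by (auto simp: perm_of_def)
    ultimately show "bij_betw (perm_of ls) {1..n} {1..n}"
      by (simp add: bij_betw_def endo_inj_surj)
  qed (use n in \<open>auto simp: perm_of_def\<close>)
qed

context lw_algebra
begin

definition alg_br :: "'v \<Rightarrow> 'v \<Rightarrow> 'v" where
  "alg_br x y = r 2 (basis (cherry (leaf 1) (leaf 2))) [x, y]"

definition alg_M :: "'v list \<Rightarrow> 'v \<Rightarrow> 'v" where
  "alg_M X z = r (length X + 1) (basis (corolla (length X))) (X @ [z])"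

lemma psb_operations_alg: "psb_operations scale alg_br alg_M"
proof (rule psb_operations.intro[OF vector_space_axioms], rule psb_operations_axioms.intro)
  have c: "(basis (cherry (leaf 1) (leaf 2)) :: _ \<Rightarrow>\<^sub>0 'k) \<in> Ops LW 2"
    by (intro basis_in_LW cherry_in_LW_trees)
  have k: "(basis (corolla n) :: _ \<Rightarrow>\<^sub>0 'k) \<in> Ops LW (n + 1)" for n
    by (intro basis_in_LW corolla_in_LW_trees)
  show "lin (alg_br x)" for x
    using r_lin_entry[OF c, of "[x, 0]" 1] by (simp add: alg_br_def[abs_def])
  show "lin (\<lambda>x. alg_br x y)" for y
    using r_lin_entry[OF c, of "[0, y]" 0] by (simp add: alg_br_def)
  show "lin (alg_M X)" for X
    using r_lin_entry[OF k[of "length X"], of "X @ [0]" "length X"] by (simp add: alg_M_def[abs_def])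
  show "lin (\<lambda>v. alg_M (A @ v # B) z)" for A B z
    using r_lin_entry[OF k[of "length (A @ 0 # B)"], of "A @ 0 # B @ [z]" "length A"]
    by (simp add: alg_M_def)
  \<comment> \<open>The corolla without leaves is the tree with one vertex, that is, the unit of the
    operad.\<close>
  show "alg_M [] z = z" for z
    using r_unit by (simp add: alg_M_def corolla_def End_operad_def)
qed

end

sublocale lw_algebra \<subseteq> psb_operations scale alg_br alg_M
  by (rule psb_operations_alg)

context lw_algebra
begin

text \<open>The algebra acts through \<open>t\<close> by evaluating it with its two operations.
  Inputs are numbered from 1 and list positions from 0, hence \<open>i - 1\<close>.\<close>

definition rep :: "nat \<Rightarrow> nat ptree \<Rightarrow> bool" where
  "rep n t \<longleftrightarrow> (\<forall>xs. length xs = n \<longrightarrow> r n (basis t) xs =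
      ev (\<lambda>i. xs ! (i - 1)) t)"

lemma rep_perm:
  assumes "t \<in> LW_trees n" "\<sigma> permutes {1..n}" "rep n t"
  shows "rep n (map_ptree \<sigma> t)"
  unfolding rep_def
proof (intro allI impI)
  fix xs :: "'v list" assume len: "length xs = n"
  let ?ys = "map (\<lambda>i. xs ! (\<sigma> i - 1)) [1..<Suc n]"
  have "r n (basis (map_ptree \<sigma> t)) = oact (End_operad scale) n \<sigma> (r n (basis t))"
    using r_act[OF assms(2) basis_in_LW[OF assms(1)]] by (simp add: lin_ext_simps)
  then have "r n (basis (map_ptree \<sigma> t)) xs = r n (basis t) ?ys"
    using len by (simp add: End_operad_def del: upt_Suc)
  also have "\<dots> = ev (\<lambda>i. ?ys ! (i - 1)) t"
    using assms(3) by (simp add: rep_def del: upt_Suc)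
  also have "\<dots> = ev (\<lambda>i. xs ! (\<sigma> i - 1)) t"
  proof (rule ev_cong)
    fix i assume "i \<in> set (labs t)"
    then have "1 \<le> i" "i \<le> n" using assms(1) by (auto simp: LW_trees_def)
    then show "?ys ! (i - 1) = xs ! (\<sigma> i - 1)" by (cases i) (simp_all del: upt_Suc)
  qed
  finally show "r n (basis (map_ptree \<sigma> t)) xs = ev (\<lambda>i. xs ! (i - 1)) (map_ptree \<sigma> t)"
    by (simp add: ev_map_ptree)
qed

lemma ev_corolla: "ev env (corolla n) = alg_M (map env [1..<Suc n]) (env (n + 1))"
  by (simp add: corolla_def comp_def del: upt_Suc)

lemma rep_corolla: "rep (n + 1) (corolla n)"
  unfolding rep_def
proof (intro allI impI)
  fix xs :: "'v list" assume len: "length xs = n + 1"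
  then have "xs = take n xs @ [xs ! n]" by (metis add.commute le_add2 plus_1_eq_Suc lessI
      take_Suc_conv_app_nth take_all_iff order_refl)
  moreover have "map (\<lambda>i. xs ! (i - 1)) [1..<Suc n] = take n xs"
    using len by (intro nth_equalityI) (simp_all del: upt_Suc)
  moreover have "length (take n xs) = n" using len by simp
  ultimately show "r (n + 1) (basis (corolla n)) xs = ev (\<lambda>i. xs ! (i - 1)) (corolla n)"
    unfolding ev_corolla alg_M_def by simp
qed

lemma rep_cherry: "rep 2 (cherry (leaf 1) (leaf 2))"
  unfolding rep_def by (auto simp: alg_br_def numeral_2_eq_2 length_Suc_conv)

text \<open>Grafting \<open>S\<close> in place of the leaf with the largest label is a single
  composition: no edges have to be distributed, no label of the outer tree moves, and nothing is
  contracted.\<close>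

lemma rep_plug:
  fixes m n :: nat
  defines "S' \<equiv> \<lambda>S. map_ptree (\<lambda>k. k + (m - 1)) S"
  assumes t: "Node l (As @ leaf m # Bs) \<in> LW_trees m" and S: "S \<in> LW_trees n"
    and lw: "lwt (Node l (As @ S # Bs))"
    and rep: "rep m (Node l (As @ leaf m # Bs))" "rep n S"
  shows "rep (m + n - 1) (Node l (As @ S' S # Bs))"
proof -
  let ?t = "Node l (As @ leaf m # Bs)" and ?p = "[length As]"
  have m: "m \<ge> 1" by (rule LW_trees_pos[OF t])
  have lt: "lwt ?t" "distinct (labs ?t)" "set (labs ?t) = {1..m}" using t by (auto simp: LW_trees_def)
  have p: "?p \<in> vertices ?t" "label_at ?t ?p = Some m" by (auto simp: vertices_Node nth_append)
  have vl: "vertex_labeled ?t m = ?p" by (rule vertex_labeled_eq[OF lt(2) p])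
  have sub: "subtree_at ?t ?p = leaf m" by (simp add: nth_append)
  have rv: "replace_vertex m h ?t = Node l (As @ h [] # Bs)" for h
    using replace_vertex_Node[OF lt(2), of "length As" m h] by (simp add: nth_append)
  \<comment> \<open>If \<open>l\<close> is a label, \<open>lw\<close> makes \<open>S\<close> full,
    so \<open>S\<close> is not in \<open>W_trees n\<close>; if not, the successor is unlabeled.
    Neither case contracts.\<close>
  have nc: "\<not> (S \<in> W_trees n \<and> ?p \<noteq> [] \<and> label_at ?t (butlast ?p) \<noteq> None)"
    using lw by (cases S) (auto simp: W_trees_iff)
  have idt: "map_ptree (\<lambda>k. if k > m then k + n - 1 else k) ?t = ?t"
    using map_ptree_cong_labs[of ?t "\<lambda>k. if k > m then k +
        n - 1 else k" "\<lambda>k. k"] lt(3) by (simp only:) (auto simp: ptree.map_ident)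
  have along: "tree_comp_along \<phi> n m ?t S = Node l (As @ S' S # Bs)" for \<phi>
    unfolding tree_comp_along_def idt rv S'_def by (simp add: graft_Nil)
  \<comment> \<open>A leaf has no incoming edge, and there is exactly one extensional function on
    the empty set.\<close>
  have "in_degree ?t ?p = 0" by (simp add: nth_append)
  then have maps: "grafting_maps n m ?t = {\<lambda>_. undefined}" by (simp add: grafting_maps_def vl)
  have comp: "ocomp LW m n m (basis ?t) (basis S) =
      (basis (Node l (As @ S' S # Bs)) :: _ \<Rightarrow>\<^sub>0 'k)"
    unfolding LW_comp_basis lw_tree_comp_def vl Let_def pt_comp_def maps along if_not_P[OF nc] by simp
  show ?thesis unfolding rep_def
  proof (intro allI impI)
    fix xs :: "'v list" assume len: "length xs = m + n - 1"
    let ?env = "\<lambda>i. xs ! (i - 1)"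
    let ?v = "r n (basis S) (take n (drop (m - 1) xs))"
    obtain \<Lambda> where "lin \<Lambda>" and \<Lambda>: "\<And>h. ev ?env (replace_vertex m h ?t) =
        \<Lambda> (ev ?env (h []))"
      "\<And>v. ev (?env(m := v)) ?t = \<Lambda> v"
      using ev_replace_vertex[OF lt(1,2) p, of ?env] unfolding sub ptree.sel list.map M_Nil by blast
    have n: "n \<ge> 1" by (rule LW_trees_pos[OF S])
    have mm: "m \<in> {1..m}" using m by simp
    note args = End_comp_args[OF mm n len]
    have v: "?v = ev ?env (S' S)"
    proof -
      have "?v = ev (\<lambda>i. take n (drop (m - 1) xs) ! (i - 1)) S" using rep(2) args(3)
          by (simp only: rep_def)
      also have "\<dots> = ev (\<lambda>i. ?env (i + (m - 1))) S"
        by (rule ev_cong, rule args(1)) (use S in \<open>simp add: LW_trees_def\<close>)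
      finally show ?thesis by (simp add: S'_def ev_map_ptree)
    qed
    have "r (m + n - 1) (basis (Node l (As @ S' S # Bs))) xs =
        r m (basis ?t) (take (m - 1) xs @ [?v] @ drop (m - 1 + n) xs)"
      using r_comp[of m m "basis ?t" "basis S" n] m t S len unfolding comp
      by (simp add: End_operad_def)
    also have "\<dots> = ev (\<lambda>i. (take (m - 1) xs @ [?v] @ drop (m - 1 + n) xs) ! (i - 1)) ?t"
      using rep(1) args(4) by (simp only: rep_def)
    also have "\<dots> = ev (?env(m := ?v)) ?t"
    proof (rule ev_cong)
      fix i assume "i \<in> set (labs ?t)"
      then have i: "i \<in> {1..m}" by (simp only: lt(3))
      show "(take (m - 1) xs @ [?v] @ drop (m - 1 + n) xs) ! (i - 1) = (?env(m := ?v)) i"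
        unfolding args(2)[OF i] using i by auto
    qed
    also have "\<dots> = ev ?env (Node l (As @ S' S # Bs))"
      using \<Lambda>(1)[of "\<lambda>_. S' S"] unfolding \<Lambda>(2) v rv by simp
    finally show "r (m + n - 1) (basis (Node l (As @ S' S # Bs))) xs = ev ?env (Node l (As @ S' S # Bs))" .
  qed
qed

end

primrec vcount :: "'l ptree \<Rightarrow> nat" where
  "vcount (Node l ts) = Suc (sum_list (map vcount ts))"

lemma vcount_map_ptree [simp]: "vcount (map_ptree f t) = vcount t"
proof (induction t)
  case (Node l ts)
  then have "map (vcount \<circ> map_ptree f) ts = map vcount ts" by simp
  then show ?case by (simp del: map_eq_conv)
qed

lemma vcount_le_1: "vcount t \<le> 1 \<longleftrightarrow> branches t = []"
proof (cases t)
  case (Node l ts)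
  show ?thesis
  proof (cases ts)
    case (Cons c cs)
    then show ?thesis by (cases c) (simp add: Node)
  qed (simp add: Node)
qed

context lw_algebra
begin

text \<open>
  A tree with a child \<open>c\<close> of the root that is not a leaf is, up to relabeling, the composite at a leaf
  of a smaller tree with \<open>c\<close>; no contraction occurs, because \<open>c\<close> has no unlabeled vertex when the
  root is labeled.
\<close>

theorem rep_LW_trees: "t \<in> LW_trees N \<Longrightarrow> rep N t"
proof (induction "vcount t" arbitrary: t N rule: less_induct)
  case less
  obtain l ts where t: "t = Node l ts" by (cases t)
  have lt: "lwt t" "distinct (labs t)" "set (labs t) = {1..N}" using less.prems by (auto simp: LW_trees_def)
  show ?case
  proof (cases "\<forall>c\<in>set ts. branches c = []")
    case True
    have "\<exists>b. c = leaf b" if c: "c \<in> set ts" for c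
    proof -
      have "lwt c" using lt c by (auto simp: t full_imp_lwt split: option.splits)
      then show ?thesis using True c by (cases rule: lwt_cases) auto
    qed
    then obtain f where "\<forall>c\<in>set ts. c = leaf (f c)" by metis
    then have ts: "ts = map leaf (map f ts)" by (simp add: map_idI comp_def)
    define bs where "bs = map f ts"
    note ts = ts[folded bs_def]
    have labs: "concat (map labs (map leaf bs)) = bs" by (simp add: comp_def concat_map_singleton)
    show ?thesis
    proof (cases l)
      case (Some a)
      have "labs t = a # bs" unfolding t ts labs.simps(1) labs Some by simp
      \<comment> \<open>The corolla carries its largest label at the root, so \<open>a\<close> goes
        last.\<close>
      then have d: "distinct (bs @ [a])" "set (bs @ [a]) = {1..N}" using lt by auto
      note \<sigma> = perm_of_permutes[OF d]
      let ?n = "length bs"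
      have N: "N = ?n + 1" using \<sigma>(2) by simp
      have "map (perm_of (bs @ [a])) [1..<Suc ?n] = bs"
        by (rule nth_equalityI) (auto simp: perm_of_def nth_append simp del: upt_Suc)
      moreover have "perm_of (bs @ [a]) (?n + 1) = a" by (simp add: perm_of_def)
      moreover have "map_ptree (perm_of (bs @ [a])) (corolla ?n) =
          Node (Some (perm_of (bs @ [a]) (?n + 1))) (map leaf (map (perm_of (bs @ [a])) [1..<Suc ?n]))"
        by (simp add: corolla_def comp_def del: upt_Suc)
      ultimately have "t = map_ptree (perm_of (bs @ [a])) (corolla ?n)"
        unfolding t ts Some by simp
      then show ?thesis
        using rep_perm[OF corolla_in_LW_trees _ rep_corolla, of "perm_of (bs @ [a])" ?n] \<sigma>(1) N by simp
    next
      case None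
      then have "length bs = 2" using lt by (simp add: t bs_def)
      then obtain a b where ab: "bs = [a, b]" by (auto simp: numeral_2_eq_2 length_Suc_conv)
      have "labs t = bs" unfolding t ts labs.simps(1) labs None by simp
      then have d: "distinct bs" "set bs = {1..N}" using lt by auto
      note \<sigma> = perm_of_permutes[OF d]
      have N: "N = 2" using \<sigma>(2) ab by simp
      have "t = map_ptree (perm_of bs) (cherry (leaf 1) (leaf 2))"
        unfolding t ts None by (simp add: ab perm_of_def)
      then show ?thesis
        using rep_perm[OF cherry_in_LW_trees(1) _ rep_cherry, of "perm_of bs"] \<sigma>(1) N by simp
    qed
  next
    case False
    then obtain c where c: "c \<in> set ts" "branches c \<noteq> []" by blast
    then obtain As Bs where ts: "ts = As @ c # Bs" by (meson split_list)
    \<comment> \<open>The relabeling \<open>g\<close> numbers the labels outside \<open>c\<close> by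
      \<open>1..u\<close> and those of \<open>c\<close> from \<open>u + 1\<close> on, so that
      \<open>c\<close> is the part inserted at the largest input \<open>m = u + 1\<close>.\<close>
    define U where "U = labs (Node l (As @ Bs))"
    define ls where "ls = U @ labs c"
    define u where "u = length U"
    have "mset (labs t) = mset ls" by (simp add: t ts ls_def U_def ac_simps)
    then have ls: "distinct ls" "set ls = {1..N}"
      using lt by (metis mset_eq_imp_distinct_iff, metis mset_eq_setD)
    note \<sigma> = perm_of_permutes[OF ls]
    define g where "g = inv_into UNIV (perm_of ls)"
    have lenN: "N = u + length (labs c)" using \<sigma>(2) by (simp add: ls_def u_def)
    have gU: "map g U = [1..<Suc u]"
    proof (rule nth_equalityI)
      fix i assume "i < length (map g U)"
      then have i: "i < u" by (simp add: u_def)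
      have "perm_of ls (i + 1) = U ! i" using i by (simp add: perm_of_def ls_def u_def nth_append)
      then have "g (U ! i) = i + 1" unfolding g_def using permutes_inverses(2)[OF \<sigma>(1)] by metis
      then show "map g U ! i = [1..<Suc u] ! i" using i by (simp add: u_def del: upt_Suc)
    qed (simp add: u_def del: upt_Suc)
    have gc: "map g (labs c) = map (\<lambda>k. k + u) [1..<Suc (length (labs c))]"
    proof (rule nth_equalityI)
      fix i assume "i < length (map g (labs c))"
      then have i: "i < length (labs c)" by simp
      have "perm_of ls (u + i + 1) = labs c ! i" using i by (simp add: perm_of_def ls_def u_def nth_append)
      then have "g (labs c ! i) = u + i + 1" unfolding g_def using permutes_inverses(2)[OF \<sigma>(1)] by metis
      then show "map g (labs c) ! i = map (\<lambda>k. k +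
          u) [1..<Suc (length (labs c))] ! i" using i by (simp del: upt_Suc)
    qed (simp del: upt_Suc)
    define m where "m = u + 1"
    define n where "n = length (labs c)"
    \<comment> \<open>Subtracting \<open>u\<close> renumbers the branch from 1; the composition at
      \<open>m\<close> shifts by \<open>m - 1 = u\<close> and so undoes this.\<close>
    define S where "S = map_ptree (\<lambda>k. g k - u) c"
    let ?As = "map (map_ptree g) As" and ?Bs = "map (map_ptree g) Bs"
    let ?t' = "Node (map_option g l) (?As @ leaf m # ?Bs)"
    have lc: "lwt c" using lt(1) by (auto simp: t ts full_imp_lwt split: option.splits)
    have labsS: "labs S = [1..<Suc n]"
    proof -
      have "labs S = map (\<lambda>k. k - u) (map g (labs c))" by (simp add: S_def labs_map_ptree comp_def)
      also have "\<dots> = [1..<Suc n]" unfolding gc by (simp add: comp_def n_def del: upt_Suc)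
      finally show ?thesis .
    qed
    have S: "S \<in> LW_trees n" using lc by (auto simp: LW_trees_def labsS S_def[THEN arg_cong[of _ _
        lwt]] simp del: upt_Suc)
    have "mset (labs ?t') = mset (map g U) + {#m#}"
    proof -
      have "concat (map labs ?As) = map g (concat (map labs As))" "concat (map labs ?Bs) =
          map g (concat (map labs Bs))"
        by (simp_all add: map_concat comp_def labs_map_ptree)
      then show ?thesis by (cases l) (simp_all add: U_def del: map_map)
    qed
    then have mt': "mset (labs ?t') = mset [1..<Suc m]" unfolding gU by (simp add: m_def)
    have lwt': "lwt ?t'" using lt(1) by (auto simp: t ts split: option.splits)
    have "mset_set (set [1..<Suc m]) = mset [1..<Suc m]" by (rule mset_set_set) simp
    moreover have "set [1..<Suc m] = {1..m}" by auto
    ultimately have t': "?t' \<in> LW_trees m" using lwt' unfolding LW_trees_mset mt' by (simp only: simp_thms)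
    have lwS: "lwt (Node (map_option g l) (?As @ S # ?Bs))"
      using lt(1) by (auto simp: t ts S_def split: option.splits)
    have big: "vcount c > 1" using c(2) vcount_le_1[of c] by simp
    have "vcount S < vcount t" by (simp add: S_def t ts)
    then have repS: "rep n S" using less.hyps S by blast
    have "map (vcount \<circ> map_ptree g) As = map vcount As" "map (vcount \<circ> map_ptree g) Bs =
        map vcount Bs" by auto
    then have "vcount ?t' < vcount t" using big by (simp add: t ts del: map_eq_conv)
    then have rept': "rep m ?t'" using less.hyps t' by blast
    have "map_ptree (\<lambda>k. k + (m - 1)) S = map_ptree g c"
      unfolding S_def map_ptree_comp
    proof (rule map_ptree_cong_labs)
      fix k assume "k \<in> set (labs c)"
      then have "g k \<in> set (map g (labs c))" by simp
      then have "g k \<ge> u" unfolding gc by auto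
      then show "g k - u + (m - 1) = g k" by (simp add: m_def)
    qed
    then have "rep (m + n - 1) (map_ptree g t)"
      using rep_plug[OF t' S lwS rept' repS] by (simp add: t ts)
    moreover have N: "m + n - 1 = N" by (simp add: m_def n_def lenN)
    moreover have "map_ptree g t \<in> LW_trees N"
      using map_ptree_permutes[OF less.prems permutes_inv[OF \<sigma>(1)]] by (simp add: g_def)
    ultimately have "rep N (map_ptree (perm_of ls) (map_ptree g t))"
      using rep_perm[OF _ \<sigma>(1)] by simp
    moreover have "map_ptree (perm_of ls) (map_ptree g t) = t"
      by (simp add: map_ptree_comp g_def permutes_inverses(1)[OF \<sigma>(1)] ptree.map_ident)
    ultimately show ?thesis by simp
  qed
qed

lemma r_basis:
  "t \<in> LW_trees n \<Longrightarrow> length xs = n \<Longrightarrow>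
      r n (basis t) xs = ev (\<lambda>i. xs ! (i - 1)) t"
  using rep_LW_trees by (simp add: rep_def)

lemma r_ev: "x \<in> Ops LW n \<Longrightarrow> length xs = n \<Longrightarrow>
    r n x xs = lcomb (ev (\<lambda>i. xs ! (i - 1))) x"
  unfolding r_lcomb by (rule lcomb_cong, rule r_basis) auto

end

section \<open>Algebras and structures\<close>

context lw_algebra
begin

text \<open>Counterpart of \<open>ev_lw_tree_comp\<close>, obtained here from the morphism property;
  the axioms are extracted by computing the left-hand side for generators.\<close>

lemma lcomb_ev_lw_tree_comp:
  assumes T: "T \<in> LW_trees m" and R: "R \<in> LW_trees n" and i: "i \<in> {1..m}" and len: "length xs =
      m + n - 1"
  shows "lcomb (ev (\<lambda>k. xs ! (k - 1))) (lw_tree_comp n i T R) =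
    ev (\<lambda>k. (take (i - 1) xs @ [ev (\<lambda>k. xs ! (k + (i - 1) - 1)) R] @ drop (i - 1 +
        n) xs) ! (k - 1)) T"
proof -
  let ?x = "lw_tree_comp n i T R :: _ \<Rightarrow>\<^sub>0 'k"
  have n: "n \<ge> 1" by (rule LW_trees_pos[OF R])
  have x: "?x \<in> Ops LW (m + n - 1)" using lw_tree_comp_closed[OF T R i] by simp
  note args = End_comp_args[OF i n len]
  have 1: "r n (basis R) (take n (drop (i - 1) xs)) = ev (\<lambda>k. xs ! (k + (i - 1) - 1)) R"
  proof -
    have "r n (basis R) (take n (drop (i - 1) xs)) = ev (\<lambda>k. take n (drop (i - 1) xs) ! (k - 1)) R"
      by (rule r_basis[OF R args(3)])
    also have "\<dots> = ev (\<lambda>k. xs ! (k + (i - 1) - 1)) R"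
      by (rule ev_cong, rule args(1)) (use R in \<open>simp add: LW_trees_def\<close>)
    finally show ?thesis .
  qed
  have "lcomb (ev (\<lambda>k. xs ! (k - 1))) ?x = r (m + n - 1) ?x xs"
    by (rule r_ev[OF x len, symmetric])
  also have "\<dots> = r m (basis T) (take (i - 1) xs @ [r n (basis R) (take n (drop (i - 1) xs))] @ drop
      (i - 1 + n) xs)"
    using r_comp[OF i basis_in_LW[OF T] basis_in_LW[OF R]] len by (simp add: LW_comp_basis End_operad_def)
  also have "\<dots> = ev (\<lambda>k. (take (i - 1) xs @ [r n (basis R) (take n (drop (i - 1) xs))] @ drop
      (i - 1 + n) xs) ! (k - 1)) T"
    by (rule r_basis[OF T args(4)])
  finally show ?thesis unfolding 1 .
qed

text \<open>Composition at the root of the corolla with one leaf. The root has no successor, so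
  nothing is contracted, and the leaf is grafted onto each vertex of \<open>R\<close> in turn. Both
  derivation rules are instances.\<close>

lemma alg_M_ev:
  assumes R: "R \<in> LW_trees n" and ys: "length ys = n"
  shows "alg_M [x] (ev (\<lambda>k. ys ! (k - 1)) R) =
      (\<Sum>a\<in>{1..n}. evg (\<lambda>k. ys ! (k - 1)) (pick [a] [x]) R)"
proof -
  let ?T = "corolla 1"
  have T: "?T \<in> LW_trees 2" using corolla_in_LW_trees[of 1] by (simp add: numeral_2_eq_2)
  have cor: "?T = Node (Some 2) [leaf 1]" by (simp add: corolla_def numeral_2_eq_2)
  have vl: "vertex_labeled ?T 2 = []"
    unfolding cor by (rule vertex_labeled_eq) simp_all
  have map_id: "map_ptree (\<lambda>k. if k > 2 then k + n - 1 else k) ?T = ?T" unfolding cor by simp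
  have maps: "grafting_maps n 2 ?T = {..<1} \<rightarrow>\<^sub>E {1..n}"
    unfolding grafting_maps_def vl unfolding cor by simp
  let ?g = "\<lambda>\<phi>. graft (\<lambda>w. map ((!) [leaf 1]) (filter (\<lambda>j. \<phi> j + 1 =
      w) [0..<length [leaf 1 :: nat ptree]])) (map_ptree (\<lambda>k. k + 1) R)"
  have along: "tree_comp_along \<phi> n 2 ?T R = ?g \<phi>" for \<phi>
    unfolding tree_comp_along_def map_id unfolding cor by simp
  have comp: "(lw_tree_comp n 2 ?T R :: _ \<Rightarrow>\<^sub>0 'k) =
      (\<Sum>\<phi>\<in>{..<1} \<rightarrow>\<^sub>E {1..n}. basis (?g \<phi>))"
    unfolding lw_tree_comp_def vl Let_def pt_comp_def maps along by (simp only: simp_thms if_False)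
  let ?xs = "x # ys"
  have g: "ev (\<lambda>k. ?xs ! (k - 1)) (?g \<phi>) =
      evg (\<lambda>k. ys ! (k - 1)) (pick (map \<phi> [0..<1]) [x]) R" for \<phi>
    unfolding ev_graft_comp
  proof (rule trans[OF evg_cong])
    fix i assume "i \<in> set (labs R)"
    then have "1 \<le> i" using R by (auto simp: LW_trees_def)
    then show "?xs ! (i + 1 - 1) = ys ! (i - 1) \<and>
        pick (map \<phi> [0..<length [leaf 1 :: nat ptree]]) (map (ev (\<lambda>k. ?xs ! (k - 1))) [leaf
            1]) i = pick (map \<phi> [0..<1]) [x] i"
      by (cases i) simp_all
  qed simp
  have "alg_M [x] (ev (\<lambda>k. ys ! (k - 1)) R) =
      ev (\<lambda>k. (take (2 - 1) ?xs @ [ev (\<lambda>k. ?xs ! (k + (2 - 1) - 1)) R] @ drop (2 - 1 +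
          n) ?xs) ! (k - 1)) ?T"
  proof -
    have "ev (\<lambda>k. ?xs ! (k + (2 - 1) - 1)) R = ev (\<lambda>k. ys ! (k - 1)) R"
    proof (rule ev_cong)
      fix k assume "k \<in> set (labs R)"
      then have "1 \<le> k" using R by (auto simp: LW_trees_def)
      then show "?xs ! (k + (2 - 1) - 1) = ys ! (k - 1)" by (cases k) simp_all
    qed
    then show ?thesis unfolding cor by simp
  qed
  also have "\<dots> = lcomb (ev (\<lambda>k. ?xs ! (k - 1))) (lw_tree_comp n 2 ?T R)"
    by (rule lcomb_ev_lw_tree_comp[OF T R, symmetric]) (simp_all add: ys)
  also have "\<dots> = (\<Sum>\<phi>\<in>{..<1} \<rightarrow>\<^sub>E {1..n}. evg (\<lambda>k. ys ! (k -
      1)) (pick (map \<phi> [0..<1]) [x]) R)"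
    by (simp only: comp lcomb_sum lcomb_basis g)
  also have "\<dots> = (\<Sum>\<phi>\<in>words {1..n} 1. evg (\<lambda>k. ys ! (k - 1)) (pick \<phi> [x]) R)"
    by (rule sum.reindex_bij_betw[OF words_eq_PiE])
  also have "\<dots> = (\<Sum>a\<in>{1..n}. evg (\<lambda>k. ys ! (k - 1)) (pick [a] [x]) R)"
    using sum_words_Suc[of "\<lambda>\<phi>. evg (\<lambda>k. ys ! (k - 1)) (pick \<phi> [x]) R" "{1..n}"
        0] by simp
  finally show ?thesis .
qed

text \<open>\<open>alg_M_ev\<close> for a corolla: a letter grafted onto the root comes to the left
  of \<open>Y\<close>, and one grafted onto leaf \<open>Suc k\<close> acts on
  \<open>Y ! k\<close>.\<close>

lemma alg_M_deriv: "alg_M [x] (alg_M Y z) =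
    alg_M (x # Y) z + (\<Sum>k<length Y. alg_M (Y[k := alg_M [x] (Y ! k)]) z)"
proof -
  let ?n = "length Y" and ?ys = "Y @ [z]"
  have mapY: "map (\<lambda>k. ?ys ! (k - 1)) [1..<Suc ?n] = Y"
    by (rule nth_equalityI) (simp_all add: nth_append del: upt_Suc)
  have 1: "ev (\<lambda>k. ?ys ! (k - 1)) (corolla ?n) = alg_M Y z"
    unfolding ev_corolla mapY by simp
  have evg: "evg (\<lambda>k. ?ys ! (k - 1)) G (corolla ?n) =
      alg_M (G (?n + 1) @ map (\<lambda>k. alg_M (G k) (?ys ! (k - 1))) [1..<Suc ?n]) z" for G
    by (simp add: corolla_def comp_def del: upt_Suc)
  have root: "evg (\<lambda>k. ?ys ! (k - 1)) (pick [?n + 1] [x]) (corolla ?n) = alg_M (x # Y) z"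
  proof -
    have "map (\<lambda>k. alg_M (pick [?n + 1] [x] k) (?ys ! (k - 1))) [1..<Suc ?n] =
        map (\<lambda>k. ?ys ! (k - 1)) [1..<Suc ?n]"
      by (rule map_cong) (auto simp: pick_singleton)
    then show ?thesis unfolding evg mapY by (simp add: pick_singleton)
  qed
  have leaf: "evg (\<lambda>k. ?ys ! (k - 1)) (pick [Suc k] [x]) (corolla ?n) =
      alg_M (Y[k := alg_M [x] (Y ! k)]) z"
    if k: "k < ?n" for k
  proof -
    have "map (\<lambda>j. alg_M (pick [Suc k] [x] j) (?ys ! (j - 1))) [1..<Suc ?n] = Y[k := alg_M [x] (Y ! k)]"
      by (rule nth_equalityI) (use k in \<open>auto simp: pick_singleton nth_append nth_list_update simp
          del: upt_Suc\<close>)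
    then show ?thesis unfolding evg using k by (simp add: pick_singleton)
  qed
  have "{1..?n + 1} = insert (?n + 1) (Suc ` {..<?n})" by (simp add: image_Suc_lessThan atLeastAtMostSuc_conv)
  then have "(\<Sum>a\<in>{1..?n + 1}. evg (\<lambda>k. ?ys ! (k - 1)) (pick [a] [x]) (corolla ?n)) =
      evg (\<lambda>k. ?ys ! (k - 1)) (pick [?n + 1] [x]) (corolla ?n) +
      (\<Sum>a\<in>Suc ` {..<?n}. evg (\<lambda>k. ?ys ! (k - 1)) (pick [a] [x]) (corolla ?n))"
    by (simp only: sum.insert[of "Suc ` {..<?n}"] finite_imageI finite_lessThan) (subst sum.insert, auto)
  also have "(\<Sum>a\<in>Suc ` {..<?n}. evg (\<lambda>k. ?ys ! (k - 1)) (pick [a] [x]) (corolla ?n)) =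
      (\<Sum>k<?n. evg (\<lambda>k. ?ys ! (k - 1)) (pick [Suc k] [x]) (corolla ?n))"
    by (simp add: sum.reindex)
  also have "\<dots> = (\<Sum>k<?n. alg_M (Y[k := alg_M [x] (Y ! k)]) z)"
    by (rule sum.cong) (simp_all only: leaf lessThan_iff)
  finally show ?thesis
    using alg_M_ev[OF corolla_in_LW_trees[of ?n], of ?ys x] unfolding 1 root by simp
qed

lemma alg_br_deriv: "alg_M [x] (alg_br a b) = alg_br (alg_M [x] a) b + alg_br a (alg_M [x] b)"
proof -
  have "{1..2::nat} = {1, 2}" by auto
  then show ?thesis
    using alg_M_ev[OF cherry_in_LW_trees(1), of "[a, b]" x] by (simp add: pick_singleton)
qed

lemma alg_br_antisym: "alg_br x y = - alg_br y x"
proof -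
  let ?x = "basis (cherry (leaf 1) (leaf 2)) + basis (cherry (leaf 2) (leaf 1)) :: _ \<Rightarrow>\<^sub>0 'k"
  have rel: "?x \<in> psb_relations 2" by (simp add: psb_relations_def)
  then have "?x \<in> Ops LW 2" using psb_relations_subset by blast
  from r_ev[OF this, of "[x, y]"] have "lcomb (ev (\<lambda>i. [x, y] ! (i - 1))) ?x = 0"
    using r_relations[OF rel] by simp
  then have "alg_br x y + alg_br y x = 0" by (simp add: lcomb_add)
  then show ?thesis by (simp add: eq_neg_iff_add_eq_0)
qed

lemma alg_br_jacobi: "alg_br x (alg_br y z) = alg_br (alg_br x y) z + alg_br y (alg_br x z)"
proof -
  let ?x = "basis (cherry (leaf 1) (cherry (leaf 2) (leaf 3)))
        - basis (cherry (cherry (leaf 1) (leaf 2)) (leaf 3))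
        - basis (cherry (leaf 2) (cherry (leaf 1) (leaf 3))) :: _ \<Rightarrow>\<^sub>0 'k"
  have rel: "?x \<in> psb_relations 3" by (simp add: psb_relations_def)
  then have "?x \<in> Ops LW 3" using psb_relations_subset by blast
  from r_ev[OF this, of "[x, y, z]"] have "lcomb (ev (\<lambda>i. [x, y, z] ! (i - 1))) ?x = 0"
    using r_relations[OF rel] by simp
  then have "alg_br x (alg_br y z) - alg_br (alg_br x y) z - alg_br y (alg_br x z) = 0"
    unfolding lcomb_minus lcomb_basis by simp
  then show ?thesis by (simp add: algebra_simps)
qed

text \<open>The cherry is composed into leaf \<open>i\<close> of a corolla, whose successor is the
  labeled root, so contraction occurs. As a signed sum over exchanges the composite gives the
  left-hand side; as a substitution it gives the right-hand side.\<close>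

lemma alg_M_commutator:
  "alg_M (A @ [x, y] @ B) z - alg_M (A @ [y, x] @ B) z = alg_M (A @ [alg_br x y] @ B) z"
proof -
  let ?a = "length A" and ?b = "length B" and ?R = "cherry (leaf 1) (leaf 2) :: nat ptree"
  \<comment> \<open>The leaf \<open>i\<close> receives the bracket, and \<open>m\<close> is the
    length of \<open>A @ [alg_br x y] @ B\<close>.\<close>
  define i where "i = ?a + 1"
  define m where "m = ?a + 1 + ?b"
  let ?p = "[?a]" and ?T = "corolla m"
  let ?f = "\<lambda>k. if k > i then k + 2 - 1 else k"
  let ?xs = "A @ [x, y] @ B @ [z]"
  let ?env = "\<lambda>k. ?xs ! (k - 1)"
  have T: "?T \<in> LW_trees (m + 1)" by (rule corolla_in_LW_trees)
  have upt: "[1..<Suc m] = [1..<Suc ?a] @ i # [i + 1..<Suc m]"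
    unfolding i_def m_def by (metis Suc_eq_plus1 add.assoc add_Suc_right le_add1 upt_add_eq_append
        upt_conv_Cons less_add_Suc1 plus_1_eq_Suc)
  have cor: "?T = Node (Some (m + 1)) (map leaf [1..<Suc ?a] @ leaf i # map leaf [i + 1..<Suc m])"
    unfolding corolla_def upt by simp
  have p: "?p \<in> vertices ?T" "label_at ?T ?p = Some i"
    unfolding cor by (auto simp: vertices_Node nth_append simp del: upt_Suc)
  have vl: "vertex_labeled ?T i = ?p"
    by (rule vertex_labeled_eq[OF _ p]) (use T in \<open>simp add: LW_trees_def\<close>)
  have sub: "subtree_at ?T ?p = leaf i" unfolding cor by (simp add: nth_append del: upt_Suc)
  have maps: "grafting_maps 2 i ?T = {\<lambda>_. undefined}"
    by (simp only: grafting_maps_def vl in_degree_def sub ptree.sel list.size) simp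
  \<comment> \<open>The leaf \<open>i\<close> stays as the vertex to be replaced, and later labels
    move up by one, so that the cherry takes \<open>i\<close> and \<open>i + 1\<close>.\<close>
  let ?T' = "Node (Some (m + 2)) (map leaf [1..<Suc ?a] @ leaf i # map leaf [i + 2..<m + 2])"
  have T': "map_ptree ?f ?T = ?T'"
  proof -
    have "map ?f [1..<Suc ?a] = [1..<Suc ?a]" by (rule map_idI) (auto simp: i_def)
    moreover have "map ?f [i + 1..<Suc m] = map Suc [i + 1..<Suc m]" by (rule map_cong) auto
    moreover have "map Suc [i + 1..<Suc m] = [i + 2..<m + 2]" by (simp only: map_Suc_upt) simp
    moreover have "?f i = i" "?f (m + 1) = m + 2" by (simp_all add: i_def m_def)
    moreover have "map_ptree ?f ?T = Node (Some (?f (m +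
        1))) (map leaf (map ?f [1..<Suc ?a]) @ leaf (?f i) # map leaf (map ?f [i + 1..<Suc m]))"
      unfolding cor by (simp add: comp_def del: upt_Suc)
    ultimately show ?thesis by (simp only:)
  qed
  let ?r = "\<lambda>bs. Node (Some (m + 2)) (map leaf [1..<Suc ?a] @ bs @ map leaf [i + 2..<m + 2])"
  have along: "Con_at ?p (tree_comp_along \<phi> 2 i ?T Q) =
      ?r (branches (map_ptree (\<lambda>k. k + ?a) Q))" for \<phi> Q
  proof -
    have id: "map (replace_vertex i h) (map leaf ks) =
        map leaf ks" if "i \<notin> set ks" for h and ks :: "nat list"
      using that by (auto intro: map_idI)
    have rv: "replace_vertex i h ?T' = Node (Some (m + 2)) (map leaf [1..<Suc ?a] @ h [] # map leaf [i +
        2..<m + 2])" for h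
      using id[of "[1..<Suc ?a]" h] id[of "[i + 2..<m + 2]" h] by (simp add: i_def m_def del: upt_Suc map_map)
    show ?thesis unfolding tree_comp_along_def T' rv by (simp add: graft_Nil i_def nth_append del: upt_Suc)
  qed
  have W: "?R \<in> W_trees 2" using cherry_in_LW_trees(1) by (simp add: W_trees_iff)
  have "label_at ?T [] \<noteq> None" by (simp add: corolla_def)
  then have comp: "(lw_tree_comp 2 i ?T ?R :: _ \<Rightarrow>\<^sub>0 'k) =
      (\<Sum>S\<in>Pow (unlabeled_vertices ?R). fscale ((-1) ^ card S) (basis (?r (branches (map_ptree
          (\<lambda>k. k + ?a) (Con (swap_branches ?R S)))))))"
    using W unfolding lw_tree_comp_def vl Let_def pt_comp_def maps
    by (simp add: lin_ext_simps along del: swap_branches.simps Con.simps)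
  \<comment> \<open>The root is the only unlabeled vertex of the cherry, so there are two terms, of
    opposite sign.\<close>
  have un: "unlabeled_vertices ?R = {[]}" by (auto simp: unlabeled_Node numeral_2_eq_2 lessThan_Suc)
  have 0: "branches (map_ptree (\<lambda>k. k + ?a) (Con (swap_branches ?R {}))) =
      [leaf (1 + ?a), leaf (2 + ?a)]"
    by (simp add: swap_empty del: swap_branches.simps)
  have 1: "branches (map_ptree (\<lambda>k. k + ?a) (Con (swap_branches ?R {[]}))) =
      [leaf (2 + ?a), leaf (1 + ?a)]"
    by (simp add: upt_rec numeral_2_eq_2)
  have evr: "ev ?env (?r (map leaf ks)) = alg_M (A @ map ?env ks @ B) z" for ks
  proof -
    have "map ?env [1..<Suc ?a] = A" by (rule nth_equalityI) (simp_all add: nth_append del: upt_Suc)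
    moreover have "map ?env [i + 2..<m + 2] = B"
      by (rule nth_equalityI) (auto simp add: nth_append i_def m_def simp del: upt_Suc)
    moreover have "?env (m + 2) = z" by (simp add: m_def nth_append)
    ultimately show ?thesis by (simp add: comp_def del: upt_Suc)
  qed
  have "lcomb (ev ?env) (lw_tree_comp 2 i ?T ?R) =
      ev ?env (?r (map leaf [1 + ?a, 2 + ?a])) - ev ?env (?r (map leaf [2 + ?a, 1 + ?a]))"
  proof -
    have "(\<Sum>S\<in>Pow {[]}. f S) = f {} +
        f {[]}" for f :: "nat list set \<Rightarrow> nat ptree \<Rightarrow>\<^sub>0 'k"
      by (simp add: Pow_insert)
    then show ?thesis unfolding comp un by (simp only: 0 1 lcomb_add lcomb_fscale lcomb_basis list.map) simp
  qed
  also have "\<dots> = alg_M (A @ [x, y] @ B) z - alg_M (A @ [y, x] @ B) z"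
    unfolding evr by (simp add: nth_append)
  finally have lhs: "lcomb (ev ?env) (lw_tree_comp 2 i ?T ?R) =
      alg_M (A @ [x, y] @ B) z - alg_M (A @ [y, x] @ B) z" .
  have "ev (\<lambda>k. ?xs ! (k + (i - 1) - 1)) ?R = alg_br x y"
    by (simp add: i_def nth_append)
  moreover have "take (i - 1) ?xs = A" "drop (i - 1 + 2) ?xs = B @ [z]" by (simp_all add: i_def)
  moreover have "lcomb (ev ?env) (lw_tree_comp 2 i ?T ?R) =
    ev (\<lambda>k. (take (i - 1) ?xs @ [ev (\<lambda>k. ?xs ! (k + (i - 1) - 1)) ?R] @ drop (i - 1 +
        2) ?xs) ! (k - 1)) ?T"
    by (rule lcomb_ev_lw_tree_comp[OF T cherry_in_LW_trees(1)]) (simp_all add: i_def m_def)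
  ultimately have "lcomb (ev ?env) (lw_tree_comp 2 i ?T ?R) =
      ev (\<lambda>k. (A @ [alg_br x y] @ B @ [z]) ! (k - 1)) ?T"
    by (simp only:)
  also have "\<dots> = alg_M (A @ [alg_br x y] @ B) z"
  proof -
    let ?ys = "A @ [alg_br x y] @ B"
    have "map (\<lambda>k. (A @ [alg_br x y] @ B @ [z]) ! (k - 1)) [1..<Suc m] = ?ys"
    proof (rule nth_equalityI)
      fix j assume "j < length (map (\<lambda>k. (A @ [alg_br x y] @ B @ [z]) ! (k - 1)) [1..<Suc m])"
      then have j: "j < length ?ys" by (simp add: m_def del: upt_Suc)
      have "(?ys @ [z]) ! j = ?ys ! j" using j by (simp only: nth_append_left)
      then show "map (\<lambda>k. (A @ [alg_br x y] @ B @ [z]) ! (k - 1)) [1..<Suc m] ! j = ?ys ! j"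
        using j by (simp add: m_def del: upt_Suc)
    qed (simp add: m_def del: upt_Suc)
    moreover have "(A @ [alg_br x y] @ B @ [z]) ! (m + 1 - 1) = z" by (simp add: m_def nth_append)
    ultimately show ?thesis unfolding ev_corolla by (simp only:)
  qed
  finally show ?thesis using lhs by simp
qed

lemma psb_structure_alg: "psb_structure scale alg_br alg_M"
  by (rule psb_structure.intro[OF psb_operations_alg], rule psb_structure_axioms.intro)
    (fact alg_M_commutator alg_M_deriv alg_br_deriv alg_br_antisym alg_br_jacobi)+

end

section \<open>From structures to algebras\<close>

context psb_structure
begin

definition ev_alg :: "nat \<Rightarrow> (nat ptree \<Rightarrow>\<^sub>0 'a) \<Rightarrow> 'b list
    \<Rightarrow> 'b" where
  "ev_alg n x xs = (if length xs = n then lcomb (ev (\<lambda>i. xs ! (i - 1))) x else 0)"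

text \<open>The input \<open>Suc k\<close> labels one vertex; the value is the linear context of
  this vertex applied to \<open>M\<close>, which is linear in its last argument.\<close>

lemma ev_lin_entry:
  assumes t: "t \<in> LW_trees n" and len: "length xs = n" and k: "k < n"
  shows "lin (\<lambda>v. ev (\<lambda>i. xs[k := v] ! (i - 1)) t)"
proof -
  have lt: "lwt t" "distinct (labs t)" "set (labs t) = {1..n}" using t by (auto simp: LW_trees_def)
  obtain p where p: "p \<in> vertices t" "label_at t p = Some (Suc k)"
    using label_exists[of "Suc k" t] lt k by auto
  let ?env = "\<lambda>i. xs ! (i - 1)"
  obtain \<Lambda> where "lin \<Lambda>" and \<Lambda>: "\<And>v. ev (?env(Suc k := v)) t =
      \<Lambda> (M (map (ev ?env) (branches (subtree_at t p))) v)"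
    using ev_replace_vertex[OF lt(1,2) p, of ?env] by blast
  have "ev (\<lambda>i. xs[k := v] ! (i - 1)) t = ev (?env(Suc k := v)) t" for v
  proof (rule ev_cong)
    fix i assume "i \<in> set (labs t)"
    then have "1 \<le> i" "i \<le> n" using lt(3) by auto
    then show "xs[k := v] ! (i - 1) = (?env(Suc k := v)) i"
      using len by (cases i) (auto simp: nth_list_update)
  qed
  then show ?thesis unfolding \<Lambda> using lin_comp[OF \<open>lin \<Lambda>\<close> M_lin] by simp
qed

lemma ev_alg_Ops:
  assumes x: "x \<in> Ops LW n"
  shows "ev_alg n x \<in> Ops (End_operad scale) n"
proof (cases "n = 0")
  case True
  have "LW_trees 0 = {}" using LW_trees_pos by fastforce
  then have "x = 0" using x True by auto
  then show ?thesis using True by (auto simp: End_operad_def ev_alg_def fun_eq_iff)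
next
  case False
  have "lin (\<lambda>v. ev_alg n x (xs[i := v]))" if "length xs = n" "i < n" for xs i
  proof -
    have l: "lin (\<lambda>v. ev (\<lambda>k. xs[i := v] ! (k - 1)) t)" if "t \<in> Poly_Mapping.keys x" for t
      using x that \<open>length xs = n\<close> \<open>i < n\<close> by (intro ev_lin_entry) auto
    have "lin (\<lambda>v. lcomb (ev (\<lambda>k. xs[i := v] ! (k - 1))) x)"
    proof (rule linI)
      show "lcomb (ev (\<lambda>k. xs[i := v + w] ! (k - 1))) x =
          lcomb (ev (\<lambda>k. xs[i := v] ! (k - 1))) x +
              lcomb (ev (\<lambda>k. xs[i := w] ! (k - 1))) x" for v w
        unfolding lcomb_add_fun[symmetric] by (rule lcomb_cong) (rule lin_add[OF l])
      show "lcomb (ev (\<lambda>k. xs[i := scale c v] ! (k - 1))) x =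
          scale c (lcomb (ev (\<lambda>k. xs[i := v] ! (k - 1))) x)" for c v
        unfolding lcomb_scale_fun[symmetric] by (rule lcomb_cong) (rule lin_scale[OF l])
    qed
    then show ?thesis using that by (simp add: ev_alg_def)
  qed
  then show ?thesis using False by (simp add: End_operad_def ev_alg_def)
qed

text \<open>The bilinear extension of \<open>ev_lw_tree_comp\<close> from trees to
  combinations.\<close>

lemma ev_alg_comp:
  assumes i: "i \<in> {1..m}" and x: "x \<in> Ops LW m" and y: "y \<in> Ops LW n"
  shows "ev_alg (m + n - 1) (ocomp LW m n i x y) = ocomp (End_operad scale) m n i (ev_alg m x) (ev_alg n y)"
\<comment> \<open>A nonzero \<open>y\<close> contains a tree, hence \<open>n \<ge> 1\<close>, which
  the position arithmetic of \<open>End_comp_args\<close> requires.\<close>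
proof (cases "y = 0")
  case True
  then have y0: "ev_alg n y = (\<lambda>_. 0)" and xy0: "ocomp LW m n i x y = 0"
    by (simp_all add: ev_alg_def fun_eq_iff LW_comp lin_ext_lcomb)
  show ?thesis unfolding y0 xy0 End_comp_zero[OF vector_space_axioms ev_alg_Ops[OF x] i]
    by (simp add: ev_alg_def fun_eq_iff)
next
  case False
  then obtain t where "t \<in> Poly_Mapping.keys y" by (metis ex_in_conv keys_eq_empty)
  then have n: "n \<ge> 1" using y LW_trees_pos by auto
  show ?thesis
  proof
    fix xs
    show "ev_alg (m + n - 1) (ocomp LW m n i x y) xs =
        ocomp (End_operad scale) m n i (ev_alg m x) (ev_alg n y) xs"
    proof (cases "length xs = m + n - 1")
      case len: True
      note args = End_comp_args[OF i n len]
      let ?env = "\<lambda>k. xs ! (k - 1)"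
      let ?v = "ev_alg n y (take n (drop (i - 1) xs))"
      let ?ys = "\<lambda>v. take (i - 1) xs @ [v] @ drop (i - 1 + n) xs"
      have v: "?v = lcomb (ev (\<lambda>k. ?env (k + (i - 1)))) y"
      proof -
        have "?v = lcomb (ev (\<lambda>k. take n (drop (i - 1) xs) ! (k - 1))) y"
          using args(3) by (simp only: ev_alg_def simp_thms if_True)
        also have "\<dots> = lcomb (ev (\<lambda>k. ?env (k + (i - 1)))) y"
          by (rule lcomb_cong, rule ev_cong, rule args(1)) (use y in \<open>auto simp: LW_trees_def\<close>)
        finally show ?thesis .
      qed
      have T: "lcomb (\<lambda>R. lcomb (ev ?env) (lw_tree_comp n i T R)) y =
          ev (\<lambda>k. ?ys ?v ! (k - 1)) T"
        if "T \<in> Poly_Mapping.keys x" for T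
      proof -
        have T: "T \<in> LW_trees m" using x that by auto
        have ys: "?ys w = (?ys 0)[i - 1 := w]" for w
        proof -
          have "length (take (i - 1) xs) = i - 1" using len i n by auto
          then show ?thesis by (metis append_Cons append_Nil list_update_length)
        qed
        have "lin (\<lambda>w. ev (\<lambda>k. (?ys 0)[i - 1 := w] ! (k - 1)) T)"
          by (rule ev_lin_entry[OF T args(4)]) (use i in auto)
        moreover have "(\<lambda>w. ev (\<lambda>k. (?ys 0)[i - 1 := w] ! (k - 1)) T) =
            (\<lambda>w. ev (\<lambda>k. ?ys w ! (k - 1)) T)"
          by (rule ext) (subst (2) ys, rule refl)
        ultimately have lin: "lin (\<lambda>w. ev (\<lambda>k. ?ys w ! (k - 1)) T)" by (rule subst[rotated])
        have "lcomb (ev ?env) (lw_tree_comp n i T R) =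
            ev (\<lambda>k. ?ys (ev (\<lambda>k. ?env (k + (i - 1))) R) ! (k - 1)) T"
          if "R \<in> Poly_Mapping.keys y" for R
        proof -
          have R: "R \<in> LW_trees n" using y that by auto
          show ?thesis unfolding ev_lw_tree_comp[OF T R i]
            by (rule ev_cong, rule args(2)[symmetric]) (use T in \<open>simp add: LW_trees_def\<close>)
        qed
        then have "lcomb (\<lambda>R. lcomb (ev ?env) (lw_tree_comp n i T R)) y =
            lcomb (\<lambda>R. ev (\<lambda>k. ?ys (ev (\<lambda>k. ?env (k + (i - 1))) R) ! (k - 1)) T) y"
          by (rule lcomb_cong)
        \<comment> \<open>Linearity in the \<open>i\<close>-th input moves the combination over the
          trees of \<open>y\<close> inside the value of \<open>T\<close>.\<close>
        also have "\<dots> = ev (\<lambda>k. ?ys ?v ! (k - 1)) T" unfolding v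
            by (rule lin_lcomb[OF lin, symmetric])
        finally show ?thesis .
      qed
      have "ev_alg (m + n - 1) (ocomp LW m n i x y) xs =
          lcomb (\<lambda>T. lcomb (\<lambda>R. lcomb (ev ?env) (lw_tree_comp n i T R)) y) x"
        using len by (simp add: ev_alg_def LW_comp lcomb_lin_ext)
      also have "\<dots> = lcomb (ev (\<lambda>k. ?ys ?v ! (k - 1))) x" by (rule lcomb_cong) (rule T)
      also have "\<dots> = ev_alg m x (?ys ?v)" using args(4) unfolding ev_alg_def[of m] by simp
      finally show ?thesis using len by (simp add: End_operad_def)
    qed (simp add: End_operad_def ev_alg_def)
  qed
qed

lemma lw_algebra_ev_alg: "lw_algebra scale ev_alg"
proof (rule lw_algebra.intro[OF vector_space_axioms], rule lw_algebra_axioms.intro)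
  show "ev_alg n (x + y) = (\<lambda>xs. ev_alg n x xs + ev_alg n y xs)" for n x y
    by (simp add: ev_alg_def fun_eq_iff lcomb_add)
  show "ev_alg n (fscale c x) = (\<lambda>xs. scale c (ev_alg n x xs))" for n c x
    by (simp add: ev_alg_def fun_eq_iff lcomb_fscale)
  show "ev_alg 1 (basis (leaf 1)) = ounit (End_operad scale)"
    by (auto simp: ev_alg_def fun_eq_iff End_operad_def length_Suc_conv)
  show "ev_alg n x \<in> Ops (End_operad scale) n" if "x \<in> Ops LW n" for n x
    using that by (rule ev_alg_Ops)
  show "ev_alg (m + n - 1) (ocomp LW m n i x y) = ocomp (End_operad scale) m n i (ev_alg m x) (ev_alg n y)"
    if "i \<in> {1..m}" "x \<in> Ops LW m" "y \<in> Ops LW n" for m n i x y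
    using that by (rule ev_alg_comp)
  show "ev_alg n (oact LW n \<sigma> x) = oact (End_operad scale) n \<sigma> (ev_alg n x)"
    if \<sigma>: "\<sigma> permutes {1..n}" and x: "x \<in> Ops LW n" for n \<sigma> x
  proof
    fix xs :: "'b list"
    let ?ys = "map (\<lambda>i. xs ! (\<sigma> i - 1)) [1..<Suc n]"
    have "lcomb (\<lambda>t. ev (\<lambda>i. xs ! (\<sigma> i - 1)) t) x =
        lcomb (ev (\<lambda>i. ?ys ! (i - 1))) x"
    proof (rule lcomb_cong, rule ev_cong)
      fix t i assume "t \<in> Poly_Mapping.keys x" "i \<in> set (labs t)"
      then have "1 \<le> i" "i \<le> n" using x by (auto simp: LW_trees_def)
      then show "xs ! (\<sigma> i - 1) = ?ys ! (i - 1)" by (cases i) (simp_all del: upt_Suc)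
    qed
    then show "ev_alg n (oact LW n \<sigma> x) xs = oact (End_operad scale) n \<sigma> (ev_alg n x) xs"
      by (simp add: ev_alg_def End_operad_def lcomb_lin_ext ev_map_ptree del: upt_Suc)
  qed
  show "ev_alg n x = (\<lambda>_. 0)" if rel: "x \<in> psb_relations n" for n x
  proof
    fix xs :: "'b list"
    consider "n = 2" "x = basis (cherry (leaf 1) (leaf 2)) + basis (cherry (leaf 2) (leaf 1))"
      | "n = 3" "x = basis (cherry (leaf 1) (cherry (leaf 2) (leaf 3)))
        - basis (cherry (cherry (leaf 1) (leaf 2)) (leaf 3))
        - basis (cherry (leaf 2) (cherry (leaf 1) (leaf 3)))"
      using rel by (auto simp: psb_relations_def split: if_splits)
    then show "ev_alg n x xs = 0"
    proof cases
      case 1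
      show ?thesis unfolding 1(2) ev_alg_def lcomb_add lcomb_basis
          using br_antisym[of "xs ! 0" "xs ! 1"] by simp
    next
      case 2
      show ?thesis unfolding 2(2) ev_alg_def lcomb_minus lcomb_basis
        using br_jacobi[of "xs ! 0" "xs ! 1" "xs ! 2"] by (simp add: numeral_2_eq_2)
    qed
  qed
qed

end

section \<open>Maps on the tensor algebra\<close>

lemma ring_free_algebra: "ring (free_algebra :: ('v list \<Rightarrow>\<^sub>0 'k::field) ring)"
proof (rule ringI)
  show "abelian_group (free_algebra :: ('v list \<Rightarrow>\<^sub>0 'k) ring)"
    by (rule abelian_groupI) (auto simp: free_algebra_def algebra_simps intro: exI[of _ "- _"] left_minus)
  show "Group.monoid (free_algebra :: ('v list \<Rightarrow>\<^sub>0 'k) ring)"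
    by (rule monoidI) (auto simp: free_algebra_def mult.assoc)
qed (auto simp: free_algebra_def algebra_simps)

lemma ideal_free_algebraI:
  fixes I :: "('v list \<Rightarrow>\<^sub>0 'k::field) set"
  assumes "0 \<in> I" "\<And>p q. p \<in> I \<Longrightarrow> q \<in> I \<Longrightarrow>
      p + q \<in> I" "\<And>p q. p \<in> I \<Longrightarrow> q * p \<in> I" "\<And>p q. p \<in> I
          \<Longrightarrow> p * q \<in> I"
  shows "ideal I free_algebra"
proof (rule idealI[OF ring_free_algebra])
  interpret R: ring "free_algebra :: ('v list \<Rightarrow>\<^sub>0 'k) ring" by (rule ring_free_algebra)
  show "subgroup I (add_monoid free_algebra)"
  proof (rule R.add.subgroupI)
    fix p assume p: "p \<in> I"
    have "\<ominus>\<^bsub>free_algebra\<^esub> p = - p"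
      by (rule R.minus_equality) (simp_all add: free_algebra_def)
    moreover have "- 1 * p \<in> I" using p by (rule assms)
    ultimately show "\<ominus>\<^bsub>free_algebra\<^esub> p \<in> I" by simp
  qed (use assms in \<open>auto simp: free_algebra_def\<close>)
qed (use assms in \<open>auto simp: free_algebra_def\<close>)

lemma fscale_eq_mult: "fscale c p = Poly_Mapping.single [] c * (p :: 'v list \<Rightarrow>\<^sub>0 'k::field)"
  unfolding fscale_def mult_map_scale_conv_mult by (simp add: zero_list_def)

lemma basis_mult: "(basis A :: 'v list \<Rightarrow>\<^sub>0 'k::field) * basis B = basis (A @ B)"
  by (simp add: mult_single plus_list_def)

lemma poly_mapping_expand: "p = (\<Sum>b\<in>Poly_Mapping.keys p. fscale (Poly_Mapping.lookup p b) (basis b))"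
  using lin_ext_basis_self[of p] by (simp add: lin_ext_def)

text \<open>Scalars are central, because multiples of the empty word commute with every
  word.\<close>

lemma mult_fscale: "p * fscale c q = fscale c (p * (q :: 'v list \<Rightarrow>\<^sub>0 'k::field))"
proof -
  have "basis b * Poly_Mapping.single [] c =
      Poly_Mapping.single [] c * (basis b :: 'v list \<Rightarrow>\<^sub>0 'k)" for b
    by (simp add: mult_single plus_list_def)
  then have "p * Poly_Mapping.single [] c = Poly_Mapping.single [] c * p"
    by (subst (1 2) poly_mapping_expand[of p])
      (simp add: sum_distrib_left sum_distrib_right fscale_eq_mult mult.assoc, simp add:
          mult.assoc[symmetric] mult_single plus_list_def mult.commute)
  then show ?thesis by (simp add: fscale_eq_mult mult.assoc[symmetric])
qed

lemma fscale_mult: "fscale c p * q = fscale c (p * (q :: 'v list \<Rightarrow>\<^sub>0 'k::field))"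
  by (simp add: fscale_eq_mult mult.assoc)

text \<open>By bilinearity of the product it suffices to multiply by words on both sides.\<close>

lemma (in vector_space) lcomb_mult_zeroI:
  fixes p :: "'v list \<Rightarrow>\<^sub>0 'a"
  assumes "\<And>A B. lcomb f (basis A * p * basis B) = 0"
  shows "lcomb f (a * p * b) = 0"
proof -
  have 1: "lcomb f (basis A * p * b) = 0" for A
    by (subst poly_mapping_expand[of b])
      (simp add: sum_distrib_left mult_fscale lcomb_sum lcomb_fscale assms)
  show ?thesis
    by (subst poly_mapping_expand[of a])
      (simp add: sum_distrib_right fscale_mult lcomb_sum lcomb_fscale 1)
qed

context vector_space
begin

abbreviation tc :: "('b list \<Rightarrow>\<^sub>0 'a) \<Rightarrow> ('b list \<Rightarrow>\<^sub>0 'a)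
    set" where "tc \<equiv> tensor_class scale"
abbreviation TA where "TA \<equiv> tensor_algebra scale"
abbreviation LI where "LI \<equiv> linearity_ideal scale"

lemma ideal_LI: "ideal LI free_algebra"
  unfolding linearity_ideal_def
  by (rule ring.genideal_ideal[OF ring_free_algebra]) (simp add: free_algebra_def)

lemma generators_LI:
  "basis [x + y] - basis [x] - basis [y] \<in> LI" "basis [scale c x] - fscale c (basis [x]) \<in> LI"
proof -
  have "{basis [x + y] - basis [x] - basis [y] | x y. True} \<union>
     {basis [scale c x] - fscale c (basis [x]) | c x. True} \<subseteq> LI"
    unfolding linearity_ideal_def
    by (rule ring.genideal_self[OF ring_free_algebra]) (simp add: free_algebra_def)
  then show "basis [x + y] - basis [x] - basis [y] \<in> LI" "basis [scale c x] - fscale c (basis [x]) \<in> LI"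
    by blast+
qed

lemma LI_mult: "p \<in> LI \<Longrightarrow> a * p * b \<in> LI"
proof -
  interpret ideal LI "free_algebra :: ('b list \<Rightarrow>\<^sub>0 'a) ring" by (rule ideal_LI)
  assume "p \<in> LI"
  then have "a \<otimes>\<^bsub>free_algebra\<^esub> p \<otimes>\<^bsub>free_algebra\<^esub> b \<in> LI"
    by (intro I_l_closed I_r_closed) (simp_all add: free_algebra_def)
  then show ?thesis by (simp add: free_algebra_def)
qed

lemma tc_hom: "ring_hom_ring free_algebra TA tc"
proof -
  interpret ideal LI "free_algebra :: ('b list \<Rightarrow>\<^sub>0 'a) ring" by (rule ideal_LI)
  show ?thesis
    using rcos_ring_hom_ring by (simp add: tensor_algebra_def tensor_class_def[abs_def])
qed

lemma ring_TA: "ring TA"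
  using tc_hom by (rule ring_hom_ring.axioms)

lemma tc_closed [simp]: "tc p \<in> carrier TA"
  using ring_hom_closed[OF ring_hom_ring.homh[OF tc_hom]] by (simp add: free_algebra_def)

lemma tc_mult: "tc p \<otimes>\<^bsub>TA\<^esub> tc q = tc (p * q)"
  using ring_hom_mult[OF ring_hom_ring.homh[OF tc_hom], of p q] by (simp add: free_algebra_def)

lemma tc_add: "tc p \<oplus>\<^bsub>TA\<^esub> tc q = tc (p + q)"
  using ring_hom_add[OF ring_hom_ring.homh[OF tc_hom], of p q] by (simp add: free_algebra_def)

lemma tc_zero: "\<zero>\<^bsub>TA\<^esub> = tc 0"
proof -
  interpret ring_hom_ring free_algebra TA tc by (rule tc_hom)
  show ?thesis using hom_zero by (simp add: free_algebra_def)
qed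

lemma tc_minus: "tc p \<ominus>\<^bsub>TA\<^esub> tc q = tc (p - q)"
proof -
  interpret Q: ring TA by (rule ring_TA)
  have "tc p \<ominus>\<^bsub>TA\<^esub> tc q =
      (tc (p - q) \<oplus>\<^bsub>TA\<^esub> tc q) \<ominus>\<^bsub>TA\<^esub> tc q" by (simp add: tc_add)
  also have "\<dots> = tc (p - q)" by (simp add: Q.minus_eq Q.a_assoc Q.r_neg)
  finally show ?thesis .
qed

lemma tc_eqD: "tc p = tc q \<Longrightarrow> p - q \<in> LI"
proof -
  interpret ideal LI "free_algebra :: ('b list \<Rightarrow>\<^sub>0 'a) ring" by (rule ideal_LI)
  assume "tc p = tc q"
  moreover have "p \<in> tc p" unfolding tensor_class_def by (rule a_rcos_self) (simp add: free_algebra_def)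
  ultimately have "p \<in> tc q" by simp
  then show ?thesis unfolding tensor_class_def a_r_coset_def' by (auto simp: free_algebra_def)
qed

lemma tc_eqI: "p - q \<in> LI \<Longrightarrow> tc p = tc q"
proof -
  interpret ideal LI "free_algebra :: ('b list \<Rightarrow>\<^sub>0 'a) ring" by (rule ideal_LI)
  assume "p - q \<in> LI"
  then have "p \<in> tc q" unfolding tensor_class_def a_r_coset_def'
    by (intro UN_I[of "p - q"]) (simp_all add: free_algebra_def)
  then show ?thesis unfolding tensor_class_def
    by (intro a_repr_independence[OF _ _ a_subgroup, symmetric]) (simp_all add: free_algebra_def)
qed

lemma carrier_TA: "carrier TA = range tc"
  by (auto simp: tensor_algebra_def FactRing_def A_RCOSETS_def' tensor_class_def free_algebra_def)

lemma tensor_scale_tc: "tensor_scale scale c (tc p) = tc (fscale c p)"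
  by (simp add: tensor_scale_def tc_mult fscale_eq_mult)

lemma tensor_hom_tc:
  assumes "T \<in> tensor_hom scale"
  shows "lin (T (tc p))" "T (tc (p + q)) z = T (tc p) z + T (tc q) z"
    "T (tc (fscale c p)) z = scale c (T (tc p) z)"
proof -
  note T = assms[unfolded tensor_hom_def mem_Collect_eq]
  show "lin (T (tc p))" using T tc_closed by meson
  have "T (tc p \<oplus>\<^bsub>TA\<^esub> tc q) z = T (tc p) z + T (tc q) z" using T tc_closed by meson
  then show "T (tc (p + q)) z = T (tc p) z + T (tc q) z" by (simp only: tc_add)
  have "T (tensor_scale scale c (tc p)) z = scale c (T (tc p) z)" using T tc_closed by meson
  then show "T (tc (fscale c p)) z = scale c (T (tc p) z)" by (simp only: tensor_scale_tc)
qed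

text \<open>Elements of \<open>tensor_hom\<close> are determined by their values on monomials, which
  is how two of them are compared later.\<close>

lemma tensor_hom_lcomb:
  assumes "T \<in> tensor_hom scale"
  shows "T (tc p) z = lcomb (\<lambda>X. T (monomial scale X) z) p"
proof -
  have zero: "T (tc 0) z = 0" using tensor_hom_tc(3)[OF assms, of 0 0 z] by simp
  have "T (tc (\<Sum>b\<in>A. fscale (Poly_Mapping.lookup p b) (basis b))) z =
     (\<Sum>b\<in>A. scale (Poly_Mapping.lookup p b) (T (monomial scale b) z))" for A
    by (induction A rule: infinite_finite_induct)
      (simp_all add: zero tensor_hom_tc(2,3)[OF assms] monomial_def)
  then show ?thesis unfolding lcomb_def using poly_mapping_expand[of p] by metis
qed

lemma tensor_hom_minus:
  assumes "T \<in> tensor_hom scale"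
  shows "T (tc (p - q)) z = T (tc p) z - T (tc q) z"
  by (simp add: tensor_hom_lcomb[OF assms] lcomb_minus)

lemma tensor_hom_eqI:
  assumes "T \<in> tensor_hom scale" "T' \<in> tensor_hom scale"
    and "\<And>X z. T (monomial scale X) z = T' (monomial scale X) z"
  shows "T = T'"
proof (rule extensionalityI[of _ "carrier TA"])
  show "T \<in> extensional (carrier TA)" "T' \<in> extensional (carrier TA)"
    using assms(1,2) by (simp_all add: tensor_hom_def)
  fix A assume "A \<in> carrier TA"
  then obtain p where "A = tc p" by (auto simp: carrier_TA)
  then show "T A = T' A"
    by (simp add: fun_eq_iff tensor_hom_lcomb[OF assms(1)] tensor_hom_lcomb[OF assms(2)] assms(3))
qed

end

text \<open>
  The representative \<open>p\<close> is irrelevant if \<open>M\<close> is multilinear; see \<open>tensor_map_tc\<close>.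
\<close>

definition tensor_map ::
  "('k::field \<Rightarrow> 'v::ab_group_add \<Rightarrow> 'v) \<Rightarrow> ('v list \<Rightarrow> 'v
      \<Rightarrow> 'v) \<Rightarrow> ('v list \<Rightarrow>\<^sub>0 'k) set \<Rightarrow> 'v \<Rightarrow>
          'v" where
  "tensor_map scale M = restrict
     (\<lambda>A z. vector_space.lcomb scale (\<lambda>X. M X z) (SOME p. A = tensor_class scale p))
     (carrier (tensor_algebra scale))"

context psb_operations
begin

text \<open>
  Multiplying by arbitrary \<open>a\<close> and \<open>b\<close> makes the following set a two-sided ideal, so that it contains
  the ideals of the tensor algebra as soon as it contains their generators.
\<close>

definition annihilator :: "('v list \<Rightarrow>\<^sub>0 'k) set" where
  "annihilator = {p. \<forall>a b z. lcomb (\<lambda>X. M X z) (a * p * b) = 0}"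

lemma annihilatorI: "(\<And>A B z. lcomb (\<lambda>X. M X z) (basis A * p * basis B) = 0) \<Longrightarrow>
    p \<in> annihilator"
  unfolding annihilator_def by (auto intro: lcomb_mult_zeroI)

lemma annihilatorD: "p \<in> annihilator \<Longrightarrow> lcomb (\<lambda>X. M X z) p = 0"
  using mult_1_left mult_1_right unfolding annihilator_def mem_Collect_eq by metis

lemma annihilator_mult: "p \<in> annihilator \<Longrightarrow>
    q * p \<in> annihilator" "p \<in> annihilator \<Longrightarrow> p * q \<in> annihilator"
  unfolding annihilator_def mem_Collect_eq by (metis mult.assoc)+

lemma annihilator_add: "p \<in> annihilator \<Longrightarrow> q \<in> annihilator \<Longrightarrow>
    p + q \<in> annihilator"
  by (simp add: annihilator_def distrib_left distrib_right lcomb_add)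

lemma annihilator_zero: "0 \<in> annihilator"
  by (simp add: annihilator_def)

lemma ideal_annihilator: "ideal annihilator free_algebra"
  by (rule ideal_free_algebraI) (fact annihilator_zero annihilator_add annihilator_mult)+

text \<open>Linearity of \<open>M\<close> in an entry between arbitrary words \<open>A\<close> and
  \<open>B\<close> puts the generators into the annihilator, and minimality of the generated ideal
  does the rest.\<close>

lemma LI_annihilator: "LI \<subseteq> annihilator"
  unfolding linearity_ideal_def
proof (rule ring.genideal_minimal[OF ring_free_algebra ideal_annihilator], intro Un_least subsetI)
  fix p :: "'v list \<Rightarrow>\<^sub>0 'k" assume "p \<in> {basis [x +
      y] - basis [x] - basis [y] | x y. True}"
  then obtain x y where p: "p = basis [x + y] - basis [x] - basis [y]" by blast
  show "p \<in> annihilator"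
  proof (rule annihilatorI)
    fix A B z
    have "basis A * p * basis B = basis (A @ (x + y) # B) - basis (A @ x # B) - basis (A @ y # B)"
      by (simp add: p left_diff_distrib right_diff_distrib basis_mult)
    then show "lcomb (\<lambda>X. M X z) (basis A * p * basis B) = 0"
      by (simp add: lcomb_minus lin_add[OF M_lin_entry])
  qed
next
  fix p :: "'v list \<Rightarrow>\<^sub>0 'k" assume "p \<in> {basis [scale c x] - fscale c (basis [x]) | c
      x. True}"
  then obtain c x where p: "p = basis [scale c x] - fscale c (basis [x])" by blast
  show "p \<in> annihilator"
  proof (rule annihilatorI)
    fix A B z
    have "basis A * p * basis B = basis (A @ scale c x # B) - fscale c (basis (A @ x # B))"
      by (simp add: p left_diff_distrib right_diff_distrib mult_fscale fscale_mult basis_mult)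
    then show "lcomb (\<lambda>X. M X z) (basis A * p * basis B) = 0"
      by (simp add: lcomb_minus lcomb_fscale lin_scale[OF M_lin_entry])
  qed
qed

text \<open>Two representatives differ by an element of the linearity ideal, which the annihilator
  contains.\<close>

lemma tensor_map_tc: "tensor_map scale M (tc p) z = lcomb (\<lambda>X. M X z) p"
proof -
  have "tc p = tc (SOME q. tc p = tc q)" by (rule someI) (rule refl)
  then have "p - (SOME q. tc p = tc q) \<in> annihilator" using tc_eqD LI_annihilator by blast
  from annihilatorD[OF this, of z] show ?thesis by (simp add: tensor_map_def lcomb_minus)
qed

lemma tensor_map_monomial: "tensor_map scale M (monomial scale X) z = M X z"
  by (simp add: monomial_def tensor_map_tc)

lemma tensor_map_hom: "tensor_map scale M \<in> tensor_hom scale"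
  unfolding tensor_hom_def
proof (intro CollectI conjI ballI allI)
  show "tensor_map scale M \<in> extensional (carrier TA)" by (simp add: tensor_map_def)
  fix A assume "A \<in> carrier TA"
  then obtain p where A: "A = tc p" by (auto simp: carrier_TA)
  show "lin (tensor_map scale M A)"
    by (rule linI) (simp_all add: A tensor_map_tc lin_add[OF M_lin] lin_scale[OF M_lin] lcomb_add_fun
        lcomb_scale_fun)
  show "tensor_map scale M (tensor_scale scale c A) z = scale c (tensor_map scale M A z)" for c z
    by (simp add: A tensor_scale_tc tensor_map_tc lcomb_fscale)
  fix B z assume "B \<in> carrier TA"
  then obtain q where B: "B = tc q" by (auto simp: carrier_TA)
  show "tensor_map scale M (A \<oplus>\<^bsub>TA\<^esub> B) z = tensor_map scale M A z + tensor_map scale M B z"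
    by (simp add: A B tc_add tensor_map_tc lcomb_add)
qed

end

section \<open>Ordered partitions and words\<close>

lemma nths_eq_pick:
  assumes "length \<phi> = length X"
  shows "nths X {j. j < length X \<and> \<phi> ! j = w} = pick \<phi> X w"
proof -
  have zip: "zip X [0..<length X] = map (\<lambda>j. (X ! j, j)) [0..<length X]"
    by (rule nth_equalityI) simp_all
  have "nths X I = map ((!) X) (filter (\<lambda>j. j \<in> I) [0..<length X])" for I
    unfolding nths_def zip by (simp add: filter_map comp_def)
  moreover have "filter (\<lambda>j. j \<in> {j. j < length X \<and> \<phi> ! j = w}) [0..<length X] =
      filter (\<lambda>j. \<phi> ! j = w) [0..<length X]"
    by (rule filter_cong) auto
  ultimately show ?thesis by (simp only: pick_map_nth[OF assms])
qed

text \<open>A word over \<open>{..<k}\<close> names the block of each position; covering provides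
  the block, and disjointness makes it unique.\<close>

lemma bij_betw_words_partitions:
  "bij_betw (\<lambda>\<phi>. map (\<lambda>i. {j. j < n \<and> \<phi> ! j =
      i}) [0..<k]) (words {..<k} n) (ordered_partitions k n)"
  (is "bij_betw ?f _ _")
proof (rule bij_betwI')
  show "?f \<phi> = ?f \<psi> \<longleftrightarrow> \<phi> =
      \<psi>" if \<phi>: "\<phi> \<in> words {..<k} n"
          and \<psi>: "\<psi> \<in> words {..<k} n" for \<phi> \<psi>
  proof
    assume eq: "?f \<phi> = ?f \<psi>"
    show "\<phi> = \<psi>"
    proof (rule nth_equalityI)
      show "length \<phi> = length \<psi>" using \<phi> \<psi> by (simp add: words_def)
      fix j assume "j < length \<phi>"
      then have j: "j < n" "\<phi> ! j < k" using \<phi> subsetD[OF _ nth_mem, of \<phi> "{..<k}" j]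
          by (simp_all add: words_def)
      have "?f \<phi> ! (\<phi> ! j) = ?f \<psi> ! (\<phi> ! j)" by (simp only: eq)
      then have eq: "{i. i < n \<and> \<phi> ! i = \<phi> ! j} = {i. i < n \<and> \<psi> ! i =
          \<phi> ! j}" using j by simp
      have "j \<in> {i. i < n \<and> \<phi> ! i = \<phi> ! j}" using j by simp
      then have "j \<in> {i. i < n \<and> \<psi> ! i = \<phi> ! j}" by (simp only: eq)
      then show "\<phi> ! j = \<psi> ! j" by simp
    qed
  qed simp
  show "?f \<phi> \<in> ordered_partitions k n" if \<phi>: "\<phi> \<in> words {..<k} n" for \<phi>
  proof -
    have "\<phi> ! j < k" if "j < n" for j
      using \<phi> that subsetD[OF _ nth_mem, of \<phi> "{..<k}" j] by (simp add: words_def)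
    then show ?thesis by (auto simp: ordered_partitions_def)
  qed
  show "\<exists>\<phi>\<in>words {..<k} n. J = ?f \<phi>" if J: "J \<in> ordered_partitions k n" for J
  proof -
    have len: "length J = k" and un: "(\<Union>i<k. J ! i) = {..<n}"
      and dis: "\<And>i j. i < k \<Longrightarrow> j < k \<Longrightarrow> i \<noteq> j \<Longrightarrow>
          J ! i \<inter> J ! j = {}"
      using J by (auto simp: ordered_partitions_def)
    have "\<exists>i. i < k \<and> j \<in> J ! i" if "j < n" for j using un that by (metis UN_E lessThan_iff)
    then obtain g where g: "\<And>j. j < n \<Longrightarrow> g j < k \<and> j \<in> J ! g j" by metis
    let ?\<phi> = "map g [0..<n]"
    show ?thesis
    proof (rule bexI[of _ ?\<phi>])
      show "?\<phi> \<in> words {..<k} n" using g by (auto simp: words_def)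
      show "J = ?f ?\<phi>"
      proof (rule nth_equalityI)
        fix i assume "i < length J"
        then have i: "i < k" using len by simp
        have "J ! i \<subseteq> {..<n}" using un i by blast
        moreover have "j \<in> J ! i \<longleftrightarrow> g j = i" if "j < n" for j
          using g[OF that] dis[of i "g j"] i by blast
        ultimately have "J ! i = {j. j < n \<and> g j = i}" by blast
        also have "\<dots> = {j. j < n \<and> ?\<phi> ! j = i}" by auto
        finally show "J ! i = ?f ?\<phi> ! i" using i by simp
      qed (simp add: len)
    qed
  qed
qed

text \<open>\<open>h\<close> may depend only on the values below \<open>k\<close>, because
  \<open>J ! i\<close> is unspecified for \<open>i \<ge> k\<close>, whereas \<open>pick\<close> is
  defined everywhere.\<close>

lemma sum_ordered_partitions:
  assumes "\<And>G G'. (\<And>i. i < k \<Longrightarrow> G i = G' i) \<Longrightarrow> h G = h G'"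
  shows "(\<Sum>J\<in>ordered_partitions k (length X). h (\<lambda>i. nths X (J ! i))) =
    (\<Sum>\<phi>\<in>words {..<k} (length X). h (pick \<phi> X))"
proof -
  let ?f = "\<lambda>\<phi>. map (\<lambda>i. {j. j < length X \<and> \<phi> ! j = i}) [0..<k]"
  have "(\<Sum>J\<in>ordered_partitions k (length X). h (\<lambda>i. nths X (J ! i))) =
    (\<Sum>\<phi>\<in>words {..<k} (length X). h (\<lambda>i. nths X (?f \<phi> ! i)))"
    by (rule sum.reindex_bij_betw[OF bij_betw_words_partitions, symmetric])
  also have "\<dots> = (\<Sum>\<phi>\<in>words {..<k} (length X). h (pick \<phi> X))"
  proof (rule sum.cong[OF refl], rule assms)
    fix \<phi> i assume "\<phi> \<in> words {..<k} (length X)" "i < k"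
    then show "nths X (?f \<phi> ! i) = pick \<phi> X i" by (simp add: nths_eq_pick words_def)
  qed
  finally show ?thesis .
qed

section \<open>Structures and pairs\<close>

lemma (in vector_space) double_zero:
  fixes v :: 'b
  assumes "(2::'a) \<noteq> 0" "v = - v"
  shows "v = 0"
proof -
  have "scale 2 v = v + v" by (metis one_add_one scale_left_distrib scale_one)
  also have "\<dots> = 0" using assms(2) by (metis add.right_inverse)
  finally show ?thesis using assms(1) by simp
qed

section \<open>From structures to pairs, and back\<close>

context psb_structure
begin

text \<open>Here the characteristic enters: antisymmetry gives \<open>br x x = - br x x\<close>,
  from which \<open>br x x = 0\<close> follows on dividing by 2.\<close>

lemma lie_algebra_br:
  assumes "(2::'a) \<noteq> 0"
  shows "lie_algebra scale br"
  unfolding lie_algebra_def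
proof (intro conjI allI)
  show "br x x = 0" for x using double_zero[OF assms br_antisym] .
  show "br x (br y z) + br y (br z x) + br z (br x y) = 0" for x y z
  proof -
    have "br y (br z x) = - br y (br x z)"
      using br_antisym[of z x] lin_minus[OF br_lin_right] by simp
    then show ?thesis using br_jacobi[of x y z] br_antisym[of z "br x y"] by simp
  qed
qed (fact vector_space_axioms br_lin_right br_lin_left)+

text \<open>The image of the annihilator is an ideal of \<open>TA\<close>, and
  \<open>M_commutator\<close> with arbitrary words on both sides puts the generators into it; hence
  it contains the whole ideal.\<close>

lemma commutator_ideal_zero: "A \<in> commutator_ideal scale br \<Longrightarrow> tensor_map scale M A z = 0"
proof -
  interpret Q: ring TA by (rule ring_TA)
  have "ideal (tc ` annihilator) TA"
  proof (rule idealI[OF ring_TA])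
    show "subgroup (tc ` annihilator) (add_monoid TA)"
    proof (rule Q.add.subgroupI)
      fix A assume "A \<in> tc ` annihilator"
      then obtain p where p: "p \<in> annihilator" "A = tc p" by blast
      have "\<ominus>\<^bsub>TA\<^esub> A = tc (- p)"
        by (rule Q.minus_equality) (simp_all add: p tc_add tc_zero)
      moreover have "- 1 * p \<in> annihilator" by (rule annihilator_mult(1)[OF p(1)])
      ultimately show "\<ominus>\<^bsub>TA\<^esub> A \<in> tc ` annihilator" by simp
      fix B assume "B \<in> tc ` annihilator"
      then show "A \<oplus>\<^bsub>TA\<^esub> B \<in> tc ` annihilator" using p
          by (auto simp: tc_add annihilator_add)
    qed (use annihilator_zero in auto)
    show "x \<otimes>\<^bsub>TA\<^esub> a \<in> tc ` annihilator" "a \<otimes>\<^bsub>TA\<^esub> x \<in> tc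
        ` annihilator"
      if "a \<in> tc ` annihilator" "x \<in> carrier TA" for a x
      using that annihilator_mult by (auto simp: carrier_TA tc_mult)
  qed
  moreover have "{monomial scale [x, y] \<ominus>\<^bsub>TA\<^esub> monomial scale [y, x]
      \<ominus>\<^bsub>TA\<^esub> monomial scale [br x y] | x y. True} \<subseteq> tc ` annihilator"
  proof clarify
    fix x y
    let ?p = "basis [x, y] - basis [y, x] - basis [br x y] :: 'b list \<Rightarrow>\<^sub>0 'a"
    have "?p \<in> annihilator"
    proof (rule annihilatorI)
      fix A B z
      have "basis A * ?p * basis B = basis (A @ [x, y] @ B) - basis (A @ [y, x] @ B) - basis (A @ [br x y] @ B)"
        by (simp add: left_diff_distrib right_diff_distrib basis_mult)
      then show "lcomb (\<lambda>X. M X z) (basis A * ?p * basis B) = 0"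
        using M_commutator[of A x y B z] by (simp add: lcomb_minus)
    qed
    then show "monomial scale [x, y] \<ominus>\<^bsub>TA\<^esub> monomial scale [y, x]
        \<ominus>\<^bsub>TA\<^esub> monomial scale [br x y] \<in> tc ` annihilator"
      by (auto simp: monomial_def tc_minus)
  qed
  ultimately have "commutator_ideal scale br \<subseteq> tc ` annihilator"
    unfolding commutator_ideal_def by (rule Q.genideal_minimal)
  then show "A \<in> commutator_ideal scale br \<Longrightarrow> tensor_map scale M A z = 0"
    using annihilatorD by (auto simp: tensor_map_tc)
qed

text \<open>\<open>M_ev_sum\<close> for the corolla with root \<open>0\<close> and leaves from 1 on:
  with this numbering the block \<open>J ! k\<close> is what is grafted onto vertex
  \<open>k\<close>.\<close>

lemma M_M: "M X (M Y z) = (\<Sum>J\<in>ordered_partitions (Suc (length Y)) (length X).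
    M (nths X (J ! 0) @ map (\<lambda>k. M (nths X (J ! Suc k)) (Y ! k)) [0..<length Y]) z)"
proof -
  let ?m = "length Y"
  let ?R = "Node (Some 0) (map leaf [1..<Suc ?m])" and ?env = "\<lambda>i. if i = 0 then z else Y ! (i - 1)"
  let ?h = "\<lambda>G. M (G 0 @ map (\<lambda>k. M (G (Suc k)) (Y ! k)) [0..<?m]) z"
  have labs: "labs ?R = [0..<Suc ?m]"
    by (simp add: comp_def concat_map_singleton upt_conv_Cons del: upt_Suc)
  have upt: "[1..<Suc ?m] = map Suc [0..<?m]" by (simp add: map_Suc_upt del: upt_Suc)
  have "map (\<lambda>k. Y ! k) [0..<?m] = Y" by (rule map_nth)
  then have ev: "ev ?env ?R = M Y z" unfolding upt by (simp add: comp_def)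
  have evg: "evg ?env G ?R = ?h G" for G unfolding upt by (simp add: comp_def)
  have "M X (ev ?env ?R) = (\<Sum>\<phi>\<in>words (set (labs ?R)) (length X). evg ?env (pick \<phi> X) ?R)"
    by (rule M_ev_sum) (auto simp only: labs distinct_upt lwt_Node option.case set_map full_Node, auto)
  also have "set (labs ?R) = {..<Suc ?m}" unfolding labs by auto
  also have "(\<Sum>\<phi>\<in>words {..<Suc ?m} (length X). evg ?env (pick \<phi> X) ?R) =
      (\<Sum>\<phi>\<in>words {..<Suc ?m} (length X). ?h (pick \<phi> X))"
    by (simp only: evg)
  also have "\<dots> = (\<Sum>J\<in>ordered_partitions (Suc ?m) (length X). ?h (\<lambda>i. nths X (J ! i)))"
  proof (rule sum_ordered_partitions[symmetric])
    fix G G' :: "nat \<Rightarrow> 'b list" assume *: "\<And>i. i < Suc ?m \<Longrightarrow> G i = G' i"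
    have "map (\<lambda>k. M (G (Suc k)) (Y ! k)) [0..<?m] = map (\<lambda>k. M (G' (Suc k)) (Y ! k)) [0..<?m]"
      by (rule map_cong) (simp_all add: *)
    then show "?h G = ?h G'" using *[of 0] by (simp only: zero_less_Suc)
  qed
  finally show ?thesis unfolding ev .
qed

lemma M_br: "M X (br x y) = (\<Sum>J\<in>ordered_partitions 2 (length X). br (M (nths X (J ! 0)) x) (M
    (nths X (J ! 1)) y))"
proof -
  let ?R = "cherry (leaf 0) (leaf 1) :: nat ptree" and ?env = "\<lambda>i. if i = 0 then x else y"
  let ?h = "\<lambda>G. br (M (G 0) x) (M (G 1) y)"
  have "M X (ev ?env ?R) = (\<Sum>\<phi>\<in>words (set (labs ?R)) (length X). evg ?env (pick \<phi> X) ?R)"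
    by (rule M_ev_sum) simp_all
  also have "set (labs ?R) = {..<2::nat}" by auto
  also have "(\<Sum>\<phi>\<in>words {..<2::nat} (length X). evg ?env (pick \<phi> X) ?R) =
      (\<Sum>\<phi>\<in>words {..<2::nat} (length X). ?h (pick \<phi> X))"
    by simp
  also have "\<dots> = (\<Sum>J\<in>ordered_partitions 2 (length X). ?h (\<lambda>i. nths X (J ! i)))"
  proof (rule sum_ordered_partitions[symmetric])
    fix G G' :: "nat \<Rightarrow> 'b list" assume *: "\<And>i. i < 2 \<Longrightarrow> G i = G' i"
    show "?h G = ?h G'" using *[of 0] *[of 1] by simp
  qed
  finally show ?thesis by simp
qed

theorem psb_pair_of_structure:
  assumes "(2::'a) \<noteq> 0"
  shows "psb_pair scale br (tensor_map scale M)"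
  unfolding psb_pair_def tensor_map_monomial
  using lie_algebra_br[OF assms] tensor_map_hom commutator_ideal_zero M_M M_br by simp

end

text \<open>An ordered partition of a one-element set selects one block. With a single letter in
  (iii) and (iv), this letter joins the word or acts on one argument, and (ii) leaves the other
  arguments unchanged.\<close>

theorem psb_structure_of_pair:
  assumes pair: "psb_pair scale br T"
  shows "psb_structure scale br (\<lambda>X. T (monomial scale X))"
proof -
  let ?M = "\<lambda>X. T (monomial scale X)"
  note pair = pair[unfolded psb_pair_def]
  have lie: "lie_algebra scale br" and T: "T \<in> tensor_hom scale" using pair by blast+
  note lie = lie[unfolded lie_algebra_def]
  interpret vector_space scale using lie by blast
  have br1: "lin (br x)" and br2: "lin (\<lambda>x. br x y)" and br0: "br x x = 0"
    and jac: "br x (br y z) + br y (br z x) + br z (br x y) = 0" for x y z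
    using lie by blast+
  have anti: "br x y = - br y x" for x y
  proof -
    \<comment> \<open>Polarization of \<open>br x x = 0\<close>.\<close>
    have "br (x + y) (x + y) = br x x + br x y + (br y x + br y y)"
      by (simp add: lin_add[OF br1] lin_add[OF br2] add.assoc)
    then have "br x y + br y x = 0" by (simp add: br0)
    then show ?thesis by (simp add: eq_neg_iff_add_eq_0)
  qed
  show ?thesis
  proof (rule psb_structure.intro[OF psb_operations.intro[OF vector_space_axioms]],
      rule psb_operations_axioms.intro, goal_cases)
    case 1
    show ?case by (rule br1)
  next
    case 2
    show ?case by (rule br2)
  next
    case 3
    show ?case unfolding monomial_def by (rule tensor_hom_tc(1)[OF T])
  next
    case (4 A B z)
    show ?case
    proof (rule linI)
      fix v w
      have "basis A * (basis [v + w] - basis [v] - basis [w]) * basis B \<in> LI"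
        by (rule LI_mult[OF generators_LI(1)])
      then have "basis (A @ (v + w) # B) - (basis (A @ v # B) + basis (A @ w # B)) \<in> LI"
        by (simp add: left_diff_distrib right_diff_distrib basis_mult algebra_simps)
      from tc_eqI[OF this] show "?M (A @ (v + w) # B) z = ?M (A @ v # B) z + ?M (A @ w # B) z"
        unfolding monomial_def by (simp only: tensor_hom_tc(2)[OF T])
    next
      fix c v
      have "basis A * (basis [scale c v] - fscale c (basis [v])) * basis B \<in> LI"
        by (rule LI_mult[OF generators_LI(2)])
      then have "basis (A @ scale c v # B) - fscale c (basis (A @ v # B)) \<in> LI"
        by (simp add: left_diff_distrib right_diff_distrib mult_fscale fscale_mult basis_mult)
      from tc_eqI[OF this] show "?M (A @ scale c v # B) z = scale c (?M (A @ v # B) z)"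
        unfolding monomial_def by (simp only: tensor_hom_tc(3)[OF T])
    qed
  next
    case 5
    show ?case using pair by blast
  next
    case 6
    have M_Nil: "?M [] z = z" for z using pair by blast
    have MM: "?M X (?M Y z) = (\<Sum>J\<in>ordered_partitions (Suc (length Y)) (length X).
        ?M (nths X (J ! 0) @ map (\<lambda>k. ?M (nths X (J ! Suc k)) (Y ! k)) [0..<length Y]) z)" for X Y z
      using pair by blast
    have Mbr: "?M X (br x y) = (\<Sum>J\<in>ordered_partitions 2 (length X).
           br (?M (nths X (J ! 0)) x) (?M (nths X (J ! 1)) y))" for X x y
      using pair by blast
    have words1: "(\<Sum>\<phi>\<in>words W 1. f \<phi>) =
        (\<Sum>a\<in>W. f [a])" for W :: "nat set" and f :: "nat list \<Rightarrow> 'b"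
      using sum_words_Suc[of f W 0] by simp
    show ?case
    proof (rule psb_structure_axioms.intro, goal_cases)
      case (1 A x y B z)
      have ring: "ring TA" by (rule ring_TA)
      let ?gen = "monomial scale [x, y] \<ominus>\<^bsub>TA\<^esub> monomial scale [y, x]
          \<ominus>\<^bsub>TA\<^esub> monomial scale [br x y]"
      let ?S = "{monomial scale [x, y] \<ominus>\<^bsub>TA\<^esub> monomial scale [y, x]
          \<ominus>\<^bsub>TA\<^esub> monomial scale [br x y] | x y. True}"
      have S: "?S \<subseteq> carrier TA" by (auto simp: monomial_def tc_minus)
      interpret K: ideal "commutator_ideal scale br" TA
        unfolding commutator_ideal_def by (rule ring.genideal_ideal[OF ring S])
      have "?gen \<in> commutator_ideal scale br"
        unfolding commutator_ideal_def using ring.genideal_self[OF ring S] by blast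
      \<comment> \<open>Multiplying by the monomials of \<open>A\<close> and \<open>B\<close> places
        the commutator inside a word without leaving the ideal.\<close>
      then have "tc (basis A) \<otimes>\<^bsub>TA\<^esub> ?gen \<otimes>\<^bsub>TA\<^esub> tc (basis B)
          \<in> commutator_ideal scale br"
        by (intro K.I_l_closed K.I_r_closed) simp_all
      moreover have "tc (basis A) \<otimes>\<^bsub>TA\<^esub> ?gen \<otimes>\<^bsub>TA\<^esub> tc (basis B) =
          tc (basis (A @ [x, y] @ B) - basis (A @ [y, x] @ B) - basis (A @ [br x y] @ B))"
        by (simp add: monomial_def tc_minus tc_mult left_diff_distrib right_diff_distrib basis_mult)
      ultimately have "T (tc (basis (A @ [x, y] @ B) - basis (A @ [y, x] @ B) - basis (A @ [br x y] @ B)))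
          z = 0"
        using pair by simp
      then show ?case unfolding monomial_def by (simp only: tensor_hom_minus[OF T] right_minus_eq)
    next
      case (2 x Y z)
      let ?m = "length Y"
      let ?h = "\<lambda>G. ?M (G 0 @ map (\<lambda>k. ?M (G (Suc k)) (Y ! k)) [0..<?m]) z"
      have cong: "?h G = ?h G'" if *: "\<And>i. i < Suc ?m \<Longrightarrow>
          G i = G' i" for G G' :: "nat \<Rightarrow> 'b list"
      proof -
        have "map (\<lambda>k. ?M (G (Suc k)) (Y ! k)) [0..<?m] =
            map (\<lambda>k. ?M (G' (Suc k)) (Y ! k)) [0..<?m]"
          by (rule map_cong) (simp_all add: *)
        then show ?thesis using *[of 0] by (simp only: zero_less_Suc)
      qed
      have "?M [x] (?M Y z) = (\<Sum>\<phi>\<in>words {..<Suc ?m} (length [x]). ?h (pick \<phi> [x]))"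
        unfolding MM by (rule sum_ordered_partitions[OF cong])
      also have "\<dots> = (\<Sum>a<Suc ?m. ?h (pick [a] [x]))"
          using words1[of "\<lambda>\<phi>. ?h (pick \<phi> [x])"] by simp
      also have "\<dots> = ?h (pick [0] [x]) + (\<Sum>k<?m. ?h (pick [Suc k] [x]))"
        by (rule sum.lessThan_Suc_shift)
      also have "?h (pick [0] [x]) = ?M (x # Y) z"
        by (simp add: pick_singleton M_Nil map_nth)
      also have "(\<Sum>k<?m. ?h (pick [Suc k] [x])) = (\<Sum>k<?m. ?M (Y[k := ?M [x] (Y ! k)]) z)"
      proof (rule sum.cong[OF refl])
        fix k assume "k \<in> {..<?m}"
        have "map (\<lambda>j. ?M (pick [Suc k] [x] (Suc j)) (Y ! j)) [0..<?m] = Y[k := ?M [x] (Y ! k)]"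
          by (rule nth_equalityI) (auto simp: pick_singleton M_Nil nth_list_update)
        then show "?h (pick [Suc k] [x]) = ?M (Y[k := ?M [x] (Y ! k)]) z"
          by (simp add: pick_singleton)
      qed
      finally show ?case .
    next
      case (3 x a b)
      let ?h = "\<lambda>G. br (?M (G 0) a) (?M (G 1) b)"
      have "?M [x] (br a b) = (\<Sum>\<phi>\<in>words {..<2::nat} (length [x]). ?h (pick \<phi> [x]))"
        unfolding Mbr by (rule sum_ordered_partitions) simp
      also have "\<dots> = (\<Sum>k<(2::nat). ?h (pick [k] [x]))"
          using words1[of "\<lambda>\<phi>. ?h (pick \<phi> [x])"] by simp
      also have "\<dots> = br (?M [x] a) b + br a (?M [x] b)"
        by (simp add: numeral_2_eq_2 pick_singleton M_Nil)
      finally show ?case .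
    next
      case (4 x y)
      show ?case by (rule anti)
    next
      case (5 x y z)
      have "br y (br z x) = - br y (br x z)" using anti[of z x] lin_minus[OF br1] by simp
      moreover have "br z (br x y) = - br (br x y) z" by (rule anti)
      ultimately show ?case using jac[of x y z] by (simp add: algebra_simps)
    qed
  qed
qed

section \<open>The correspondence\<close>

definition pair_of_algebra ::
  "('k::field \<Rightarrow> 'v::ab_group_add \<Rightarrow> 'v) \<Rightarrow> (nat \<Rightarrow> (nat ptree
      \<Rightarrow>\<^sub>0 'k) set \<Rightarrow> 'v list \<Rightarrow> 'v) \<Rightarrow>
    ('v \<Rightarrow> 'v \<Rightarrow> 'v) \<times> (('v list \<Rightarrow>\<^sub>0 'k) set \<Rightarrow>
        'v \<Rightarrow> 'v)" where
  "pair_of_algebra scale \<rho> =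
    ((\<lambda>x y. \<rho> 2 (psb_class 2 (cherry (leaf 1) (leaf 2))) [x, y]),
     tensor_map scale (\<lambda>X z. \<rho> (length X + 1) (psb_class (length X +
         1) (corolla (length X))) (X @ [z])))"

lemma pair_of_algebra_alg:
  assumes "vector_space scale" "operad_algebra PSB scale \<rho>"
  defines "r \<equiv> \<lambda>n x. \<rho> n (psb_coset n x)"
  shows "pair_of_algebra scale \<rho> = (lw_algebra.alg_br r, tensor_map scale (lw_algebra.alg_M r))"
proof -
  interpret lw_algebra scale r
    unfolding r_def by (rule lw_algebra_of_operad_algebra[OF assms(1,2)])
  have "(\<lambda>x y. \<rho> 2 (psb_class 2 (cherry (leaf 1) (leaf 2))) [x, y]) = alg_br"
    by (intro ext) (simp only: alg_br_def, simp only: r_def psb_class_def)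
  moreover have "(\<lambda>X z. \<rho> (length X + 1) (psb_class (length X +
      1) (corolla (length X))) (X @ [z])) = alg_M"
    by (intro ext) (simp only: alg_M_def, simp only: r_def psb_class_def)
  ultimately show ?thesis by (simp only: pair_of_algebra_def)
qed

text \<open>By \<open>r_basis\<close> both algebras evaluate every tree with the same two
  operations; equality of \<open>alg_M\<close> is recovered from \<open>tensor_map\<close> on
  monomials.\<close>

lemma inj_on_pair_of_algebra:
  fixes scale :: "'k::field \<Rightarrow> 'v::ab_group_add \<Rightarrow> 'v"
  assumes V: "vector_space scale"
  shows "inj_on (pair_of_algebra scale) {\<rho>. operad_algebra PSB scale \<rho>}"
proof (rule inj_onI, clarify)
  fix \<rho> \<rho>' assume \<rho>: "operad_algebra PSB scale \<rho>"
      and \<rho>': "operad_algebra PSB scale \<rho>'"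
    and eq: "pair_of_algebra scale \<rho> = pair_of_algebra scale \<rho>'"
  interpret A: lw_algebra scale "\<lambda>n x. \<rho> n (psb_coset n x)"
    by (rule lw_algebra_of_operad_algebra[OF V \<rho>])
  interpret B: lw_algebra scale "\<lambda>n x. \<rho>' n (psb_coset n x)"
    by (rule lw_algebra_of_operad_algebra[OF V \<rho>'])
  have br: "A.alg_br = B.alg_br" and T: "tensor_map scale A.alg_M = tensor_map scale B.alg_M"
    using eq unfolding pair_of_algebra_alg[OF V \<rho>] pair_of_algebra_alg[OF V \<rho>'] by simp_all
  have M: "A.alg_M = B.alg_M"
    using A.tensor_map_monomial B.tensor_map_monomial T by (intro ext) metis
  show "\<rho> = \<rho>'"
  proof (rule operad_algebra_eqI[OF V \<rho> \<rho>'])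
    fix n t assume t: "t \<in> LW_trees n"
    then have b: "(basis t :: nat ptree \<Rightarrow>\<^sub>0 'k) \<in> Ops LW n" by (rule basis_in_LW)
    show "\<rho> n (psb_coset n (basis t)) = \<rho>' n (psb_coset n (basis t))"
    proof
      fix xs
      show "\<rho> n (psb_coset n (basis t)) xs = \<rho>' n (psb_coset n (basis t)) xs"
      proof (cases "length xs = n")
        case True
        then show ?thesis using A.r_basis[OF t True] B.r_basis[OF t True] br M by simp
      next
        case False
        then show ?thesis using A.r_length[OF b False] B.r_length[OF b False] by simp
      qed
    qed
  qed
qed

text \<open>The algebra is evaluation by \<open>br\<close> and the values of \<open>T\<close> on
  monomials, descended to the quotient; these values determine \<open>T\<close>, so the given pair
  comes back.\<close>

lemma pair_of_algebra_surj:
  fixes scale :: "'k::field_char_0 \<Rightarrow> 'v::ab_group_add \<Rightarrow> 'v"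
  assumes V: "vector_space scale" and pair: "psb_pair scale br T"
  shows "\<exists>\<rho>. operad_algebra PSB scale \<rho> \<and> pair_of_algebra scale \<rho> = (br, T)"
proof -
  interpret S: psb_structure scale br "\<lambda>X. T (monomial scale X)"
    by (rule psb_structure_of_pair[OF pair])
  interpret A: lw_algebra scale S.ev_alg by (rule S.lw_algebra_ev_alg)
  obtain \<rho> where \<rho>: "operad_algebra PSB scale \<rho>"
    and r: "\<And>n x. x \<in> Ops LW n \<Longrightarrow> \<rho> n (psb_coset n x) = S.ev_alg n x"
    using A.ex_operad_algebra by blast
  have T: "T \<in> tensor_hom scale" using pair by (simp add: psb_pair_def)
  have "(\<lambda>x y. \<rho> 2 (psb_class 2 (cherry (leaf 1) (leaf 2))) [x, y]) = br"
    by (intro ext)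
      (simp only: psb_class_def r[OF basis_in_LW[OF cherry_in_LW_trees(1)]] S.ev_alg_def, simp add:
          S.lcomb_basis)
  moreover have "(\<lambda>X z. \<rho> (length X + 1) (psb_class (length X +
      1) (corolla (length X))) (X @ [z])) =
      (\<lambda>X. T (monomial scale X))"
  proof (intro ext)
    fix X and z :: 'v
    have "map (\<lambda>i. (X @ [z]) ! (i - 1)) [1..<Suc (length X)] = X"
      by (rule nth_equalityI) (simp_all add: nth_append del: upt_Suc)
    then have "S.ev (\<lambda>i. (X @ [z]) ! (i - 1)) (corolla (length X)) = T (monomial scale X) z"
      by (simp add: corolla_def comp_def del: upt_Suc)
    then show "\<rho> (length X + 1) (psb_class (length X + 1) (corolla (length X))) (X @ [z]) =
        T (monomial scale X) z"
      unfolding psb_class_def r[OF basis_in_LW[OF corolla_in_LW_trees]] S.ev_alg_def by simp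
  qed
  moreover have "tensor_map scale (\<lambda>X. T (monomial scale X)) = T"
    by (rule S.tensor_hom_eqI[OF S.tensor_map_hom T S.tensor_map_monomial])
  ultimately have "pair_of_algebra scale \<rho> = (br, T)" by (simp only: pair_of_algebra_def)
  with \<rho> show ?thesis by blast
qed

theorem proposition14:
  fixes scale :: "'k::field_char_0 \<Rightarrow> 'v::ab_group_add \<Rightarrow> 'v"
  assumes "vector_space scale"
  shows "\<exists>F. bij_betw F
      {\<rho>. operad_algebra (PSB :: ('k, (nat ptree \<Rightarrow>\<^sub>0 'k) set) operad) scale \<rho>}
      {(br, T). psb_pair scale br T} \<and>
    (\<forall>\<rho> br T. operad_algebra PSB scale \<rho> \<longrightarrow> F \<rho> =
        (br, T) \<longrightarrow>
      (\<forall>x y. br x y = \<rho> 2 (psb_class 2 (cherry (leaf 1) (leaf 2))) [x, y]) \<and>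
      (\<forall>X z. T (monomial scale X) z =
         \<rho> (length X + 1) (psb_class (length X + 1) (corolla (length X))) (X @ [z])))"
proof (intro exI conjI allI impI)
  show "bij_betw (pair_of_algebra scale) {\<rho>. operad_algebra PSB scale \<rho>} {(br, T). psb_pair scale
      br T}"
    unfolding bij_betw_def
  proof (intro conjI equalityI subsetI)
    show "inj_on (pair_of_algebra scale) {\<rho>. operad_algebra PSB scale \<rho>}"
      by (rule inj_on_pair_of_algebra[OF assms])
  next
    fix P assume "P \<in> pair_of_algebra scale ` {\<rho>. operad_algebra PSB scale \<rho>}"
    then obtain \<rho> where \<rho>: "operad_algebra PSB scale \<rho>" and P: "P =
        pair_of_algebra scale \<rho>" by blast
    interpret lw_algebra scale "\<lambda>n x. \<rho> n (psb_coset n x)"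
      by (rule lw_algebra_of_operad_algebra[OF assms \<rho>])
    interpret psb_structure scale alg_br alg_M by (rule psb_structure_alg)
    show "P \<in> {(br, T). psb_pair scale br T}"
      unfolding P pair_of_algebra_alg[OF assms \<rho>] using psb_pair_of_structure by simp
  next
    fix P assume "P \<in> {(br, T). psb_pair scale br T}"
    then show "P \<in> pair_of_algebra scale ` {\<rho>. operad_algebra PSB scale \<rho>}"
      using pair_of_algebra_surj[OF assms, of "fst P" "snd P"] by (auto simp: image_iff split_def intro: sym)
  qed
next
  fix \<rho> br T x y X z
  assume \<rho>: "operad_algebra PSB scale \<rho>" and F: "pair_of_algebra scale \<rho> = (br, T)"
  interpret lw_algebra scale "\<lambda>n x. \<rho> n (psb_coset n x)"
    by (rule lw_algebra_of_operad_algebra[OF assms \<rho>])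
  have br: "br = alg_br" and T: "T = tensor_map scale alg_M"
    using F unfolding pair_of_algebra_alg[OF assms \<rho>] by simp_all
  show "br x y = \<rho> 2 (psb_class 2 (cherry (leaf 1) (leaf 2))) [x, y]"
    by (simp only: br alg_br_def psb_class_def)
  show "T (monomial scale X) z =
      \<rho> (length X + 1) (psb_class (length X + 1) (corolla (length X))) (X @ [z])"
    by (simp only: T tensor_map_monomial alg_M_def psb_class_def)
qed

end
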